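(* Let $P$ be a finite poset, let $r \geq 2$ and let $\imath:[r]\to[2r]$ be strictly increasing. Then the following are equivalent: (1) the relation $\preceq_\imath$ on $P_r$ is reflexive; (2) the clique complex $\Delta(G_\imath(P_r))$ is a (geometric) subdivision of the order complex $\Delta(P)$; (3) the clique complex $\Delta(G_\imath(P_r))$ is homeomorphic to $\Delta(P)$.
   Context: For a natural number $n$, $[n]=\{1,\dots,n\}$. For a finite poset $(P,\leq)$ and $r\geq 1$, $P_r$ denotes the set of all $r$-multichains $\mathfrak{p}: p_1\leq p_2\leq\cdots\leq p_r$ of elements of $P$. For a strictly increasing map $\imath:[r]\to[2r]$ define a binary relation $\preceq_\imath$ on $P_r$: for $\mathfrak{p}: p_1\leq\cdots\leq p_r$ and $\mathfrak{q}: q_1\leq\cdots\leq q_r$, $\mathfrak{p}\preceq_\imath\mathfrak{q}$ holds iff for all $t,s\in[r]$ we have $p_t\geq q_s$ whenever $s\leq \imath(t)-t$, and $p_t\leq q_s$ whenever $s>\imath(t)-t$. $G_\imath(P_r)$ is the undirected graph with vertex set $P_r$ and edge set $\{\{\mathfrak{p},\mathfrak{q}\}\subseteq P_r : \mathfrak{p}\preceq_\imath\mathfrak{q},\ \mathfrak{p}\neq\mathfrak{q}\}$, and $\Delta(G_\imath(P_r))$ is its clique complex (all subsets of $P_r$ forming cliques). $\Delta(P)$ is the order complex of $P$ (all chains of $P$). "Subdivision" is meant in the sense of geometric subdivision, and "homeomorphic" refers to geometric realizations. *)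

theory Defs
  imports "HOL-Analysis.Analysis" "HOL-Library.Function_Algebras"
begin

section \<open>Multichains\<close>

text \<open>An \<open>r\<close>-multichain \<open>p\<^sub>1 \<le> \<dots> \<le> p\<^sub>r\<close> is a function on \<open>{1..r}\<close>, extensional so that
  equality of functions is equality of multichains.\<close>

definition multichains :: "nat \<Rightarrow> 'a::order set \<Rightarrow> (nat \<Rightarrow> 'a) set" where
  "multichains r P = {p \<in> {1..r} \<rightarrow>\<^sub>E P. mono_on {1..r} p}"

text \<open>The subtraction is on \<open>nat\<close>, but for a strictly increasing \<open>\<iota>\<close> from \<open>{1..r}\<close> to
  \<open>{1..2 * r}\<close> we have \<open>\<iota> t \<ge> t\<close>, so nothing is truncated.\<close>

definition multichain_rel ::
  "nat \<Rightarrow> (nat \<Rightarrow> nat) \<Rightarrow> (nat \<Rightarrow> 'a::order) \<Rightarrow> (nat \<Rightarrow> 'a) \<Rightarrow> bool" where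
  "multichain_rel r \<iota> p q \<longleftrightarrow>
     (\<forall>t\<in>{1..r}. \<forall>s\<in>{1..r}. (s \<le> \<iota> t - t \<longrightarrow> p t \<ge> q s) \<and> (s > \<iota> t - t \<longrightarrow> p t \<le> q s))"

definition multichain_edges :: "nat \<Rightarrow> (nat \<Rightarrow> nat) \<Rightarrow> 'a::order set \<Rightarrow> (nat \<Rightarrow> 'a) set set" where
  "multichain_edges r \<iota> P =
     {{p, q} | p q. p \<in> multichains r P \<and> q \<in> multichains r P \<and> multichain_rel r \<iota> p q \<and> p \<noteq> q}"

section \<open>Abstract simplicial complexes\<close>

text \<open>Complexes are given by their sets of faces; the empty face is included.\<close>

definition order_complex :: "'a::order set \<Rightarrow> 'a set set" where
  "order_complex P = {C. C \<subseteq> P \<and> Complete_Partial_Order.chain (\<le>) C}"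

definition clique_complex :: "'v set \<Rightarrow> 'v set set \<Rightarrow> 'v set set" where
  "clique_complex V E = {C. C \<subseteq> V \<and> (\<forall>u\<in>C. \<forall>v\<in>C. u \<noteq> v \<longrightarrow> {u, v} \<in> E)}"

definition multichain_complex :: "nat \<Rightarrow> (nat \<Rightarrow> nat) \<Rightarrow> 'a::order set \<Rightarrow> (nat \<Rightarrow> 'a) set set" where
  "multichain_complex r \<iota> P = clique_complex (multichains r P) (multichain_edges r \<iota> P)"

section \<open>Geometric realizations and subdivisions\<close>

text \<open>The pointwise vector space structure on functions makes affine and convex hulls available
  in the space \<open>'v \<Rightarrow> real\<close>, which is the ambient space of a complex with vertices in \<open>'v\<close>.\<close>

instantiation "fun" :: (type, real_vector) real_vector
begin

definition scaleR_fun :: "real \<Rightarrow> ('a \<Rightarrow> 'b) \<Rightarrow> 'a \<Rightarrow> 'b" where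
  "scaleR_fun c f = (\<lambda>x. c *\<^sub>R f x)"

instance
  by standard (simp_all add: scaleR_fun_def fun_eq_iff scaleR_add_right scaleR_add_left)

end

text \<open>\<open>\<phi>\<close> places the vertices of the abstract complex \<open>K\<close> so that the convex hulls of the faces
  are simplices forming a geometric simplicial complex.\<close>

definition realizes :: "('v \<Rightarrow> 'e::real_vector) \<Rightarrow> 'v set set \<Rightarrow> bool" where
  "realizes \<phi> K \<longleftrightarrow>
     inj_on \<phi> (\<Union>K) \<and>
     (\<forall>\<sigma>\<in>K. \<not> affine_dependent (\<phi> ` \<sigma>)) \<and>
     (\<forall>\<sigma>\<in>K. \<forall>\<tau>\<in>K. convex hull (\<phi> ` \<sigma>) \<inter> convex hull (\<phi> ` \<tau>) = convex hull (\<phi> ` (\<sigma> \<inter> \<tau>)))"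

definition underlying_space :: "('v \<Rightarrow> 'e::real_vector) \<Rightarrow> 'v set set \<Rightarrow> 'e set" where
  "underlying_space \<phi> K = (\<Union>\<sigma>\<in>K. convex hull (\<phi> ` \<sigma>))"

definition std_vertex :: "'v \<Rightarrow> 'v \<Rightarrow> real" where
  "std_vertex v = indicator {v}"

text \<open>As a subset of \<open>'v \<Rightarrow> real\<close> this carries the product topology, which for finite complexes
  (the only ones used here) is the usual Euclidean topology of the realization.\<close>

definition geometric_realization :: "'v set set \<Rightarrow> ('v \<Rightarrow> real) set" where
  "geometric_realization K = underlying_space std_vertex K"

text \<open>A finite complex \<open>K'\<close> is a geometric subdivision of \<open>K\<close> if it can be realized with the same
  underlying space as \<open>K\<close> and with every simplex contained in a simplex of \<open>K\<close>.\<close>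

definition geometric_subdivision :: "'w set set \<Rightarrow> 'v set set \<Rightarrow> bool" where
  "geometric_subdivision K' K \<longleftrightarrow>
     (\<exists>\<phi> :: 'w \<Rightarrow> ('v \<Rightarrow> real).
        realizes \<phi> K' \<and>
        underlying_space \<phi> K' = geometric_realization K \<and>
        (\<forall>\<sigma>\<in>K'. \<exists>\<tau>\<in>K. convex hull (\<phi> ` \<sigma>) \<subseteq> convex hull (std_vertex ` \<tau>)))"

end

theory Submission
  imports Defs "HOL-Homology.Invariance_of_Domain"
begin

text \<open>
  A strictly increasing \<open>\<iota>\<close> is the same as a lattice path \<open>L\<close> from \<open>(0, 0)\<close> to \<open>(r, r)\<close>. Describing a
  multichain \<open>p\<close> by the numbers \<open>weight r a p\<close> of its entries below \<open>a\<close>, the relation between \<open>p\<close> and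
  \<open>q\<close> becomes \<open>(weight r a p, weight r a q) \<in> L\<close> for all \<open>a\<close>. Hence it is reflexive if and only if
  \<open>P\<close> is an antichain or \<open>L\<close> contains the diagonal.

  If \<open>L\<close> contains the diagonal, send \<open>p\<close> to the barycenter of its entries. Every point of the order
  complex is a convex combination of the images of a unique clique: the first element of the clique
  can be read off from the point, and one peels it off. A subdivision clearly yields a homeomorphism.

  If \<open>L\<close> misses a diagonal point and \<open>P\<close> is not an antichain, let \<open>n\<close> be the largest size of a chain
  of \<open>P\<close>; a homeomorphism would make it the largest size of a clique. If two different diagonal points
  on \<open>L\<close> share a row or column of \<open>L\<close>, there is a clique of size \<open>n + 1\<close>. Otherwise the largest
  cliques have size \<open>5\<close> (size \<open>3\<close> for \<open>n = 2\<close>), which forces \<open>n = 5\<close>. In that case compare the number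
  of top-dimensional simplices containing a simplex of codimension one, whose maximum is a
  topological invariant when it is at least three, by invariance of domain: it is larger for the
  clique complex than for the order complex.
\<close>

section \<open>Topological invariants of simplicial complexes\<close>

text \<open>The bound five is 3 + 3 - 1. Where the path leaves the diagonal it provides three
  pairwise related numbers i, i + 1, k, and where it returns it provides j, m - 1, m. A clique can
  run through the second triple in its weights at one element of P and afterwards through the first
  triple in its weights at a smaller element, the two runs sharing one multichain. Dimension cannot
  settle n = 5, and the number of top simplices at a face of codimension one is topologically
  visible only from three on, since two pages meet along their spine like two halves of one simplex.
  The comparison works because some face of the clique complex has at least two extensions more than
  the best chain, hence at least three. Dimension and branching are local, so both follow from
  invariance of domain and no homology group of the complexes has to be computed. In the reflexive
  case everything is expressed by lower sums: for the barycenter of a multichain they are its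
  weights divided by r, so a point of the realization is a function of averaged weights on
  P.\<close>

definition fin_seqs :: "nat \<Rightarrow> (nat \<Rightarrow> real) set" where
  "fin_seqs n = {x. \<forall>i\<ge>n. x i = 0}"

text \<open>All Euclidean spaces are nested subspaces of the single type
  \<open>nat \<Rightarrow> real\<close>, so that dimension is a number rather than a type. The
  hypothesis n \<le> m admits a domain of larger dimension; that this is impossible for a nonempty
  domain and n < m is drawn as a consequence below.\<close>

lemma invariance_of_domain_fin_seqs:
  fixes f :: "(nat \<Rightarrow> real) \<Rightarrow> (nat \<Rightarrow> real)"
  assumes "n \<le> m" "openin (top_of_set (fin_seqs m)) U"
    and "continuous_on U f" "f ` U \<subseteq> fin_seqs n" "inj_on f U"
  shows "openin (top_of_set (fin_seqs n)) (f ` U)"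
proof -
  have E: "Euclidean_space k = top_of_set (fin_seqs k)" for k
    by (simp add: Euclidean_space_def euclidean_product_topology fin_seqs_def)
  have U: "U \<subseteq> fin_seqs m"
    using assms(2) openin_imp_subset by blast
  have "continuous_map (subtopology (Euclidean_space m) U) (Euclidean_space n) f"
    using assms(3,4) U unfolding E subtopology_subtopology
    by (simp add: Int_absorb1 continuous_map_in_subtopology image_subset_iff_funcset)
  then show ?thesis
    using invariance_of_domain_Euclidean_space_gen[OF assms(1), of U f] assms by (simp add: E)
qed

text \<open>The form in which openness gets contradicted: an open set cannot lie in a half space and
  touch its boundary, since the point can be pushed across in coordinate n.\<close>

lemma openin_fin_seqs_perturb:
  assumes "openin (top_of_set (fin_seqs m)) S" "p \<in> S" "n < m"
  obtains e where "e > 0" "p(n := p n - e) \<in> S"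
proof -
  obtain W where W: "open W" "S = fin_seqs m \<inter> W"
    using assms(1) by (auto simp: openin_open)
  define g where "g = (\<lambda>t::real. p(n := p n - t))"
  have "continuous_on UNIV (\<lambda>t. g t i)" for i
    by (cases "i = n") (auto simp: g_def intro!: continuous_intros)
  then have "continuous_on UNIV g"
    by (rule continuous_on_coordinatewise_then_product)
  then have "open (g -` W)"
    using W(1) by (simp add: continuous_on_open_vimage)
  moreover have "0 \<in> g -` W" using assms W by (auto simp: g_def)
  ultimately obtain e where e: "e > 0" "ball 0 e \<subseteq> g -` W"
    by (meson openE)
  then have "g (e/2) \<in> W" by (auto simp: dist_real_def subset_iff)
  moreover have "g (e/2) \<in> fin_seqs m"
    using assms W(2) by (auto simp: g_def fin_seqs_def)
  ultimately show ?thesis using e(1) W(2) by (intro that[of "e/2"]) (auto simp: g_def)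
qed

text \<open>If n < m, the image would be open in the larger space although its coordinate n vanishes
  identically.\<close>

lemma invariance_of_dimension_fin_seqs:
  fixes f :: "(nat \<Rightarrow> real) \<Rightarrow> (nat \<Rightarrow> real)"
  assumes "openin (top_of_set (fin_seqs m)) U" "U \<noteq> {}"
    and "continuous_on U f" "f ` U \<subseteq> fin_seqs n" "inj_on f U"
  shows "m \<le> n"
proof (rule ccontr)
  assume "\<not> m \<le> n"
  then have "n < m" by simp
  obtain u where u: "u \<in> U" using assms(2) by blast
  have sub: "f ` U \<subseteq> fin_seqs m"
    using assms(4) \<open>n < m\<close> unfolding fin_seqs_def by fastforce
  have "openin (top_of_set (fin_seqs m)) (f ` U)"
    by (rule invariance_of_domain_fin_seqs) (use assms sub in auto)
  then obtain e where e: "e > 0" "(f u)(n := f u n - e) \<in> f ` U"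
    using openin_fin_seqs_perturb u \<open>n < m\<close> by (metis imageI)
  then have "f u n - e = 0" using assms(4) unfolding fin_seqs_def by (metis (mono_tags, lifting) fun_upd_same le_refl mem_Collect_eq subset_iff)
  moreover have "f u n = 0" using u assms(4) by (auto simp: fin_seqs_def)
  ultimately show False using e by simp
qed

text \<open>A chart \<open>c\<close> of \<open>T\<close> turns a map on an open part of
  \<open>T\<close> into a map on an open part of Euclidean space, to which the two invariance
  results apply.\<close>

lemma chart_transfer:
  assumes c: "homeomorphism T I c c'" "openin (top_of_set (fin_seqs n)) I"
    and A: "openin (top_of_set T) A" and g: "continuous_on A g" "inj_on g A"
  shows "openin (top_of_set (fin_seqs n)) (c ` A)" "continuous_on (c ` A) (g \<circ> c')"
    "inj_on (g \<circ> c') (c ` A)" "(g \<circ> c') ` c ` A = g ` A"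
proof -
  have AT: "A \<subseteq> T" using A by (rule openin_imp_subset)
  then have cA: "c ` A \<subseteq> I" using homeomorphism_image1[OF c(1)] by blast
  have "(\<lambda>x. c' (c x)) ` A = (\<lambda>x. x) ` A"
    using homeomorphism_apply1[OF c(1)] AT by (intro image_cong) auto
  then have c'A: "c' ` c ` A = A" by (simp add: image_image)
  show "openin (top_of_set (fin_seqs n)) (c ` A)"
    using homeomorphism_imp_open_map[OF c(1) A] c(2) by (rule openin_trans)
  show "continuous_on (c ` A) (g \<circ> c')"
    using homeomorphism_cont2[OF c(1)] cA g(1) c'A
    by (intro continuous_on_compose) (auto intro: continuous_on_subset)
  have "inj_on c' (c ` A)"
    using cA homeomorphism_apply2[OF c(1)] by (intro inj_on_inverseI[of _ c]) auto
  then show "inj_on (g \<circ> c') (c ` A)" using g(2) by (intro comp_inj_on) (simp_all only: c'A)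
  show "(g \<circ> c') ` c ` A = g ` A" by (simp only: image_comp[symmetric] c'A)
qed

lemma openin_chart_image:
  assumes "homeomorphism T I c c'" "openin (top_of_set (fin_seqs n)) I"
    and "openin (top_of_set T) A" and "continuous_on A g" "inj_on g A" "g ` A \<subseteq> fin_seqs n"
  shows "openin (top_of_set (fin_seqs n)) (g ` A)"
  using invariance_of_domain_fin_seqs[OF order_refl chart_transfer(1-2)[OF assms(1-5)]]
    chart_transfer(3-4)[OF assms(1-5)] assms(6) by simp

lemma chart_dimension_le:
  assumes "homeomorphism T I c c'" "openin (top_of_set (fin_seqs n)) I"
    and "openin (top_of_set T) A" and "continuous_on A g" "inj_on g A" "g ` A \<subseteq> fin_seqs m" "A \<noteq> {}"
  shows "n \<le> m"
  using invariance_of_dimension_fin_seqs[OF chart_transfer(1)[OF assms(1-5)] _ chart_transfer(2)[OF assms(1-5)]]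
    chart_transfer(3-4)[OF assms(1-5)] assms(6,7) by simp

section \<open>Finite simplicial complexes in barycentric coordinates\<close>

definition supp :: "('v \<Rightarrow> real) \<Rightarrow> 'v set" where
  "supp x = {v. x v \<noteq> 0}"

locale finite_complex =
  fixes K :: "'v set set"
  assumes finite_vertices: "finite (\<Union>K)"
    and face_subset: "\<sigma> \<in> K \<Longrightarrow> \<tau> \<subseteq> \<sigma> \<Longrightarrow> \<tau> \<in> K"
begin

lemma finite_face: "\<sigma> \<in> K \<Longrightarrow> finite \<sigma>"
  using finite_vertices by (meson Union_upper finite_subset)

lemma finite_complex: "finite K"
  using finite_vertices by (simp add: finite_UnionD)

end

text \<open>With unit vectors as vertices a point is its own family of barycentric coordinates. This
  turns membership in realizations into conditions on coordinates and supports.\<close>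

lemma convex_hull_std_vertex:
  assumes "finite \<sigma>"
  shows "convex hull (std_vertex ` \<sigma>) = {x. (\<forall>v. x v \<ge> 0) \<and> supp x \<subseteq> \<sigma> \<and> sum x \<sigma> = 1}"
proof -
  have inj: "inj_on std_vertex \<sigma>"
    by (auto simp: inj_on_def std_vertex_def indicator_def fun_eq_iff)
  have ev: "(\<Sum>v\<in>\<sigma>. u v *\<^sub>R std_vertex v) w = (if w \<in> \<sigma> then u w else 0)" for u w
  proof -
    have "(\<Sum>v\<in>\<sigma>. u v *\<^sub>R std_vertex v) w = (\<Sum>v\<in>\<sigma>. u v * (if w = v then 1 else 0))"
      by (induction \<sigma> rule: infinite_finite_induct)
        (auto simp: scaleR_fun_def std_vertex_def indicator_def zero_fun_def plus_fun_def)
    also have "\<dots> = (if w \<in> \<sigma> then u w else 0)"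
      using assms by (simp add: if_distrib sum.delta' cong: if_cong)
    finally show ?thesis .
  qed
  have *: "convex hull (std_vertex ` \<sigma>) =
      {y. \<exists>u. (\<forall>v\<in>\<sigma>. 0 \<le> u v) \<and> sum u \<sigma> = 1 \<and> (\<Sum>v\<in>\<sigma>. u v *\<^sub>R std_vertex v) = y}"
    (is "?L = ?R")
  proof
    show "?L \<subseteq> ?R"
    proof
      fix y assume "y \<in> ?L"
      then obtain u where "\<forall>x\<in>std_vertex ` \<sigma>. 0 \<le> u x" "sum u (std_vertex ` \<sigma>) = 1"
        "(\<Sum>x\<in>std_vertex ` \<sigma>. u x *\<^sub>R x) = y"
        using assms by (auto simp: convex_hull_finite)
      then show "y \<in> ?R"
        using inj by (auto simp: sum.reindex intro!: exI[of _ "u \<circ> std_vertex"])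
    qed
    show "?R \<subseteq> ?L"
    proof (clarify)
      fix u :: "'a \<Rightarrow> real" assume "\<forall>v\<in>\<sigma>. 0 \<le> u v" "sum u \<sigma> = 1"
      then show "(\<Sum>v\<in>\<sigma>. u v *\<^sub>R std_vertex v) \<in> convex hull (std_vertex ` \<sigma>)"
        using assms by (intro convex_sum convex_convex_hull) (auto intro: hull_inc)
    qed
  qed
  show ?thesis
  proof (intro Set.set_eqI iffI)
    fix x assume "x \<in> convex hull (std_vertex ` \<sigma>)"
    then obtain u where "\<forall>v\<in>\<sigma>. 0 \<le> u v" "sum u \<sigma> = 1" "(\<Sum>v\<in>\<sigma>. u v *\<^sub>R std_vertex v) = x"
      using * by auto
    moreover from this(3) have "x = (\<lambda>w. if w \<in> \<sigma> then u w else 0)"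
      using ev by (auto simp: fun_eq_iff)
    ultimately show "x \<in> {x. (\<forall>v. x v \<ge> 0) \<and> supp x \<subseteq> \<sigma> \<and> sum x \<sigma> = 1}"
      by (auto simp: supp_def)
  next
    fix x assume x: "x \<in> {x. (\<forall>v. x v \<ge> 0) \<and> supp x \<subseteq> \<sigma> \<and> sum x \<sigma> = 1}"
    then have "(\<Sum>v\<in>\<sigma>. x v *\<^sub>R std_vertex v) = x"
      using ev by (auto simp: fun_eq_iff supp_def)
    with x show "x \<in> convex hull (std_vertex ` \<sigma>)"
      unfolding * by blast
  qed
qed

lemma sum_supp:
  assumes "finite A" "supp x \<subseteq> A"
  shows "sum x A = sum x (supp x)"
  using assms by (intro sum.mono_neutral_right) (auto simp: supp_def)

text \<open>\<open>supp x\<close> is the face whose open simplex contains \<open>x\<close>; the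
  realization is the disjoint union of the open simplices.\<close>

lemma mem_geometric_realization:
  assumes "finite_complex K"
  shows "x \<in> geometric_realization K \<longleftrightarrow>
    (\<forall>v. x v \<ge> 0) \<and> supp x \<in> K \<and> sum x (supp x) = 1"
proof -
  interpret finite_complex K by fact
  show ?thesis
  proof
    assume "x \<in> geometric_realization K"
    then obtain \<sigma> where "\<sigma> \<in> K" "x \<in> convex hull (std_vertex ` \<sigma>)"
      by (auto simp: geometric_realization_def underlying_space_def)
    then show "(\<forall>v. x v \<ge> 0) \<and> supp x \<in> K \<and> sum x (supp x) = 1"
      using convex_hull_std_vertex[OF finite_face] face_subset finite_face sum_supp
      by (metis (mono_tags, lifting) mem_Collect_eq)
  next
    assume x: "(\<forall>v. x v \<ge> 0) \<and> supp x \<in> K \<and> sum x (supp x) = 1"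
    then have "x \<in> convex hull (std_vertex ` supp x)"
      using convex_hull_std_vertex[OF finite_face] by blast
    with x show "x \<in> geometric_realization K"
      by (auto simp: geometric_realization_def underlying_space_def)
  qed
qed

section \<open>Open stars, books and their Euclidean charts\<close>

definition star :: "'v set set \<Rightarrow> 'v set \<Rightarrow> ('v \<Rightarrow> real) set" where
  "star K \<tau> = {x \<in> geometric_realization K. \<tau> \<subseteq> supp x}"

lemma openin_star:
  assumes "finite \<tau>"
  shows "openin (top_of_set (geometric_realization K)) (star K \<tau>)"
proof -
  have "open {x :: 'a \<Rightarrow> real. x v \<noteq> 0}" for v
  proof -
    have "open ((\<lambda>x :: 'a \<Rightarrow> real. x v) -` (- {0}))"
      by (intro open_vimage continuous_on_product_coordinates) auto
    then show ?thesis by (simp add: vimage_def)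
  qed
  then have "open (\<Inter>v\<in>\<tau>. {x :: 'a \<Rightarrow> real. x v \<noteq> 0})"
    using assms by (intro open_INT) auto
  moreover have "star K \<tau> = geometric_realization K \<inter> (\<Inter>v\<in>\<tau>. {x. x v \<noteq> 0})"
    by (auto simp: star_def supp_def)
  ultimately show ?thesis by (metis openin_open_Int)
qed

text \<open>The open neighbourhood of an open simplex \<open>\<tau>\<close> in a complex whose simplices strictly
  containing \<open>\<tau>\<close> are the \<open>insert u \<tau>\<close> with \<open>u \<in> A\<close>: an open book with spine \<open>\<tau>\<close> and one
  page for each element of \<open>A\<close>.\<close>

definition book :: "'v set \<Rightarrow> 'v set \<Rightarrow> ('v \<Rightarrow> real) set" where
  "book \<tau> A = {x. (\<forall>v. x v \<ge> 0) \<and> sum x (supp x) = 1 \<and>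
     (supp x = \<tau> \<or> (\<exists>u\<in>A. supp x = insert u \<tau>))}"

text \<open>Chart domain of a book with at most two pages. The first n coordinates are the spine
  coordinates except one, which is recovered from the total 1. The absolute value of the last
  coordinate is the page coordinate, and its sign names the page.\<close>

definition book_image :: "nat \<Rightarrow> real set \<Rightarrow> (nat \<Rightarrow> real) set" where
  "book_image n S = {z \<in> fin_seqs (Suc n). (\<forall>i<n. z i > 0) \<and> (\<Sum>i<n. z i) + \<bar>z n\<bar> < 1 \<and>
     (z n = 0 \<or> sgn (z n) \<in> S)}"

lemma continuous_on_coordinate [continuous_intros]:
  "continuous_on S (\<lambda>x :: 'v \<Rightarrow> real. x v)"
  by (rule continuous_on_subset[OF continuous_on_product_coordinates]) simp

text \<open>\<open>s\<close> puts the pages on the two sides of the hyperplane where coordinate n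
  vanishes, so its injectivity limits \<open>A\<close> to two elements. The formula for that
  coordinate is part of the conclusion because it tells the spine from the pages.\<close>

lemma book_chart:
  fixes \<tau> A :: "'v set" and s :: "'v \<Rightarrow> real"
  assumes fin: "finite \<tau>" "finite A" and disj: "\<tau> \<inter> A = {}" and card: "card \<tau> = Suc n"
    and s: "s ` A \<subseteq> {1, -1}" "inj_on s A"
  shows "\<exists>c c'. homeomorphism (book \<tau> A) (book_image n (s ` A)) c c' \<and>
    (\<forall>x. c x n = (\<Sum>v\<in>A. s v * x v))"
proof -
  obtain v0 where v0: "v0 \<in> \<tau>" using card by fastforce
  have "card (\<tau> - {v0}) = n" using card v0 fin by simp
  then obtain e where e: "bij_betw e {..<n} (\<tau> - {v0})"
    using fin by (metis atLeast0LessThan ex_bij_betw_nat_finite finite_Diff)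
  define c where "c = (\<lambda>x :: 'v \<Rightarrow> real. \<lambda>i. if i < n then x (e i) else if i = n then \<Sum>v\<in>A. s v * x v else 0)"
  \<comment> \<open>The maximum gives the page coordinate to the vertex whose sign matches that of
    \<open>z n\<close>, and zero to any other one.\<close>
  define c' where "c' = (\<lambda>z :: nat \<Rightarrow> real. \<lambda>v. if v = v0 then 1 - (\<Sum>i<n. z i) - \<bar>z n\<bar>
     else if v \<in> \<tau> then z (the_inv_into {..<n} e v)
     else if v \<in> A then max 0 (s v * z n) else 0)"
  have inv: "the_inv_into {..<n} e (e i) = i" if "i < n" for i
    using e that by (auto simp: bij_betw_def the_inv_into_f_f)
  have einv: "e (the_inv_into {..<n} e v) = v" "the_inv_into {..<n} e v < n" if "v \<in> \<tau>" "v \<noteq> v0" for v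
    using e that by (auto simp: bij_betw_def f_the_inv_into_f intro: the_inv_into_into[THEN lessThan_iff[THEN iffD1]])
  have e_mem: "e i \<in> \<tau>" "e i \<noteq> v0" if "i < n" for i
    using e that by (auto simp: bij_betw_def)
  have sum_e: "(\<Sum>v\<in>\<tau>. x v) = x v0 + (\<Sum>i<n. x (e i))" for x :: "'v \<Rightarrow> real"
    using sum.reindex_bij_betw[OF e, of x] v0 fin by (simp add: sum.remove)
  have s_abs: "\<bar>s v\<bar> = 1" "s v * s v = 1" if "v \<in> A" for v using s(1) that by auto
  have page: "(\<Sum>v\<in>A. s v * x v) = s u * x u" if "supp x = insert u \<tau>" "u \<in> A" for x u
  proof -
    have "(\<Sum>v\<in>A. s v * x v) = (\<Sum>v\<in>{u}. s v * x v)"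
      using that fin disj by (intro sum.mono_neutral_right) (auto simp: supp_def)
    then show ?thesis by simp
  qed
  have spine: "(\<Sum>v\<in>A. s v * x v) = 0" if "supp x = \<tau>" for x
    using that disj by (intro sum.neutral) (auto simp: supp_def)
  have c_image: "c x \<in> book_image n (s ` A)" and c_inv: "c' (c x) = x" if x: "x \<in> book \<tau> A" for x
  proof -
    have nonneg: "x v \<ge> 0" for v using x by (auto simp: book_def)
    have pos: "x v > 0" if "v \<in> \<tau>" for v
    proof -
      have "v \<in> supp x" using x that by (auto simp: book_def)
      then show ?thesis using nonneg[of v] by (simp add: supp_def)
    qed
    consider "supp x = \<tau>" | u where "u \<in> A" "supp x = insert u \<tau>"
      using x by (auto simp: book_def)
    then have "c x \<in> book_image n (s ` A) \<and> c' (c x) = x"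
    proof cases
      case 1
      then have tot: "x v0 + (\<Sum>i<n. x (e i)) = 1" using x sum_e[of x] by (auto simp: book_def)
      have "c x n = 0" using spine[OF 1] by (simp add: c_def)
      moreover have "c' (c x) v = x v" for v
        using \<open>c x n = 0\<close> 1 tot einv[of v] by (auto simp: c'_def c_def supp_def spine[OF 1])
      ultimately show ?thesis using tot pos[OF v0] pos e_mem
        by (auto simp: book_image_def fin_seqs_def c_def)
    next
      case (2 u)
      then have "u \<notin> \<tau>" using disj by auto
      then have tot: "x u + (x v0 + (\<Sum>i<n. x (e i))) = 1"
        using x sum_e[of x] 2 fin by (auto simp: book_def)
      have cn: "c x n = s u * x u" using page[OF 2(2,1)] by (simp add: c_def)
      have "u \<in> supp x" using 2 by simp
      then have "x u > 0" using nonneg[of u] by (simp add: supp_def)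
      have ab: "\<bar>c x n\<bar> = x u" using cn s_abs[OF 2(1)] nonneg[of u] by (simp add: abs_mult)
      have sg: "sgn (c x n) = s u" using cn \<open>x u > 0\<close> s(1) 2(1) by (auto simp: sgn_mult)
      have oth: "max 0 (s v * c x n) = x v" if "v \<in> A" for v
      proof (cases "v = u")
        case True
        then show ?thesis using cn s_abs[OF 2(1)] nonneg[of u] by (simp flip: mult.assoc)
      next
        case False
        then have "s v \<noteq> s u" using that 2 s(2) by (auto simp: inj_on_def)
        moreover have "s v \<in> {1, -1}" "s u \<in> {1, -1}" using that 2 s(1) by blast+
        ultimately have "s v * s u = -1" by auto
        moreover have "s v * c x n = (s v * s u) * x u" using cn by simp
        moreover have "x v = 0" using False that disj 2 by (auto simp: supp_def)
        ultimately show ?thesis using nonneg[of u] by simp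
      qed
      have "c' (c x) v = x v" for v
      proof -
        have "x v = 0" if "v \<notin> \<tau>" "v \<notin> A" using that 2 by (auto simp: supp_def)
        moreover have "(\<Sum>i<n. c x i) = (\<Sum>i<n. x (e i))" by (simp add: c_def)
        moreover have "c x (the_inv_into {..<n} e v) = x v" if "v \<in> \<tau>" "v \<noteq> v0"
          using einv[OF that] by (simp add: c_def)
        ultimately show ?thesis
          using tot oth ab by (auto simp: c'_def)
      qed
      moreover have "c x \<in> book_image n (s ` A)"
        using tot pos[OF v0] pos e_mem ab sg 2(1) by (auto simp: book_image_def fin_seqs_def c_def)
      ultimately show ?thesis by blast
    qed
    then show "c x \<in> book_image n (s ` A)" "c' (c x) = x" by auto
  qed
  have c'_image: "c' z \<in> book \<tau> A" and c'_inv: "c (c' z) = z" if z: "z \<in> book_image n (s ` A)" for z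
  proof -
    have zpos: "\<And>i. i < n \<Longrightarrow> z i > 0" and ztot: "(\<Sum>i<n. z i) + \<bar>z n\<bar> < 1"
      and z0: "\<And>i. i > n \<Longrightarrow> z i = 0"
      using z by (auto simp: book_image_def fin_seqs_def)
    have nonneg: "c' z v \<ge> 0" for v
      using zpos[of "the_inv_into {..<n} e v"] einv(2)[of v] ztot by (auto simp: c'_def less_imp_le)
    have sup\<tau>: "\<tau> \<subseteq> supp (c' z)"
      using zpos einv(2) ztot by (fastforce simp: c'_def supp_def)
    have s\<tau>: "sum (c' z) \<tau> = 1 - \<bar>z n\<bar>"
      unfolding sum_e using e_mem inv v0 by (simp add: c'_def)
    have A: "c' z v = max 0 (s v * z n)" if "v \<in> A" for v
      using that disj v0 by (auto simp: c'_def)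
    have "c' z \<in> book \<tau> A \<and> c (c' z) = z"
    proof (cases "z n = 0")
      case True
      then have "supp (c' z) = \<tau>" using sup\<tau> v0 by (auto simp: supp_def c'_def split: if_splits)
      then show ?thesis
        using s\<tau> True nonneg e_mem inv z0 A by (auto simp: book_def c_def fun_eq_iff c'_def)
    next
      case False
      then obtain u where u: "u \<in> A" "sgn (z n) = s u" using z by (auto simp: book_image_def)
      have zu: "s u * z n = \<bar>z n\<bar>" using u by (metis abs_sgn mult.commute)
      have oth: "c' z v = 0" if "v \<in> A" "v \<noteq> u" for v
      proof -
        have "s v \<noteq> s u" using that u s(2) by (auto simp: inj_on_def)
        moreover have "s v \<in> {1, -1}" "s u \<in> {1, -1}" using that u s(1) by blast+
        ultimately have "s v = - s u" by auto
        then show ?thesis using A[OF that(1)] zu by simp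
      qed
      have cu: "c' z u = \<bar>z n\<bar>" using A[OF u(1)] zu by simp
      have sup: "supp (c' z) = insert u \<tau>"
      proof
        show "insert u \<tau> \<subseteq> supp (c' z)" using sup\<tau> cu False by (auto simp: supp_def)
        have "c' z v = 0" if "v \<notin> \<tau>" "v \<notin> A" for v
          using that v0 by (auto simp: c'_def)
        then show "supp (c' z) \<subseteq> insert u \<tau>" using oth by (auto simp: supp_def)
      qed
      have "u \<notin> \<tau>" using disj u by auto
      have "c (c' z) n = s u * c' z u" using page[OF sup u(1)] by (simp add: c_def)
      also have "\<dots> = z n" using cu zu s_abs[OF u(1)] by (metis mult.left_commute mult.right_neutral)
      finally have "c (c' z) = z"
        using e_mem inv z0 by (auto simp: c_def fun_eq_iff c'_def)
      then show ?thesis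
        using s\<tau> nonneg sup u \<open>u \<notin> \<tau>\<close> cu fin by (auto simp: book_def)
    qed
    then show "c' z \<in> book \<tau> A" "c (c' z) = z" by auto
  qed
  have contc: "continuous_on UNIV c"
  proof (rule continuous_on_coordinatewise_then_product)
    fix i
    show "continuous_on UNIV (\<lambda>x. c x i)"
      by (cases i n rule: linorder_cases) (auto simp: c_def intro!: continuous_intros)
  qed
  have contc': "continuous_on UNIV c'"
  proof (rule continuous_on_coordinatewise_then_product)
    fix v
    show "continuous_on UNIV (\<lambda>x. c' x v)"
      by (cases "v = v0"; cases "v \<in> \<tau>"; cases "v \<in> A") (auto simp: c'_def intro!: continuous_intros)
  qed
  have "homeomorphism (book \<tau> A) (book_image n (s ` A)) c c'"
  proof (rule homeomorphismI)
    show "continuous_on (book \<tau> A) c" using contc continuous_on_subset by blast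
    show "continuous_on (book_image n (s ` A)) c'" using contc' continuous_on_subset by blast
  qed (use c_image c_inv c'_image c'_inv in auto)
  moreover have "\<forall>x. c x n = (\<Sum>v\<in>A. s v * x v)" by (simp add: c_def)
  ultimately show ?thesis by blast
qed

text \<open>With both signs allowed the sign condition is empty and the spine is interior. With one
  sign the spine is a boundary, so only the page without it is open.\<close>

lemma openin_book_image:
  "openin (top_of_set (fin_seqs (Suc n))) (book_image n {1, -1})"
  "openin (top_of_set (fin_seqs (Suc n))) {z \<in> book_image n {1}. z n > 0}"
proof -
  have op: "open {z :: nat \<Rightarrow> real. 0 < z i}" for i
    by (rule open_Collect_less) (rule continuous_intros)+
  have op': "open {z :: nat \<Rightarrow> real. (\<Sum>i<n. z i) + \<bar>z n\<bar> < 1}"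
    by (rule open_Collect_less) (rule continuous_intros)+
  let ?W = "(\<Inter>i<n. {z :: nat \<Rightarrow> real. 0 < z i}) \<inter> {z. (\<Sum>i<n. z i) + \<bar>z n\<bar> < 1}"
  have "open (\<Inter>i<n. {z :: nat \<Rightarrow> real. 0 < z i})"
    using op by (simp add: open_INT)
  then have W: "open ?W" using op' by (rule open_Int)
  have "sgn a \<in> {1, -1} \<or> a = 0" for a :: real
    by (simp add: sgn_if)
  then have "book_image n {1, -1} = fin_seqs (Suc n) \<inter> ?W"
    unfolding book_image_def by blast
  then show "openin (top_of_set (fin_seqs (Suc n))) (book_image n {1, -1})"
    using W by (simp add: openin_open_Int)
  have "{z \<in> book_image n {1}. z n > 0} = fin_seqs (Suc n) \<inter> (?W \<inter> {z. 0 < z n})"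
    unfolding book_image_def by (auto simp del: fun_upd_apply)
  then show "openin (top_of_set (fin_seqs (Suc n))) {z \<in> book_image n {1}. z n > 0}"
    using W op by (simp add: open_Int openin_open_Int)
qed

lemma book_euclidean_injection:
  fixes \<tau> A :: "'v set"
  assumes fin: "finite \<tau>" "finite A" and disj: "\<tau> \<inter> A = {}" and card: "card \<tau> = Suc n"
    and "card A \<le> 2"
  shows "\<exists>c. continuous_on (book \<tau> A) c \<and> inj_on c (book \<tau> A) \<and> c ` book \<tau> A \<subseteq> fin_seqs (Suc n)"
proof -
  obtain s :: "'v \<Rightarrow> real" where s: "s ` A \<subseteq> {1, -1}" "inj_on s A"
    using card_le_inj[OF fin(2), of "{1, -1 :: real}"] \<open>card A \<le> 2\<close> by auto
  obtain c c' where c: "homeomorphism (book \<tau> A) (book_image n (s ` A)) c c'"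
    using book_chart[OF fin disj card s] by blast
  have "inj_on c (book \<tau> A)"
    using homeomorphism_apply1[OF c] by (intro inj_on_inverseI[of _ c']) auto
  moreover have "c ` book \<tau> A \<subseteq> fin_seqs (Suc n)"
    using homeomorphism_image1[OF c] by (auto simp: book_image_def)
  ultimately show ?thesis using homeomorphism_cont1[OF c] by blast
qed

text \<open>An open simplex with at least two vertices is an open page over a spine with one vertex
  less, so a one-page book supplies the coordinates; a single vertex leaves no spine and is treated
  separately.\<close>

lemma open_simplex_euclidean_injection:
  assumes "finite \<rho>" "card \<rho> = Suc n"
  defines "S \<equiv> {x. (\<forall>v. x v \<ge> 0) \<and> sum x (supp x) = 1 \<and> supp x = \<rho>}"
  shows "\<exists>c. continuous_on S c \<and> inj_on c S \<and> c ` S \<subseteq> fin_seqs n"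
proof (cases n)
  case 0
  then obtain v where v: "\<rho> = {v}" using assms by (auto simp: card_1_singleton_iff)
  have eq: "x = y" if "supp x = {v}" "supp y = {v}" "sum x (supp x) = 1" "sum y (supp y) = 1"
    for x y :: "'a \<Rightarrow> real"
  proof
    fix w
    have "x v = 1" "y v = 1" using that(3,4) unfolding that(1,2) by simp_all
    moreover have "x w = 0" "y w = 0" if "w \<noteq> v"
    proof -
      have "w \<notin> supp x" "w \<notin> supp y"
        using \<open>w \<noteq> v\<close> \<open>supp x = {v}\<close> \<open>supp y = {v}\<close> by simp_all
      then show "x w = 0" "y w = 0" by (simp_all add: supp_def)
    qed
    ultimately show "x w = y w" by (cases "w = v") auto
  qed
  have "inj_on (\<lambda>_. \<lambda>_. 0) S"
    by (intro inj_onI) (rule eq, auto simp: v S_def)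
  then show ?thesis by (intro exI[of _ "\<lambda>_. \<lambda>_. 0"]) (auto simp: fin_seqs_def)
next
  case (Suc m)
  obtain u where u: "u \<in> \<rho>" using assms by fastforce
  have "card (\<rho> - {u}) = Suc m" using assms u Suc by simp
  then have "\<exists>c. continuous_on (book (\<rho> - {u}) {u}) c \<and> inj_on c (book (\<rho> - {u}) {u}) \<and>
    c ` book (\<rho> - {u}) {u} \<subseteq> fin_seqs n"
    using assms(1) unfolding Suc by (intro book_euclidean_injection) auto
  then obtain c where "continuous_on (book (\<rho> - {u}) {u}) c" "inj_on c (book (\<rho> - {u}) {u})"
    "c ` book (\<rho> - {u}) {u} \<subseteq> fin_seqs n"
    by blast
  moreover have "S \<subseteq> book (\<rho> - {u}) {u}"
    using u by (auto simp: book_def S_def)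
  ultimately show ?thesis
    by (intro exI[of _ c]) (auto intro: continuous_on_subset inj_on_subset)
qed

text \<open>Serves to show that every neighbourhood of a spine point meets every page.\<close>

lemma segment_to_vertex_into_open:
  fixes x :: "'v \<Rightarrow> real"
  assumes "open W" "x \<in> W"
  obtains e where "0 < e" "e < 1" "(\<lambda>v. (1 - e) * x v + e * indicator {t} v) \<in> W"
proof -
  define g where "g = (\<lambda>e :: real. \<lambda>v. (1 - e) * x v + e * indicator {t} v)"
  have "continuous_on UNIV g"
    unfolding g_def by (intro continuous_on_coordinatewise_then_product continuous_intros)
  then have "open (g -` W)"
    using assms(1) by (simp add: continuous_on_open_vimage)
  moreover have "0 \<in> g -` W" using assms by (auto simp: g_def)
  ultimately obtain e where e: "e > 0" "ball 0 e \<subseteq> g -` W"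
    by (meson openE)
  then have "g (min (e/2) (1/2)) \<in> W" by (auto simp: dist_real_def subset_iff)
  then show ?thesis using e(1) by (intro that[of "min (e/2) (1/2)"]) (auto simp: g_def)
qed

lemma supp_segment_to_vertex:
  assumes "0 < e" "e < 1" "\<forall>v. x v \<ge> 0"
  shows "supp (\<lambda>v. (1 - e) * x v + e * indicator {t} v) = insert t (supp x)"
proof -
  have "(1 - e) * x t + e > 0" using assms by (simp add: add_nonneg_pos)
  then show ?thesis using assms by (auto simp: supp_def indicator_def)
qed

text \<open>The vertices of the link of \<open>\<tau>\<close>. For a face of codimension one their
  number is the number of top-dimensional simplices containing it.\<close>

definition extensions :: "'v set set \<Rightarrow> 'v set \<Rightarrow> 'v set" where
  "extensions K \<tau> = {v. v \<notin> \<tau> \<and> insert v \<tau> \<in> K}"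

context finite_complex
begin

lemma realization_iff: "x \<in> geometric_realization K \<longleftrightarrow>
    (\<forall>v. x v \<ge> 0) \<and> supp x \<in> K \<and> sum x (supp x) = 1"
  using mem_geometric_realization finite_complex_axioms .

lemma finite_extensions: "finite (extensions K \<tau>)"
  using finite_vertices by (rule finite_subset[rotated]) (auto simp: extensions_def)

lemma segment_to_vertex_in_realization:
  assumes "0 < e" "e < 1" "x \<in> geometric_realization K" "t \<in> extensions K (supp x)"
  shows "(\<lambda>v. (1 - e) * x v + e * indicator {t} v) \<in> geometric_realization K"
proof -
  have x: "\<forall>v. x v \<ge> 0" "supp x \<in> K" "sum x (supp x) = 1"
    using assms(3) by (auto simp: realization_iff)
  have t: "t \<notin> supp x" "insert t (supp x) \<in> K" using assms(4) by (auto simp: extensions_def)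
  have "(\<Sum>v\<in>insert t (supp x). (1 - e) * x v + e * indicator {t} v)
      = (1 - e) * (\<Sum>v\<in>insert t (supp x). x v) + e * (\<Sum>v\<in>insert t (supp x). indicator {t} v)"
    by (simp add: sum.distrib sum_distrib_left)
  also have "(\<Sum>v\<in>insert t (supp x). x v) = 1"
    using x t finite_face by (simp add: supp_def)
  also have "(\<Sum>v\<in>insert t (supp x). indicator {t} v) = (1::real)"
    using finite_face[OF t(2)] by (simp add: indicator_def if_distrib cong: if_cong)
  finally have "(\<Sum>v\<in>insert t (supp x). (1 - e) * x v + e * indicator {t} v) = 1" by simp
  then show ?thesis
    unfolding realization_iff supp_segment_to_vertex[OF assms(1,2) x(1)]
    using assms x t by (auto simp: indicator_def)
qed

text \<open>Above a face of codimension one there is room for one more vertex only, so the open star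
  consists of the spine and the pages.\<close>

lemma star_eq_book:
  assumes "\<tau> \<in> K" and top: "\<And>\<sigma>. \<sigma> \<in> K \<Longrightarrow> card \<sigma> \<le> Suc (card \<tau>)"
  shows "star K \<tau> = book \<tau> (extensions K \<tau>)"
proof (intro Set.set_eqI iffI)
  fix x assume x: "x \<in> star K \<tau>"
  then have K: "supp x \<in> K" "\<tau> \<subseteq> supp x" by (auto simp: star_def realization_iff)
  show "x \<in> book \<tau> (extensions K \<tau>)"
  proof (cases "supp x = \<tau>")
    case True
    then show ?thesis using x by (auto simp: book_def star_def realization_iff)
  next
    case False
    then obtain u where u: "u \<in> supp x" "u \<notin> \<tau>" using K by blast
    have "finite (supp x)" using K finite_face by blast
    moreover have "card (insert u \<tau>) = Suc (card \<tau>)"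
      using u finite_subset[OF K(2) \<open>finite (supp x)\<close>] by simp
    ultimately have "insert u \<tau> = supp x"
      using u K top[OF K(1)] by (intro card_seteq) auto
    then show ?thesis using x u K by (auto simp: book_def star_def realization_iff extensions_def)
  qed
next
  fix x assume "x \<in> book \<tau> (extensions K \<tau>)"
  then show "x \<in> star K \<tau>"
    using assms(1) by (auto simp: book_def star_def realization_iff extensions_def)
qed

lemma book_subset_star:
  assumes "\<tau> \<in> K" "A \<subseteq> extensions K \<tau>"
  shows "book \<tau> A \<subseteq> star K \<tau>"
  using assms by (auto simp: book_def star_def realization_iff extensions_def)

text \<open>Invariance of domain: a neighbourhood that embeds into \<open>\<real>\<^sup>n\<close> would have to be contained in the
  union of any two of the pages.\<close>

lemma no_euclidean_nbhd_on_spine: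
  assumes \<tau>: "\<tau> \<in> K" "card \<tau> = Suc n" and ext: "card (extensions K \<tau>) \<ge> 3"
    and N: "openin (top_of_set (geometric_realization K)) N" "x \<in> N" "supp x = \<tau>"
    and g: "continuous_on N g" "inj_on g N" "g ` N \<subseteq> fin_seqs (Suc n)"
  shows False
proof -
  obtain B where B: "B \<subseteq> extensions K \<tau>" "card B = 3"
    using ext by (meson obtain_subset_with_card_n)
  then obtain u w t where uwt: "B = {u, w, t}" "u \<noteq> w" "u \<noteq> t" "w \<noteq> t"
    by (auto simp: card_3_iff)
  define T where "T = book \<tau> {u, w}"
  have disj: "\<tau> \<inter> {u, w} = {}" using B uwt by (auto simp: extensions_def)
  define s :: "'v \<Rightarrow> real" where "s = (\<lambda>v. if v = u then 1 else -1)"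
  have s: "s ` {u, w} = {1, -1}" "inj_on s {u, w}" using uwt by (auto simp: s_def)
  obtain c c' where c: "homeomorphism T (book_image n (s ` {u, w})) c c'"
    using book_chart[OF _ _ disj \<tau>(2), of s] s \<tau> finite_face unfolding T_def by auto
  have T: "T \<subseteq> geometric_realization K"
    using book_subset_star[OF \<tau>(1), of "{u, w}"] B uwt by (auto simp: T_def star_def)
  have x: "x \<in> geometric_realization K" using N openin_imp_subset by blast
  have xT: "x \<in> T" using x N(3) by (auto simp: T_def book_def realization_iff)
  define A where "A = T \<inter> N"
  have "openin (top_of_set T) A"
    using N(1) T by (auto simp: A_def openin_open)
  \<comment> \<open>\<open>A\<close> is open in a book with two pages, which is homeomorphic to an
    open piece of Euclidean space; hence \<open>g\<close> maps it onto an open set.\<close>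
  then have "openin (top_of_set (fin_seqs (Suc n))) (g ` A)"
    using g c s openin_book_image(1)
    by (intro openin_chart_image[of T _ c c']) (auto simp: A_def intro: continuous_on_subset inj_on_subset)
  then obtain W where W: "open W" "g ` A = fin_seqs (Suc n) \<inter> W" by (auto simp: openin_open)
  have "openin (top_of_set N) (N \<inter> g -` W)"
    using g(1) W(1) by (simp add: continuous_openin_preimage_gen)
  \<comment> \<open>Injectivity of \<open>g\<close> on all of \<open>N\<close> pulls the open set
    back to \<open>A\<close> itself. So \<open>A\<close> is open in the whole realization although
    it has no point in the page of \<open>t\<close>.\<close>
  moreover have "N \<inter> g -` W = A"
  proof
    show "A \<subseteq> N \<inter> g -` W" using W(2) by (auto simp: A_def)
    show "N \<inter> g -` W \<subseteq> A"
    proof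
      fix y assume y: "y \<in> N \<inter> g -` W"
      then have "g y \<in> g ` A" using W(2) g(3) by auto
      then show "y \<in> A" using y g(2) by (auto simp: A_def inj_on_def)
    qed
  qed
  ultimately have "openin (top_of_set (geometric_realization K)) A"
    using N(1) openin_trans by metis
  then obtain W' where W': "open W'" "A = geometric_realization K \<inter> W'" by (auto simp: openin_open)
  have "x \<in> W'" using W' xT N by (auto simp: A_def)
  then obtain e where e: "0 < e" "e < 1" "(\<lambda>v. (1 - e) * x v + e * indicator {t} v) \<in> W'"
    using segment_to_vertex_into_open W'(1) by metis
  moreover have "t \<in> extensions K (supp x)" using B uwt N(3) by auto
  ultimately have "(\<lambda>v. (1 - e) * x v + e * indicator {t} v) \<in> T"
    using segment_to_vertex_in_realization[of e x t] x W' by (auto simp: A_def)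
  then have "supp (\<lambda>v. (1 - e) * x v + e * indicator {t} v) \<in> {\<tau>, insert u \<tau>, insert w \<tau>}"
    by (auto simp: T_def book_def)
  moreover have "t \<notin> insert u \<tau>" "t \<notin> insert w \<tau>" using B uwt by (auto simp: extensions_def)
  moreover have "supp (\<lambda>v. (1 - e) * x v + e * indicator {t} v) = insert t \<tau>"
    unfolding N(3)[symmetric] using x by (intro supp_segment_to_vertex e(1,2)) (simp add: realization_iff)
  ultimately show False by blast
qed

end

section \<open>Convex neighbourhoods and connectedness of open pages\<close>

definition segment_point :: "real \<Rightarrow> ('v \<Rightarrow> real) \<Rightarrow> ('v \<Rightarrow> real) \<Rightarrow> 'v \<Rightarrow> real" where
  "segment_point t y z = (\<lambda>v. (1 - t) * y v + t * z v)"

text \<open>Boxes form a base of the product topology and are convex. Intersecting a convex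
  neighbourhood with an open page keeps the page connected, which an arbitrary neighbourhood would
  not.\<close>

lemma open_fun_contains_box:
  fixes x :: "'v \<Rightarrow> real"
  assumes "open W" "x \<in> W"
  obtains B where "open B" "x \<in> B" "B \<subseteq> W"
    "\<And>y z t. y \<in> B \<Longrightarrow> z \<in> B \<Longrightarrow> t \<in> {0..1} \<Longrightarrow> segment_point t y z \<in> B"
proof -
  obtain X where X: "x \<in> Pi\<^sub>E UNIV X" "\<And>i. open (X i)" "finite {i. X i \<noteq> UNIV}" "Pi\<^sub>E UNIV X \<subseteq> W"
    using product_topology_open_contains_basis[of "\<lambda>i. euclidean" UNIV W x] assms
    by (auto simp: open_fun_def)
  have "\<exists>e>0. ball (x i) e \<subseteq> X i" for i
    using X(1,2) by (metis PiE_mem UNIV_I openE)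
  then obtain e where e: "\<And>i. e i > 0" "\<And>i. ball (x i) (e i) \<subseteq> X i" by metis
  define B where "B = Pi\<^sub>E UNIV (\<lambda>i. if X i = UNIV then UNIV else ball (x i) (e i))"
  have "{i. (if X i = UNIV then UNIV else ball (x i) (e i)) \<noteq> UNIV} \<subseteq> {i. X i \<noteq> UNIV}" by auto
  then have "open B" unfolding B_def using X(3) by (intro open_PiE) (auto intro: finite_subset)
  moreover have "x \<in> B" using e by (auto simp: B_def)
  moreover have "B \<subseteq> W" using X(4) e(2) by (fastforce simp: B_def PiE_iff split: if_splits)
  moreover have "segment_point t y z \<in> B" if yz: "y \<in> B" "z \<in> B" and t: "t \<in> {0..1}" for y z t
  proof -
    have "convex (if X i = UNIV then UNIV else ball (x i) (e i))" for i by simp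
    then have "(1 - t) *\<^sub>R y i + t *\<^sub>R z i \<in> (if X i = UNIV then UNIV else ball (x i) (e i))" for i
      using yz t by (intro convexD) (auto simp: B_def PiE_iff split: if_splits)
    then show ?thesis by (simp add: B_def PiE_iff segment_point_def)
  qed
  ultimately show ?thesis using that by blast
qed

lemma connected_if_segments:
  fixes S :: "('v \<Rightarrow> real) set"
  assumes "\<And>y z t. y \<in> S \<Longrightarrow> z \<in> S \<Longrightarrow> t \<in> {0..1} \<Longrightarrow> segment_point t y z \<in> S"
  shows "connected S"
proof (rule connectedI_const)
  fix Q :: "('v \<Rightarrow> real) \<Rightarrow> bool" assume Q: "continuous_on S Q"
  have "Q y = Q z" if "y \<in> S" "z \<in> S" for y z
  proof -
    have "continuous_on {0..1} (\<lambda>t. segment_point t y z)"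
      unfolding segment_point_def
      by (intro continuous_on_coordinatewise_then_product continuous_intros)
    then have "connected ((\<lambda>t. segment_point t y z) ` {0..1})"
      by (rule connected_continuous_image) simp
    moreover have "(\<lambda>t. segment_point t y z) ` {0..1} \<subseteq> S" using assms that by blast
    ultimately have "\<exists>c. \<forall>p\<in>(\<lambda>t. segment_point t y z) ` {0..1}. Q p = c"
      by (intro connectedD_const continuous_on_subset[OF Q])
    then have "Q (segment_point 0 y z) = Q (segment_point 1 y z)" by auto
    then show ?thesis by (simp add: segment_point_def)
  qed
  then show "\<exists>c. \<forall>s\<in>S. Q s = c" by blast
qed

text \<open>That the coordinate of a page vertex does not vanish is an open condition, and off the
  spine exactly one of these conditions holds.\<close>

lemma connected_in_single_page:
  fixes S :: "('v \<Rightarrow> real) set"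
  assumes conn: "connected S" and pg: "\<And>z. z \<in> S \<Longrightarrow> \<exists>w\<in>A. supp z = insert w \<rho>"
    and disj: "\<rho> \<inter> A = {}" and y: "y \<in> S" "supp y = insert v \<rho>" "v \<in> A" and z: "z \<in> S"
  shows "supp z = insert v \<rho>"
proof -
  have op: "open {y :: 'v \<Rightarrow> real. y w \<noteq> 0}" for w
    by (rule open_Collect_neq) (rule continuous_intros)+
  let ?U = "{y :: 'v \<Rightarrow> real. y v \<noteq> 0}" and ?V = "\<Union>w\<in>A - {v}. {y :: 'v \<Rightarrow> real. y w \<noteq> 0}"
  have page: "w = w'" if "supp p = insert w \<rho>" "w' \<in> A" "p w' \<noteq> 0" for p w w'
  proof -
    have "w' \<in> supp p" using that(3) by (simp add: supp_def)
    then have "w' \<in> insert w \<rho>" by (simp only: that(1))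
    moreover have "w' \<notin> \<rho>" using disj that(2) by blast
    ultimately show ?thesis by simp
  qed
  have "?U \<inter> ?V \<inter> S = {}"
  proof (rule ccontr)
    assume "?U \<inter> ?V \<inter> S \<noteq> {}"
    then obtain p w where p: "p \<in> S" "p v \<noteq> 0" "p w \<noteq> 0" "w \<in> A" "w \<noteq> v" by blast
    obtain w' where "supp p = insert w' \<rho>" using pg[OF p(1)] by blast
    then show False using page p y(3) by metis
  qed
  moreover have cover: "p w \<noteq> 0" if "supp p = insert w \<rho>" for p :: "'v \<Rightarrow> real" and w
  proof -
    have "w \<in> supp p" using that by simp
    then show ?thesis by (simp add: supp_def)
  qed
  have "S \<subseteq> ?U \<union> ?V" using pg cover by blast
  ultimately have "?U \<inter> S = {} \<or> ?V \<inter> S = {}"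
    using op by (intro connectedD[OF conn]) auto
  then have "?V \<inter> S = {}" using y cover by blast
  moreover obtain w where "w \<in> A" "supp z = insert w \<rho>" using pg[OF z] by blast
  ultimately show ?thesis using cover z by blast
qed

lemma (in finite_complex) open_simplex_segment:
  assumes "y \<in> geometric_realization K" "z \<in> geometric_realization K"
    and "supp y = \<sigma>" "supp z = \<sigma>" "t \<in> {0..1}"
  shows "segment_point t y z \<in> geometric_realization K" "supp (segment_point t y z) = \<sigma>"
proof -
  have y: "\<And>v. y v \<ge> 0" "\<sigma> \<in> K" "sum y \<sigma> = 1" and z: "\<And>v. z v \<ge> 0" "sum z \<sigma> = 1"
    using assms by (auto simp: realization_iff)
  have "segment_point t y z v > 0" if "v \<in> \<sigma>" for v
  proof -
    have "v \<in> supp y" "v \<in> supp z" using that assms by auto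
    then have "y v > 0" "z v > 0" using y(1)[of v] z(1)[of v] by (auto simp: supp_def)
    then show ?thesis using assms(5)
      by (cases "t = 0") (auto simp: segment_point_def add_nonneg_pos)
  qed
  moreover have "segment_point t y z v = 0" if "v \<notin> \<sigma>" for v
  proof -
    have "v \<notin> supp y" "v \<notin> supp z" using that assms by auto
    then show ?thesis by (auto simp: supp_def segment_point_def)
  qed
  ultimately show s: "supp (segment_point t y z) = \<sigma>" unfolding supp_def by force
  have "sum (segment_point t y z) \<sigma> = (1 - t) * sum y \<sigma> + t * sum z \<sigma>"
    by (simp add: segment_point_def sum.distrib sum_distrib_left)
  then show "segment_point t y z \<in> geometric_realization K"
    using assms(5) y z s by (auto simp: realization_iff segment_point_def)
qed

lemma (in finite_complex) supp_face:
  assumes "x \<in> geometric_realization K"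
  shows "supp x \<in> K" "supp x \<noteq> {}" "finite (supp x)"
proof -
  show K: "supp x \<in> K" using assms realization_iff by blast
  have "sum x (supp x) = 1" using assms realization_iff by blast
  then show "supp x \<noteq> {}" by force
  show "finite (supp x)" using K by (rule finite_face)
qed

lemma (in finite_complex) open_simplex_nonempty:
  assumes "\<sigma> \<in> K" "\<sigma> \<noteq> {}"
  obtains x where "x \<in> geometric_realization K" "supp x = \<sigma>"
proof -
  define x where "x = (\<lambda>v. indicator \<sigma> v / real (card \<sigma>))"
  have "card \<sigma> > 0" using assms finite_face by (simp add: card_gt_0_iff)
  then have "supp x = \<sigma>" "sum x \<sigma> = 1" by (auto simp: supp_def x_def indicator_def)
  then show ?thesis using assms by (intro that[of x]) (auto simp: realization_iff x_def)
qed

section \<open>Dimension and branching under homeomorphisms\<close>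

locale complex_homeomorphism =
  A: finite_complex K1 + B: finite_complex K2 for K1 :: "'v set set" and K2 :: "'w set set" +
  fixes h h'
  assumes hom: "homeomorphism (geometric_realization K1) (geometric_realization K2) h h'"
begin

lemma inverse: "complex_homeomorphism K2 K1 h' h"
  by unfold_locales (use hom homeomorphism_sym in blast)

lemma h_mem: "x \<in> geometric_realization K1 \<Longrightarrow> h x \<in> geometric_realization K2"
  using homeomorphism_image1[OF hom] by blast

lemma openin_preimage:
  assumes "openin (top_of_set (geometric_realization K2)) S"
  shows "openin (top_of_set (geometric_realization K1)) (geometric_realization K1 \<inter> h -` S)"
  using assms homeomorphism_cont1[OF hom] h_mem
  by (metis (no_types, lifting) continuous_on_open homeomorphism_image1[OF hom])

lemma inj_on_h: "S \<subseteq> geometric_realization K1 \<Longrightarrow> inj_on h S"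
  using homeomorphism_apply1[OF hom] by (metis inj_on_def subsetD)

text \<open>Among the points of an open simplex choose one whose image lies in an open simplex of largest
  dimension: nearby points are mapped into the same open simplex.\<close>

lemma simplex_meets_large_simplex:
  assumes \<sigma>: "\<sigma> \<in> K1" "\<sigma> \<noteq> {}"
  obtains x where "x \<in> geometric_realization K1" "supp x = \<sigma>" "card \<sigma> \<le> card (supp (h x))"
proof -
  let ?S = "{x \<in> geometric_realization K1. supp x = \<sigma>}"
  let ?c = "\<lambda>x. card (supp (h x))"
  have "?c ` ?S \<subseteq> card ` K2" using h_mem B.supp_face(1) by blast
  then have fin: "finite (?c ` ?S)" using B.finite_complex by (meson finite_imageI finite_subset)
  obtain x1 where "x1 \<in> ?S" using A.open_simplex_nonempty[OF \<sigma>] by blast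
  then have "Max (?c ` ?S) \<in> ?c ` ?S" using fin by (intro Max_in) auto
  then obtain x where x1: "x \<in> ?S" "Max (?c ` ?S) = ?c x" by (rule imageE)
  then have x: "x \<in> ?S" "\<And>y. y \<in> ?S \<Longrightarrow> ?c y \<le> ?c x"
    using Max_ge[OF fin imageI] by simp_all
  let ?\<rho> = "supp (h x)"
  have hx: "h x \<in> geometric_realization K2" using x h_mem by blast
  then have \<rho>: "?\<rho> \<in> K2" "?\<rho> \<noteq> {}" and fin\<rho>: "finite ?\<rho>" using B.supp_face by blast+
  then have "card ?\<rho> > 0" by (simp add: card_gt_0_iff)
  then obtain m where m: "card ?\<rho> = Suc m" using gr0_conv_Suc by blast
  have "card \<sigma> \<le> card ?\<rho>"
  proof (cases "card \<sigma> \<le> 1")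
    case True
    then show ?thesis using m by simp
  next
    case False
    define n where "n = card \<sigma> - 2"
    have n: "card \<sigma> = Suc (Suc n)" using False by (simp add: n_def)
    obtain u where u: "u \<in> \<sigma>" using \<sigma> by blast
    define \<tau> where "\<tau> = \<sigma> - {u}"
    have \<tau>: "finite \<tau>" "card \<tau> = Suc n" "insert u \<tau> = \<sigma>" "u \<notin> \<tau>"
      using u n A.finite_face[OF \<sigma>(1)] by (auto simp: \<tau>_def)
    obtain c c' where c: "homeomorphism (book \<tau> {u}) (book_image n ((\<lambda>_. 1) ` {u})) c c'"
      "\<And>x. c x n = (\<Sum>v\<in>{u}. 1 * x v)"
      using book_chart[of \<tau> "{u}" n "\<lambda>_. 1"] \<tau> by auto
    have S: "?S = {y \<in> book \<tau> {u}. c y n > 0}"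
    proof -
      have "c y n > 0 \<longleftrightarrow> supp y = \<sigma>" if "y \<in> book \<tau> {u}" for y
      proof -
        have "y u \<ge> 0" and sy: "supp y = \<tau> \<or> supp y = \<sigma>" using that \<tau>(3) by (simp_all add: book_def)
        then have "c y n > 0 \<longleftrightarrow> u \<in> supp y" using c(2)[of y] by (simp add: supp_def less_le)
        also have "\<dots> \<longleftrightarrow> supp y = \<sigma>" using sy \<tau>(3,4) by blast
        finally show ?thesis .
      qed
      moreover have "y \<in> book \<tau> {u}" if "y \<in> geometric_realization K1" "supp y = \<sigma>" for y
        using that \<tau>(3) by (simp add: book_def A.realization_iff)
      moreover have "y \<in> geometric_realization K1" if "y \<in> book \<tau> {u}" "supp y = \<sigma>" for y
        using that \<sigma> by (simp add: book_def A.realization_iff)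
      ultimately show ?thesis by blast
    qed
    define V where "V = {y \<in> ?S. ?\<rho> \<subseteq> supp (h y)}"
    \<comment> \<open>The image support at \<open>x\<close> has the largest size, so a support
      containing it must be equal to it.\<close>
    have V\<rho>: "supp (h y) = ?\<rho>" if "y \<in> V" for y
    proof -
      have "y \<in> ?S" "?\<rho> \<subseteq> supp (h y)" using that by (auto simp: V_def)
      moreover have "finite (supp (h y))"
        using \<open>y \<in> ?S\<close> h_mem B.supp_face by blast
      ultimately show ?thesis using x(2) by (metis card_seteq)
    qed
    have "openin (top_of_set (geometric_realization K1)) (geometric_realization K1 \<inter> h -` star K2 ?\<rho>)"
      using fin\<rho> by (intro openin_preimage openin_star)
    then obtain W where W: "open W" "geometric_realization K1 \<inter> h -` star K2 ?\<rho> = geometric_realization K1 \<inter> W"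
      by (auto simp: openin_open)
    have "?S \<subseteq> geometric_realization K1" by blast
    moreover have "V = ?S \<inter> (geometric_realization K1 \<inter> h -` star K2 ?\<rho>)"
      using h_mem by (auto simp: V_def star_def)
    ultimately have "V = ?S \<inter> W" using W by blast
    then have opV: "openin (top_of_set ?S) V" using W(1) by (auto simp: openin_open)
    have cS: "homeomorphism ?S {z \<in> book_image n {1}. z n > 0} c c'"
    proof (rule homeomorphism_of_subsets[OF c(1)])
      show "c ` ?S = {z \<in> book_image n {1}. z n > 0}"
        unfolding S using homeomorphism_image1[OF c(1)] by auto
    qed (use S in auto)
    let ?R = "{y. (\<forall>v. y v \<ge> 0) \<and> sum y (supp y) = 1 \<and> supp y = ?\<rho>}"
    obtain k where k: "continuous_on ?R k" "inj_on k ?R" "k ` ?R \<subseteq> fin_seqs m"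
      using open_simplex_euclidean_injection[OF fin\<rho> m] by blast
    have hV: "h ` V \<subseteq> ?R"
    proof
      fix z assume "z \<in> h ` V"
      then obtain y where y: "y \<in> V" "z = h y" by blast
      then have "z \<in> geometric_realization K2" using h_mem by (auto simp: V_def)
      then show "z \<in> ?R" using V\<rho>[OF y(1)] y(2) by (simp add: B.realization_iff)
    qed
    have VK: "V \<subseteq> geometric_realization K1" by (auto simp: V_def)
    have "continuous_on V h"
      using homeomorphism_cont1[OF hom] VK by (rule continuous_on_subset)
    then have "continuous_on V (k \<circ> h)"
      using continuous_on_subset[OF k(1) hV] by (rule continuous_on_compose)
    moreover have "inj_on (k \<circ> h) V"
      using inj_on_h[OF VK] inj_on_subset[OF k(2) hV] by (rule comp_inj_on)
    moreover have "(k \<circ> h) ` V \<subseteq> fin_seqs m"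
      unfolding image_comp[symmetric] using hV k(3) by blast
    moreover have "x \<in> V" using x by (auto simp: V_def)
    \<comment> \<open>An open piece of the simplex \<open>\<sigma>\<close>, of dimension n + 1, has
      been embedded into the open simplex \<open>?\<rho>\<close>, of dimension m.\<close>
    ultimately have "Suc n \<le> m"
      using chart_dimension_le[OF cS openin_book_image(2) opV] by blast
    then show ?thesis using n m by simp
  qed
  then show ?thesis using that x(1) by blast
qed

text \<open>The open star of a top-dimensional simplex is its interior and embeds into Euclidean
  space of its dimension, which no neighbourhood of a spine point with three pages does.\<close>

lemma spine_not_in_open_top_simplex:
  assumes \<tau>: "\<tau> \<in> K1" "card \<tau> = Suc n" "card (extensions K1 \<tau>) \<ge> 3"
    and top: "\<And>\<sigma>. \<sigma> \<in> K2 \<Longrightarrow> card \<sigma> \<le> Suc (Suc n)"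
    and x: "x \<in> geometric_realization K1" "supp x = \<tau>"
  shows "card (supp (h x)) \<noteq> Suc (Suc n)"
proof
  assume c: "card (supp (h x)) = Suc (Suc n)"
  let ?\<rho> = "supp (h x)"
  let ?N = "geometric_realization K1 \<inter> h -` star K2 ?\<rho>"
  have hx: "h x \<in> geometric_realization K2" using h_mem x by blast
  have op: "openin (top_of_set (geometric_realization K1)) ?N"
    using B.supp_face[OF hx] by (intro openin_preimage openin_star)
  have xN: "x \<in> ?N" using x hx by (simp add: star_def)
  let ?R = "{y. (\<forall>v. y v \<ge> 0) \<and> sum y (supp y) = 1 \<and> supp y = ?\<rho>}"
  obtain k where k: "continuous_on ?R k" "inj_on k ?R" "k ` ?R \<subseteq> fin_seqs (Suc n)"
    using open_simplex_euclidean_injection[OF _ c] B.supp_face(3)[OF hx] by blast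
  have hN: "h ` ?N \<subseteq> ?R"
  proof
    fix z assume "z \<in> h ` ?N"
    then have z: "z \<in> geometric_realization K2" "?\<rho> \<subseteq> supp z" by (auto simp: star_def)
    then have "supp z = ?\<rho>"
      using B.supp_face[OF z(1)] top c by (metis card_seteq)
    then show "z \<in> ?R" using z by (simp add: B.realization_iff)
  qed
  have "continuous_on ?N h"
    using homeomorphism_cont1[OF hom] by (rule continuous_on_subset) blast
  then have "continuous_on ?N (k \<circ> h)"
    using continuous_on_subset[OF k(1) hN] by (rule continuous_on_compose)
  moreover have "inj_on (k \<circ> h) ?N"
    using inj_on_subset[OF k(2) hN] by (intro comp_inj_on inj_on_h) auto
  moreover have "(k \<circ> h) ` ?N \<subseteq> fin_seqs (Suc n)"
    using hN k(3) unfolding image_comp[symmetric] by blast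
  ultimately show False
    by (rule A.no_euclidean_nbhd_on_spine[OF \<tau> op xN x(2)])
qed

text \<open>Two pages around their spine form a manifold without boundary, so their image in a chart
  would be open. A single page with its spine is a half space, and \<open>h x\<close> lies on its
  boundary.\<close>

lemma two_pages_not_into_one:
  assumes \<tau>: "\<tau> \<in> K1" "card \<tau> = Suc n" and uw: "u \<in> extensions K1 \<tau>" "w \<in> extensions K1 \<tau>" "u \<noteq> w"
    and Q: "open Q" "x \<in> Q" and x: "x \<in> geometric_realization K1" "supp x = \<tau>"
    and \<rho>: "finite \<rho>" "card \<rho> = Suc n" "v \<notin> \<rho>" "supp (h x) = \<rho>"
    and one_page: "\<And>y. y \<in> book \<tau> {u, w} \<inter> Q \<Longrightarrow> supp (h y) = \<rho> \<or> supp (h y) = insert v \<rho>"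
  shows False
proof -
  define s :: "'v \<Rightarrow> real" where "s = (\<lambda>z. if z = u then 1 else -1)"
  have s: "s ` {u, w} = {1, -1}" "inj_on s {u, w}" using uw by (auto simp: s_def)
  have "\<tau> \<inter> {u, w} = {}" using uw by (auto simp: extensions_def)
  then obtain c c' where c: "homeomorphism (book \<tau> {u, w}) (book_image n {1, -1}) c c'"
    using book_chart[of \<tau> "{u, w}" n s] s \<tau> A.finite_face by auto
  have "\<rho> \<inter> {v} = {}" using \<rho>(3) by auto
  then obtain d d' where d: "homeomorphism (book \<rho> {v}) (book_image n ((\<lambda>_. 1) ` {v})) d d'"
    "\<And>y. d y n = (\<Sum>a\<in>{v}. 1 * y a)"
    using book_chart[of \<rho> "{v}" n "\<lambda>_. 1"] \<rho> by auto
  define T where "T = book \<tau> {u, w} \<inter> Q"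
  have TK: "T \<subseteq> geometric_realization K1"
    using A.book_subset_star[OF \<tau>(1), of "{u, w}"] uw by (auto simp: star_def T_def)
  have hT: "h ` T \<subseteq> book \<rho> {v}"
  proof
    fix z assume "z \<in> h ` T"
    then obtain y where y: "y \<in> T" "z = h y" by blast
    then have "z \<in> geometric_realization K2" using TK h_mem by blast
    then show "z \<in> book \<rho> {v}"
      using one_page[of y] y by (auto simp: T_def book_def B.realization_iff)
  qed
  have "openin (top_of_set (book \<tau> {u, w})) T"
    using Q(1) by (auto simp: T_def openin_open)
  moreover have "continuous_on T (d \<circ> h)"
    using continuous_on_subset[OF homeomorphism_cont1[OF hom] TK] continuous_on_subset[OF homeomorphism_cont1[OF d(1)] hT]
    by (rule continuous_on_compose)
  moreover have "inj_on (d \<circ> h) T"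
  proof (rule comp_inj_on)
    show "inj_on h T" using TK by (rule inj_on_h)
    show "inj_on d (h ` T)"
      using hT homeomorphism_apply1[OF d(1)] by (intro inj_on_inverseI[of _ d']) auto
  qed
  moreover have "(d \<circ> h) ` T \<subseteq> fin_seqs (Suc n)"
    using hT homeomorphism_image1[OF d(1)] by (force simp: book_image_def)
  ultimately have opd: "openin (top_of_set (fin_seqs (Suc n))) (d ` h ` T)"
    using openin_chart_image[OF c openin_book_image(1), of T "d \<circ> h"] by (simp only: image_comp)
  have "x \<in> T" using x Q(2) by (auto simp: T_def book_def A.realization_iff)
  then have "d (h x) \<in> d ` h ` T" by blast
  then obtain e where e: "e > 0" "(d (h x))(n := d (h x) n - e) \<in> d ` h ` T"
    using openin_fin_seqs_perturb[OF opd _ lessI] by metis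
  obtain y where y: "(d (h x))(n := d (h x) n - e) = d y" "y \<in> h ` T"
    using e(2) by (rule imageE)
  have "v \<notin> supp (h x)" using \<rho>(3,4) by simp
  then have "d (h x) n = 0" using d(2) by (simp add: supp_def)
  moreover have "d y n \<ge> 0" using d(2)[of y] y(2) hT by (auto simp: book_def)
  ultimately show False using fun_cong[OF y(1), of n] e(1) by simp
qed

text \<open>The connected pages near a spine point are mapped into single pages, and two different pages
  cannot be mapped into the same one.\<close>

lemma card_extensions_le:
  assumes \<tau>: "\<tau> \<in> K1" "card \<tau> = Suc n" "card (extensions K1 \<tau>) \<ge> 3"
    and top1: "\<And>\<sigma>. \<sigma> \<in> K1 \<Longrightarrow> card \<sigma> \<le> Suc (Suc n)"
    and top2: "\<And>\<sigma>. \<sigma> \<in> K2 \<Longrightarrow> card \<sigma> \<le> Suc (Suc n)"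
  obtains \<rho> where "\<rho> \<in> K2" "card \<rho> = Suc n" "card (extensions K1 \<tau>) \<le> card (extensions K2 \<rho>)"
proof -
  have "\<tau> \<noteq> {}" using \<tau> by auto
  then obtain x where x: "x \<in> geometric_realization K1" "supp x = \<tau>" "card \<tau> \<le> card (supp (h x))"
    using simplex_meets_large_simplex[OF \<tau>(1)] by metis
  define \<rho> where "\<rho> = supp (h x)"
  have hx: "h x \<in> geometric_realization K2" using h_mem x by blast
  then have \<rho>K: "\<rho> \<in> K2" "finite \<rho>" using B.supp_face by (auto simp: \<rho>_def)
  \<comment> \<open>The image simplex of \<open>x\<close> has at least the dimension of the spine;
    once the top dimension is excluded, the dimension is preserved.\<close>
  have "card \<rho> \<noteq> Suc (Suc n)"
    unfolding \<rho>_def using spine_not_in_open_top_simplex[OF \<tau> top2 x(1,2)] by blast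
  then have \<rho>: "card \<rho> = Suc n"
    using x(3) \<tau>(2) top2[OF \<rho>K(1)] by (simp add: \<rho>_def)
  let ?A = "extensions K1 \<tau>" and ?B = "extensions K2 \<rho>"
  have star1: "star K1 \<tau> = book \<tau> ?A" using A.star_eq_book[OF \<tau>(1)] top1 \<tau>(2) by simp
  have star2: "star K2 \<rho> = book \<rho> ?B" using B.star_eq_book[OF \<rho>K(1)] top2 \<rho> by simp
  have disjB: "\<rho> \<inter> ?B = {}" by (auto simp: extensions_def)
  let ?N = "geometric_realization K1 \<inter> h -` star K2 \<rho>"
  have opN: "openin (top_of_set (geometric_realization K1)) ?N"
    using \<rho>K(2) by (intro openin_preimage openin_star)
  have xN: "x \<in> ?N" using x hx by (simp add: star_def \<rho>_def)
  have hN: "h ` ?N \<subseteq> book \<rho> ?B" using star2 by auto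
  have contN: "continuous_on ?N h"
    using homeomorphism_cont1[OF hom] by (rule continuous_on_subset) blast
  \<comment> \<open>Three pages at \<open>\<rho>\<close> make the argument about spine points
    available for the inverse map too.\<close>
  have B3: "card ?B \<ge> 3"
  proof (rule ccontr)
    assume "\<not> card ?B \<ge> 3"
    then obtain k where k: "continuous_on (book \<rho> ?B) k" "inj_on k (book \<rho> ?B)"
      "k ` book \<rho> ?B \<subseteq> fin_seqs (Suc n)"
      using book_euclidean_injection[OF \<rho>K(2) B.finite_extensions disjB \<rho>] by fastforce
    have "continuous_on ?N (k \<circ> h)"
      using contN continuous_on_subset[OF k(1) hN] by (rule continuous_on_compose)
    moreover have "inj_on (k \<circ> h) ?N"
      using inj_on_subset[OF k(2) hN] by (intro comp_inj_on inj_on_h) auto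
    moreover have "(k \<circ> h) ` ?N \<subseteq> fin_seqs (Suc n)"
      using hN k(3) unfolding image_comp[symmetric] by blast
    ultimately show False
      by (rule A.no_euclidean_nbhd_on_spine[OF \<tau> opN xN x(2)])
  qed
  interpret inv: complex_homeomorphism K2 K1 h' h by (rule inverse)
  have on_spine: "supp (h y) = \<rho>" if y: "y \<in> ?N" "supp y = \<tau>" for y
  proof -
    have "h y \<in> book \<rho> ?B" using y hN by blast
    moreover have "card (supp (h y)) \<noteq> Suc (Suc n)"
      using spine_not_in_open_top_simplex[OF \<tau> top2] y by blast
    moreover have "card (insert u \<rho>) = Suc (Suc n)" if "u \<in> ?B" for u
      using that \<rho> \<rho>K(2) by (simp add: extensions_def)
    ultimately show ?thesis by (auto simp: book_def)
  qed
  \<comment> \<open>Otherwise the inverse would send a spine point of \<open>\<rho>\<close> into an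
    open top-dimensional simplex.\<close>
  have on_page: "\<exists>v\<in>?B. supp (h y) = insert v \<rho>" if y: "y \<in> ?N" "u \<in> ?A" "supp y = insert u \<tau>" for y u
  proof -
    have hy: "h y \<in> book \<rho> ?B" "h y \<in> geometric_realization K2" using y hN h_mem by blast+
    have "supp (h y) \<noteq> \<rho>"
    proof
      assume s: "supp (h y) = \<rho>"
      have "h' (h y) = y" using y homeomorphism_apply1[OF hom] by blast
      then have "card (supp y) \<noteq> Suc (Suc n)"
        using inv.spine_not_in_open_top_simplex[OF \<rho>K(1) \<rho> B3 top1 hy(2) s] by simp
      moreover have "card (insert u \<tau>) = Suc (Suc n)"
        using y(2) \<tau>(2) A.finite_face[OF \<tau>(1)] by (simp add: extensions_def)
      ultimately show False using y(3) by simp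
    qed
    then show ?thesis using hy(1) by (auto simp: book_def)
  qed
  obtain W where W: "open W" "?N = geometric_realization K1 \<inter> W"
    using opN by (auto simp: openin_open)
  have "x \<in> W" using xN W by blast
  then obtain Q where Q: "open Q" "x \<in> Q" "Q \<subseteq> W"
    "\<And>y z t. y \<in> Q \<Longrightarrow> z \<in> Q \<Longrightarrow> t \<in> {0..1} \<Longrightarrow> segment_point t y z \<in> Q"
    using open_fun_contains_box[OF W(1)] by metis
  \<comment> \<open>The part of an open page inside the convex neighbourhood \<open>Q\<close> is
    connected and nonempty, so its image lies in a single page.\<close>
  have "\<exists>v\<in>?B. \<forall>y\<in>geometric_realization K1 \<inter> Q. supp y = insert u \<tau> \<longrightarrow> supp (h y) = insert v \<rho>"
    if u: "u \<in> ?A" for u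
  proof -
    define C where "C = {y \<in> geometric_realization K1 \<inter> Q. supp y = insert u \<tau>}"
    have CN: "C \<subseteq> ?N" using Q(3) W(2) by (auto simp: C_def)
    have "segment_point t y z \<in> C" if "y \<in> C" "z \<in> C" "t \<in> {0..1}" for y z t
      using A.open_simplex_segment[of y z "insert u \<tau>" t] Q(4)[of y z t] that by (auto simp: C_def)
    then have "connected C" by (rule connected_if_segments)
    then have conn: "connected (h ` C)"
      using continuous_on_subset[OF contN CN] by (rule connected_continuous_image[rotated])
    obtain e where e: "0 < e" "e < 1" "(\<lambda>v. (1 - e) * x v + e * indicator {u} v) \<in> Q"
      using segment_to_vertex_into_open[OF Q(1,2)] by metis
    define y0 where "y0 = (\<lambda>v. (1 - e) * x v + e * indicator {u} v)"
    have "\<forall>v. x v \<ge> 0" using x(1) by (simp add: A.realization_iff)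
    then have "supp y0 = insert u \<tau>"
      using supp_segment_to_vertex[OF e(1,2), of x u] x(2) by (simp add: y0_def)
    moreover have "y0 \<in> geometric_realization K1"
      using A.segment_to_vertex_in_realization[OF e(1,2) x(1)] u x(2) by (simp add: y0_def)
    ultimately have "y0 \<in> C" using e(3) by (simp add: C_def y0_def)
    then obtain v where v: "v \<in> ?B" "supp (h y0) = insert v \<rho>"
      using on_page[OF _ u, of y0] CN by (auto simp: C_def)
    have pg: "\<exists>w\<in>?B. supp z = insert w \<rho>" if "z \<in> h ` C" for z
      using that on_page[OF _ u] CN by (auto simp: C_def)
    have "supp (h y) = insert v \<rho>" if y: "y \<in> C" for y
      using connected_in_single_page[OF conn pg disjB imageI[OF \<open>y0 \<in> C\<close>] v(2,1) imageI[OF y]] .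
    then show ?thesis using v(1) by (auto simp: C_def)
  qed
  then obtain \<pi> where \<pi>: "\<And>u. u \<in> ?A \<Longrightarrow> \<pi> u \<in> ?B"
    "\<And>u y. \<lbrakk>u \<in> ?A; y \<in> geometric_realization K1 \<inter> Q; supp y = insert u \<tau>\<rbrakk> \<Longrightarrow> supp (h y) = insert (\<pi> u) \<rho>"
    by metis
  have "inj_on \<pi> ?A"
  proof (rule inj_onI, rule ccontr)
    fix u w assume uw: "u \<in> ?A" "w \<in> ?A" "\<pi> u = \<pi> w" "u \<noteq> w"
    have one: "supp (h y) = \<rho> \<or> supp (h y) = insert (\<pi> u) \<rho>" if y: "y \<in> book \<tau> {u, w} \<inter> Q" for y
    proof -
      have yK: "y \<in> geometric_realization K1 \<inter> Q"
        using y A.book_subset_star[OF \<tau>(1), of "{u, w}"] uw by (auto simp: star_def)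
      then have "y \<in> ?N" using Q(3) W(2) by blast
      moreover have "supp y = \<tau> \<or> supp y = insert u \<tau> \<or> supp y = insert w \<tau>"
        using y by (auto simp: book_def)
      ultimately show ?thesis using on_spine \<pi>(2)[OF uw(1) yK] \<pi>(2)[OF uw(2) yK] uw(3) by metis
    qed
    have "\<pi> u \<notin> \<rho>" using \<pi>(1)[OF uw(1)] by (simp add: extensions_def)
    then show False
      using two_pages_not_into_one[OF \<tau>(1,2) uw(1,2,4) Q(1,2) x(1,2) \<rho>K(2) \<rho> _ \<rho>_def[symmetric] one] by blast
  qed
  then have "card ?A \<le> card ?B"
    using \<pi>(1) B.finite_extensions by (intro card_inj_on_le) auto
  then show ?thesis using that \<rho>K(1) \<rho> by blast
qed

end

section \<open>Multichains and lattice paths\<close>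

text \<open>A path is represented by its set of points. The conditions are symmetric under
  exchanging the coordinates, so excursions below the diagonal are handled by transposition; with
  \<open>backward\<close> besides \<open>forward\<close> the path can be walked from either
  end.\<close>

locale lattice_path =
  fixes r :: nat and L :: "(nat \<times> nat) set"
  assumes bounds: "(u, v) \<in> L \<Longrightarrow> u \<le> r \<and> v \<le> r"
    and mono: "(u, v) \<in> L \<Longrightarrow> (u', v') \<in> L \<Longrightarrow> u < u' \<Longrightarrow> v \<le> v'"
    and start: "(0, 0) \<in> L" and finish: "(r, r) \<in> L"
    and forward: "(u, v) \<in> L \<Longrightarrow> (u, v) \<noteq> (r, r) \<Longrightarrow> (Suc u, v) \<in> L \<or> (u, Suc v) \<in> L"
    and backward: "(u, v) \<in> L \<Longrightarrow> (u, v) \<noteq> (0, 0) \<Longrightarrow>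
      (u > 0 \<and> (u - 1, v) \<in> L) \<or> (v > 0 \<and> (u, v - 1) \<in> L)"
begin

lemma mono': "(u, v) \<in> L \<Longrightarrow> (u', v') \<in> L \<Longrightarrow> v < v' \<Longrightarrow> u \<le> u'"
  using mono by (meson leD leI)

lemma transpose: "lattice_path r (L\<inverse>)"
proof
  fix u v assume "(u, v) \<in> L\<inverse>"
  then have vu: "(v, u) \<in> L" by simp
  show "u \<le> r \<and> v \<le> r" using bounds[OF vu] by simp
  show "v \<le> v'" if "(u', v') \<in> L\<inverse>" "u < u'" for u' v'
    using mono'[OF vu] that by simp
  show "(Suc u, v) \<in> L\<inverse> \<or> (u, Suc v) \<in> L\<inverse>" if "(u, v) \<noteq> (r, r)"
    using forward[OF vu] that by auto
  show "u > 0 \<and> (u - 1, v) \<in> L\<inverse> \<or> v > 0 \<and> (u, v - 1) \<in> L\<inverse>" if "(u, v) \<noteq> (0, 0)"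
    using backward[OF vu] that by auto
qed (use start finish in auto)

lemma same_sum: "(u, v) \<in> L \<Longrightarrow> (u', v') \<in> L \<Longrightarrow> u + v = u' + v' \<Longrightarrow> u = u' \<and> v = v'"
  using mono[of u v u' v'] mono[of u' v' u v] by (cases u u' rule: linorder_cases) auto

text \<open>This makes cliques linearly ordered: the relation need not be transitive, but a directed
  triangle collapses.\<close>

lemma no_three_cycle:
  assumes "(x, y) \<in> L" "(y, z) \<in> L" "(z, x) \<in> L"
  shows "x = y \<and> y = z"
  using mono[OF assms(1,2)] mono[OF assms(2,3)] mono[OF assms(3,1)]
    mono[OF assms(2,1)] mono[OF assms(3,2)] mono[OF assms(1,3)] by linarith

lemma no_two_cycle: "(x, y) \<in> L \<Longrightarrow> (y, x) \<in> L \<Longrightarrow> x = y"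
  using mono[of x y y x] mono[of y x x y] by linarith

text \<open>The part of the path between two consecutive diagonal points, when it stays strictly above the
  diagonal in between.\<close>

definition excursion :: "nat \<Rightarrow> nat \<Rightarrow> bool" where
  "excursion i m \<longleftrightarrow> (i, i) \<in> L \<and> (m, m) \<in> L \<and> (i, Suc i) \<in> L \<and> i + 2 \<le> m \<and>
     (\<forall>x. i < x \<longrightarrow> x < m \<longrightarrow> (x, x) \<notin> L)"

text \<open>\<open>k\<close> is the top of the vertical run in column i. It exceeds i + 1, since the
  path turns right there and would otherwise hit the diagonal strictly between i and m.\<close>

lemma excursion_start:
  assumes "excursion i m"
  obtains k where "(i, k) \<in> L" "(Suc i, k) \<in> L" "i + 2 \<le> k" "k \<le> m"
proof -
  have ex: "(i, i) \<in> L" "(m, m) \<in> L" "(i, Suc i) \<in> L" "i + 2 \<le> m"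
    "\<And>x. i < x \<Longrightarrow> x < m \<Longrightarrow> (x, x) \<notin> L"
    using assms by (auto simp: excursion_def)
  define k where "k = Max {v. (i, v) \<in> L}"
  have "{v. (i, v) \<in> L} \<subseteq> {..r}" by (auto dest: bounds)
  then have fin: "finite {v. (i, v) \<in> L}" by (rule finite_subset) simp
  then have k: "(i, k) \<in> L" "\<And>v. (i, v) \<in> L \<Longrightarrow> v \<le> k"
    using Max_in[OF fin] ex by (auto simp: k_def)
  have "m \<le> r" using ex bounds by blast
  then have "(i, k) \<noteq> (r, r)" using ex by auto
  then have s: "(Suc i, k) \<in> L" using forward[OF k(1)] k(2)[of "Suc k"] by auto
  have "Suc i \<le> k" using k ex by blast
  moreover have "k \<noteq> Suc i" using s ex(5)[of "Suc i"] ex(4) by auto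
  moreover have "k \<le> m" using mono[OF k(1) ex(2)] ex(4) by simp
  ultimately show ?thesis using that k(1) s by simp
qed

text \<open>Walk back along the path: to get on or below the diagonal it would have to pass a
  diagonal point strictly between i and m.\<close>

lemma excursion_above:
  assumes "excursion i m" "(u, v) \<in> L" "i < u \<or> i < v" "u < m \<or> v < m"
  shows "u < v"
  using assms(2-)
proof (induction "u + v" arbitrary: u v rule: less_induct)
  case less
  have ex: "(i, i) \<in> L" "(m, m) \<in> L" "(i, Suc i) \<in> L" "i + 2 \<le> m"
    "\<And>x. i < x \<Longrightarrow> x < m \<Longrightarrow> (x, x) \<notin> L"
    using assms by (auto simp: excursion_def)
  have uv: "i \<le> u" "i \<le> v"
    using mono[OF ex(1) less.prems(1)] mono'[OF ex(1) less.prems(1)] less.prems(2) by linarith+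
  have uv': "u \<le> m" "v \<le> m"
    using mono[OF less.prems(1) ex(2)] mono'[OF less.prems(1) ex(2)] less.prems(3) by linarith+
  show ?case
  \<comment> \<open>An antidiagonal carries at most one point of the path; on this one it is (i, i +
    1), the first point of the excursion off the diagonal.\<close>
  proof (cases "u + v = 2 * i + 1")
    case True
    then show ?thesis using same_sum[OF less.prems(1) ex(3)] by simp
  next
    case False
    then have big: "u + v > 2 * i + 1" using uv less.prems(2) by linarith
    have "u > 0 \<and> (u - 1, v) \<in> L \<or> v > 0 \<and> (u, v - 1) \<in> L"
    proof (rule backward[OF less.prems(1)])
      show "(u, v) \<noteq> (0, 0)" using big by auto
    qed
    then show ?thesis
    proof
      assume a: "u > 0 \<and> (u - 1, v) \<in> L"
      have 1: "u - 1 + v < u + v" using a by simp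
      have 2: "i < u - 1 \<or> i < v" using big by arith
      have 3: "u - 1 < m \<or> v < m" using less.prems(3) by arith
      have "u - 1 < v" using less.hyps[OF 1 _ 2 3] a by blast
      moreover have "u \<noteq> v"
      proof
        assume "u = v"
        then show False using ex(5)[of u] less.prems by simp
      qed
      ultimately show ?thesis by linarith
    next
      assume a: "v > 0 \<and> (u, v - 1) \<in> L"
      have 1: "u + (v - 1) < u + v" using a by simp
      have 2: "i < u \<or> i < v - 1" using big by arith
      have 3: "u < m \<or> v - 1 < m" using less.prems(3) by arith
      have "u < v - 1" using less.hyps[OF 1 _ 2 3] a by blast
      then show ?thesis by linarith
    qed
  qed
qed

text \<open>The mirror image of the start: \<open>j\<close> is the left end of the horizontal run in
  row m.\<close>

lemma excursion_finish:
  assumes "excursion i m"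
  obtains j where "(j, m - 1) \<in> L" "(j, m) \<in> L" "(m - 1, m) \<in> L" "i \<le> j" "j + 2 \<le> m"
proof -
  have ex: "(i, i) \<in> L" "(m, m) \<in> L" "(i, Suc i) \<in> L" "i + 2 \<le> m"
    "\<And>x. i < x \<Longrightarrow> x < m \<Longrightarrow> (x, x) \<notin> L"
    using assms by (auto simp: excursion_def)
  define j where "j = (LEAST u. (u, m) \<in> L)"
  have j: "(j, m) \<in> L" "\<And>u. (u, m) \<in> L \<Longrightarrow> j \<le> u"
    unfolding j_def using ex(2) by (auto intro: LeastI Least_le)
  have "(m - 1, m) \<in> L"
    using backward[OF ex(2)] ex(4) excursion_above[OF assms, of m "m - 1"] by auto
  moreover have "(j, m - 1) \<in> L"
  proof -
    have "(j, m) \<noteq> (0, 0)" using ex by auto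
    then show ?thesis using backward[OF j(1)] j(2)[of "j - 1"] by auto
  qed
  moreover have "i \<le> j" using mono'[OF ex(1) j(1)] ex(4) by simp
  moreover have "j \<le> m - 1" using j calculation by blast
  moreover have "(m - 1, m - 1) \<notin> L" using ex(4) by (intro ex(5)) auto
  then have "j \<noteq> m - 1" using calculation(2) by metis
  ultimately show ?thesis using that j(1) by simp
qed

text \<open>\<open>i\<close> and \<open>m\<close> are the diagonal points of the path nearest to the
  gap at j. The step after (i, i) tells whether the path or its transpose runs above the
  diagonal.\<close>

lemma excursion_exists:
  assumes "j \<le> r" "(j, j) \<notin> L"
  obtains i m where "i < j" "j < m" "excursion i m \<or> lattice_path.excursion (L\<inverse>) i m"
proof -
  interpret T: lattice_path r "L\<inverse>" by (rule transpose)
  define i where "i = Max {x. x < j \<and> (x, x) \<in> L}"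
  have j0: "j \<noteq> 0" "j \<noteq> r" using assms start finish by metis+
  have fin: "finite {x. x < j \<and> (x, x) \<in> L}" by simp
  have "0 \<in> {x. x < j \<and> (x, x) \<in> L}" using start j0 by simp
  then have i: "i < j" "(i, i) \<in> L" "\<And>x. x < j \<Longrightarrow> (x, x) \<in> L \<Longrightarrow> x \<le> i"
  proof -
    have "i \<in> {x. x < j \<and> (x, x) \<in> L}" unfolding i_def using Max_in[OF fin] \<open>0 \<in> _\<close> by blast
    then show "i < j" "(i, i) \<in> L" by auto
    show "x \<le> i" if "x < j" "(x, x) \<in> L" for x
      unfolding i_def using Max_ge[OF fin] that by simp
  qed
  define m where "m = (LEAST x. j < x \<and> (x, x) \<in> L)"
  have "j < r \<and> (r, r) \<in> L" using assms j0 finish by simp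
  then have m: "j < m \<and> (m, m) \<in> L"
    unfolding m_def by (rule LeastI)
  have m_le: "m \<le> x" if "j < x \<and> (x, x) \<in> L" for x
    unfolding m_def using that by (rule Least_le)
  have between: "(x, x) \<notin> L" if "i < x" "x < m" for x
    using that i(3)[of x] m_le[of x] assms(2) by (cases x j rule: linorder_cases) force+
  have "(Suc i, i) \<in> L \<or> (i, Suc i) \<in> L"
    using forward[OF i(2)] i(1) assms(1) by auto
  then have "excursion i m \<or> T.excursion i m"
    using i m between by (auto simp: excursion_def T.excursion_def)
  then show ?thesis using that i(1) m by blast
qed

end

section \<open>Weights of multichains and translation into lattice paths\<close>

definition weight :: "nat \<Rightarrow> 'a::order \<Rightarrow> (nat \<Rightarrow> 'a) \<Rightarrow> nat" where
  "weight r a p = card {t \<in> {1..r}. p t \<le> a}"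

lemma weight_le: "weight r a p \<le> r"
proof -
  have "card {t \<in> {1..r}. p t \<le> a} \<le> card {1..r}" by (rule card_mono) auto
  then show ?thesis by (simp add: weight_def)
qed

text \<open>The entries below \<open>a\<close> occupy an initial segment of the positions, because a
  multichain increases.\<close>

lemma multichain_le_iff_weight:
  assumes "p \<in> multichains r P" "t \<in> {1..r}"
  shows "p t \<le> a \<longleftrightarrow> t \<le> weight r a p"
proof -
  have mono: "p s \<le> p s'" if "s \<in> {1..r}" "s' \<in> {1..r}" "s \<le> s'" for s s'
    using assms that by (auto simp: multichains_def mono_on_def)
  let ?S = "{t \<in> {1..r}. p t \<le> a}"
  show ?thesis
  proof
    assume "p t \<le> a"
    have "{1..t} \<subseteq> ?S"
    proof
      fix s assume "s \<in> {1..t}"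
      then have "s \<in> {1..r}" "p s \<le> p t" using assms mono[of s t] by auto
      then show "s \<in> ?S" using \<open>p t \<le> a\<close> by (auto intro: order.trans)
    qed
    then have "card {1..t} \<le> card ?S" by (intro card_mono) auto
    then show "t \<le> weight r a p" by (simp add: weight_def)
  next
    assume t: "t \<le> weight r a p"
    show "p t \<le> a"
    proof (rule ccontr)
      assume "\<not> p t \<le> a"
      have "?S \<subseteq> {1..<t}"
      proof
        fix s assume s: "s \<in> ?S"
        have "\<not> t \<le> s"
        proof
          assume "t \<le> s"
          then have "p t \<le> p s" using s assms mono by auto
          then show False using s \<open>\<not> p t \<le> a\<close> by (auto dest: order.trans)
        qed
        then show "s \<in> {1..<t}" using s by auto
      qed
      then have "card ?S \<le> card {1..<t}" by (intro card_mono) auto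
      moreover have "card {1..<t} < t" using assms by auto
      ultimately show False using t unfolding weight_def by linarith
    qed
  qed
qed

lemma multichain_eqI_weight:
  assumes "p \<in> multichains r P" "q \<in> multichains r P" "\<And>a. a \<in> P \<Longrightarrow> weight r a p = weight r a q"
  shows "p = q"
proof
  fix t
  show "p t = q t"
  proof (cases "t \<in> {1..r}")
    case True
    then have "p t \<in> P" "q t \<in> P" using assms by (auto simp: multichains_def)
    then have "q t \<le> p t" "p t \<le> q t"
      using True assms multichain_le_iff_weight by (metis order_refl)+
    then show ?thesis by simp
  next
    case False
    then show ?thesis using assms by (auto simp: multichains_def PiE_def extensional_def)
  qed
qed

lemma finite_multichains: "finite P \<Longrightarrow> finite (multichains r P)"
  by (rule finite_subset[of _ "{1..r} \<rightarrow>\<^sub>E P"]) (auto simp: multichains_def intro: finite_PiE)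

definition path_rel :: "nat \<Rightarrow> (nat \<times> nat) set \<Rightarrow> 'a::order set \<Rightarrow> (nat \<Rightarrow> 'a) \<Rightarrow> (nat \<Rightarrow> 'a) \<Rightarrow> bool" where
  "path_rel r L P p q \<longleftrightarrow> (\<forall>a\<in>P. (weight r a p, weight r a q) \<in> L)"

definition path_complex :: "nat \<Rightarrow> (nat \<times> nat) set \<Rightarrow> 'a::order set \<Rightarrow> (nat \<Rightarrow> 'a) set set" where
  "path_complex r L P = {C. C \<subseteq> multichains r P \<and>
     (\<forall>p\<in>C. \<forall>q\<in>C. p \<noteq> q \<longrightarrow> path_rel r L P p q \<or> path_rel r L P q p)}"

lemma path_rel_transpose: "path_rel r (L\<inverse>) P p q \<longleftrightarrow> path_rel r L P q p"
  by (simp add: path_rel_def)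

lemma path_complex_transpose: "path_complex r (L\<inverse>) P = path_complex r L P"
  unfolding path_complex_def path_rel_transpose by blast

text \<open>The lattice path from \<open>(0, 0)\<close> to \<open>(r, r)\<close> whose \<open>i\<close>-th step is horizontal if and only if
  \<open>i\<close> is a value of \<open>\<iota>\<close>.\<close>

definition path_of :: "nat \<Rightarrow> (nat \<Rightarrow> nat) \<Rightarrow> (nat \<times> nat) set" where
  "path_of r \<iota> = {(u, v). u \<le> r \<and> v \<le> r \<and>
     (\<forall>t\<in>{1..r}. (t \<le> u \<longrightarrow> \<iota> t - t \<le> v) \<and> (u < t \<longrightarrow> v \<le> \<iota> t - t))}"

context
  fixes r :: nat and \<iota> :: "nat \<Rightarrow> nat"
  assumes range: "\<iota> \<in> {1..r} \<rightarrow> {1..2 * r}" and smono: "strict_mono_on {1..r} \<iota>"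
begin

text \<open>\<open>\<iota> t - t\<close> counts the numbers up to \<open>\<iota> t\<close> that are
  skipped by \<open>\<iota>\<close>, that is, the vertical steps before the t-th horizontal
  one.\<close>

lemma diff_mono:
  assumes "1 \<le> s" "s \<le> t" "t \<le> r"
  shows "s \<le> \<iota> s" "\<iota> s - s \<le> \<iota> t - t" "\<iota> t - t \<le> r"
proof -
  have ge: "s \<le> \<iota> s" if "s \<in> {1..r}" for s
    using that
  proof (induction s)
    case (Suc s)
    show ?case
    proof (cases "s = 0")
      case True
      then show ?thesis using range Suc.prems by auto
    next
      case False
      then have "\<iota> s < \<iota> (Suc s)" using Suc.prems smono by (auto simp: strict_mono_on_def)
      moreover have "s \<le> \<iota> s" using False Suc by simp
      ultimately show ?thesis by simp
    qed
  qed simp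
  have add: "\<iota> s + k \<le> \<iota> (s + k)" if "1 \<le> s" "s + k \<le> r" for s k
    using that
  proof (induction k)
    case (Suc k)
    then have "\<iota> (s + k) < \<iota> (s + Suc k)" using smono by (auto simp: strict_mono_on_def)
    then show ?case using Suc by simp
  qed simp
  show "s \<le> \<iota> s" using ge assms by simp
  have "\<iota> s + (t - s) \<le> \<iota> t" using add[of s "t - s"] assms by simp
  then show "\<iota> s - s \<le> \<iota> t - t" using assms by linarith
  have "\<iota> t + (r - t) \<le> \<iota> r" using add[of t "r - t"] assms by simp
  moreover have "\<iota> r \<le> 2 * r" using range assms by auto
  ultimately show "\<iota> t - t \<le> r" using assms by linarith
qed

lemma lattice_path_path_of: "lattice_path r (path_of r \<iota>)"
proof
  fix u v
  assume uv: "(u, v) \<in> path_of r \<iota>"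
  then have uv': "u \<le> r" "v \<le> r" "\<And>t. 1 \<le> t \<Longrightarrow> t \<le> u \<Longrightarrow> \<iota> t - t \<le> v"
    "\<And>t. u < t \<Longrightarrow> t \<le> r \<Longrightarrow> v \<le> \<iota> t - t"
    by (auto simp: path_of_def)
  show "u \<le> r \<and> v \<le> r" using uv' by simp
  show "v \<le> v'" if "(u', v') \<in> path_of r \<iota>" "u < u'" for u' v'
  proof -
    have "u' \<in> {1..r}" "\<iota> u' - u' \<le> v'" using that by (auto simp: path_of_def)
    then show ?thesis using uv'(4)[of u'] that(2) by simp
  qed
  show "(Suc u, v) \<in> path_of r \<iota> \<or> (u, Suc v) \<in> path_of r \<iota>" if "(u, v) \<noteq> (r, r)"
  \<comment> \<open>In this case all vertical steps due before the horizontal step number u + 1 have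
    been made, so the path moves right.\<close>
  proof (cases "u < r \<and> \<iota> (Suc u) - Suc u \<le> v")
    case True
    have "\<iota> t - t \<le> v" if "1 \<le> t" "t \<le> Suc u" for t
      using that True uv'(3)[of t] by (cases "t = Suc u") auto
    then show ?thesis using True uv' by (auto simp: path_of_def)
  next
    case False
    have "v < \<iota> t - t" if "u < t" "t \<le> r" for t
      using diff_mono(2)[of "Suc u" t] that False by simp
    moreover have "v < r"
      using False diff_mono(3)[of "Suc u" "Suc u"] that uv' by (cases "u = r") auto
    ultimately have "(u, Suc v) \<in> path_of r \<iota>"
      using uv' by (auto simp: path_of_def Suc_le_eq intro: le_SucI)
    then show ?thesis ..
  qed
  show "u > 0 \<and> (u - 1, v) \<in> path_of r \<iota> \<or> v > 0 \<and> (u, v - 1) \<in> path_of r \<iota>" if "(u, v) \<noteq> (0, 0)"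
  proof (cases "u > 0 \<and> v \<le> \<iota> u - u")
    case True
    have "v \<le> \<iota> t - t" if "u \<le> t" "t \<le> r" for t
      using that True uv'(4)[of t] by (cases "t = u") auto
    then show ?thesis using True uv' by (auto simp: path_of_def)
  next
    case False
    have "\<iota> t - t \<le> v - 1" if "1 \<le> t" "t \<le> u" for t
      using diff_mono(2)[of t u] that False uv'(1) by linarith
    moreover have "v - 1 \<le> \<iota> t - t" if "u < t" "t \<le> r" for t
      using uv'(4)[OF that] by linarith
    moreover have "0 < v" using False that by (cases "u = 0") auto
    ultimately have "v > 0 \<and> (u, v - 1) \<in> path_of r \<iota>"
      using uv'(1,2) by (simp add: path_of_def)
    then show ?thesis ..
  qed
next
  show "(0, 0) \<in> path_of r \<iota>" by (simp add: path_of_def)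
  show "(r, r) \<in> path_of r \<iota>" using diff_mono(3) by (auto simp: path_of_def)
qed

text \<open>An entry of index t is below \<open>a\<close> iff t is at most the weight, so
  inequalities between entries become bounds between the weights at every \<open>a\<close>. For the
  converse it suffices to test \<open>p t\<close> and \<open>q s\<close>.\<close>

lemma multichain_rel_iff_path_rel:
  assumes p: "p \<in> multichains r P" and q: "q \<in> multichains r P"
  shows "multichain_rel r \<iota> p q \<longleftrightarrow> path_rel r (path_of r \<iota>) P p q"
  unfolding path_rel_def
proof
  assume rel: "multichain_rel r \<iota> p q"
  show "\<forall>a\<in>P. (weight r a p, weight r a q) \<in> path_of r \<iota>"
  proof
    fix a assume "a \<in> P"
    have "\<iota> t - t \<le> weight r a q" if t: "t \<in> {1..r}" "t \<le> weight r a p" for t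
    proof (cases "\<iota> t - t = 0")
      case False
      then have s: "\<iota> t - t \<in> {1..r}" using diff_mono(3)[of t t] t by auto
      then have "q (\<iota> t - t) \<le> p t" using rel t by (auto simp: multichain_rel_def)
      also have "p t \<le> a" using multichain_le_iff_weight[OF p] t by blast
      finally show ?thesis using multichain_le_iff_weight[OF q s] by blast
    qed simp
    moreover have "weight r a q \<le> \<iota> t - t" if t: "t \<in> {1..r}" "weight r a p < t" for t
    proof (rule ccontr)
      let ?s = "weight r a q"
      assume "\<not> ?s \<le> \<iota> t - t"
      then have s: "\<iota> t - t < ?s" "?s \<in> {1..r}" using weight_le[of r a q] by auto
      then have "p t \<le> q ?s" using rel t(1) unfolding multichain_rel_def by blast
      moreover have "q ?s \<le> a" using multichain_le_iff_weight[OF q s(2)] by blast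
      ultimately have "p t \<le> a" by (meson order.trans)
      then show False using multichain_le_iff_weight[OF p t(1)] t(2) by simp
    qed
    ultimately show "(weight r a p, weight r a q) \<in> path_of r \<iota>"
      using weight_le by (auto simp: path_of_def)
  qed
next
  assume rel: "\<forall>a\<in>P. (weight r a p, weight r a q) \<in> path_of r \<iota>"
  show "multichain_rel r \<iota> p q"
    unfolding multichain_rel_def
  proof (intro ballI conjI impI)
    fix t s assume ts: "t \<in> {1..r}" "s \<in> {1..r}"
    have P: "p t \<in> P" "q s \<in> P" using p q ts by (auto simp: multichains_def)
    show "q s \<le> p t" if "s \<le> \<iota> t - t"
    proof -
      have "t \<le> weight r (p t) p" using multichain_le_iff_weight[OF p ts(1)] by blast
      then have "\<iota> t - t \<le> weight r (p t) q" using rel P ts by (auto simp: path_of_def)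
      then show ?thesis using multichain_le_iff_weight[OF q ts(2)] that by simp
    qed
    show "p t \<le> q s" if "\<iota> t - t < s"
    proof -
      have "s \<le> weight r (q s) q" using multichain_le_iff_weight[OF q ts(2)] by blast
      then have "\<not> weight r (q s) p < t" using rel P ts that by (fastforce simp: path_of_def)
      then show ?thesis using multichain_le_iff_weight[OF p ts(1)] by simp
    qed
  qed
qed

end

lemma multichain_complex_eq_path_complex:
  assumes "\<iota> \<in> {1..r} \<rightarrow> {1..2 * r}" "strict_mono_on {1..r} \<iota>"
  shows "multichain_complex r \<iota> P = path_complex r (path_of r \<iota>) P"
proof -
  have eq: "{p, q} \<in> multichain_edges r \<iota> P \<longleftrightarrow>
      path_rel r (path_of r \<iota>) P p q \<or> path_rel r (path_of r \<iota>) P q p"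
    if "p \<in> multichains r P" "q \<in> multichains r P" "p \<noteq> q" for p q
  proof -
    have "{p, q} \<in> multichain_edges r \<iota> P \<longleftrightarrow> multichain_rel r \<iota> p q \<or> multichain_rel r \<iota> q p"
      using that by (auto simp: multichain_edges_def doubleton_eq_iff)
    then show ?thesis using that multichain_rel_iff_path_rel[OF assms] by blast
  qed
  show ?thesis
    unfolding multichain_complex_def clique_complex_def path_complex_def
  proof (intro Collect_cong conj_cong refl ball_cong imp_cong)
    fix C p q assume "C \<subseteq> multichains r P" "p \<in> C" "q \<in> C" "p \<noteq> q"
    then show "{p, q} \<in> multichain_edges r \<iota> P \<longleftrightarrow>
      path_rel r (path_of r \<iota>) P p q \<or> path_rel r (path_of r \<iota>) P q p"
      using eq by blast
  qed
qed

lemma exists_sorted_list: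
  assumes "finite A" "transp_on A R" "asymp_on A R"
    and "\<And>x y. x \<in> A \<Longrightarrow> y \<in> A \<Longrightarrow> x \<noteq> y \<Longrightarrow> R x y \<or> R y x"
  obtains xs where "set xs = A" "sorted_wrt R xs" "length xs = card A"
  using assms
proof (induction "card A" arbitrary: A thesis)
  case 0
  then show ?case by (metis card_0_eq length_0_conv list.set(1) sorted_wrt.simps(1))
next
  case (Suc n)
  then have "A \<noteq> {}" by auto
  then obtain m where m: "m \<in> A" "\<forall>x\<in>A. x \<noteq> m \<longrightarrow> \<not> R x m"
    using Finite_Set.bex_min_element[of A R] Suc.prems by auto
  have sub: "A - {m} \<subseteq> A" by blast
  have "n = card (A - {m})" using Suc.hyps(2) m(1) Suc.prems(2) by simp
  then obtain xs where xs: "set xs = A - {m}" "sorted_wrt R xs" "length xs = card (A - {m})"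
    using Suc.hyps(1)[of "A - {m}"] Suc.prems(2-)
    by (metis DiffD1 asymp_on_subset finite_Diff sub transp_on_subset)
  have "R m x" if "x \<in> set xs" for x
    using that xs(1) m Suc.prems(5)[of m x] by blast
  then have "sorted_wrt R (m # xs)" "set (m # xs) = A" "length (m # xs) = card A"
    using xs m Suc.prems(2) Suc.hyps(2) by auto
  then show ?case using Suc.prems(1) by blast
qed

lemma chain_enumeration:
  fixes C :: "'a::order set"
  assumes "finite C" "Complete_Partial_Order.chain (\<le>) C"
  obtains a where "bij_betw a {1..card C} C" "strict_mono_on {1..card C} a"
proof -
  have tot: "x < y \<or> y < x" if "x \<in> C" "y \<in> C" "x \<noteq> y" for x y
    using assms(2) that unfolding chain_def less_le by metis
  obtain xs where xs: "set xs = C" "sorted_wrt (<) xs" "length xs = card C"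
    using exists_sorted_list[OF assms(1) transp_on_less asymp_on_less tot] by blast
  define a where "a = (\<lambda>i. xs ! (i - 1))"
  have mono: "strict_mono_on {1..card C} a"
    using xs by (auto simp: strict_mono_on_def a_def sorted_wrt_iff_nth_less)
  have "a ` {1..card C} = C"
  proof
    show "a ` {1..card C} \<subseteq> C" using xs by (auto simp: a_def)
    show "C \<subseteq> a ` {1..card C}"
    proof
      fix x assume "x \<in> C"
      then obtain j where "j < length xs" "x = xs ! j" using xs(1) by (auto simp: in_set_conv_nth)
      then show "x \<in> a ` {1..card C}" using xs(3) by (intro image_eqI[of _ _ "Suc j"]) (auto simp: a_def)
    qed
  qed
  moreover have "inj_on a {1..card C}"
    using mono by (rule strict_mono_on_imp_inj_on)
  ultimately show ?thesis using that mono by (auto simp: bij_betw_def)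
qed

section \<open>Explicit cliques and bounds on the size of cliques\<close>

text \<open>Multichains with at most four different entries suffice for all cliques constructed
  below. Their weight at any element is a cut, 0 or r, so relations between them reduce to finitely
  many points of the path.\<close>

definition block :: "nat \<Rightarrow> nat \<Rightarrow> nat \<Rightarrow> nat \<Rightarrow> 'a \<Rightarrow> 'a \<Rightarrow> 'a \<Rightarrow> 'a \<Rightarrow> nat \<Rightarrow> 'a" where
  "block r x y z A B C D =
     (\<lambda>t\<in>{1..r}. if t \<le> x then A else if t \<le> y then B else if t \<le> z then C else D)"

lemma block_in_multichains:
  assumes "A \<in> P" "B \<in> P" "C \<in> P" "D \<in> P" "A \<le> B" "B \<le> C" "C \<le> D"
  shows "block r x y z A B C D \<in> multichains r P"
proof -
  have "A \<le> C" "B \<le> D" "A \<le> D" using assms order.trans by blast+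
  then show ?thesis using assms by (auto simp: multichains_def block_def mono_on_def)
qed

lemma weight_block:
  assumes "x \<le> y" "y \<le> z" "z \<le> r" "A \<le> B" "B \<le> C" "C \<le> D"
  shows "weight r a (block r x y z A B C D) =
    (if D \<le> a then r else if C \<le> a then z else if B \<le> a then y else if A \<le> a then x else 0)"
    (is "_ = ?n")
proof -
  have le: "D \<le> a \<Longrightarrow> C \<le> a" "C \<le> a \<Longrightarrow> B \<le> a" "B \<le> a \<Longrightarrow> A \<le> a"
    using assms order.trans by blast+
  have "{t \<in> {1..r}. block r x y z A B C D t \<le> a} = {1..?n}"
    using assms(1-3) le by (auto simp: block_def)
  then show ?thesis by (simp add: weight_def)
qed

lemma path_complex_list:
  assumes "sorted_wrt (path_rel r L P) vs" "set vs \<subseteq> multichains r P"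
  shows "set vs \<in> path_complex r L P"
proof -
  have "path_rel r L P (vs ! i) (vs ! j) \<or> path_rel r L P (vs ! j) (vs ! i)"
    if "i < length vs" "j < length vs" "i \<noteq> j" for i j
    using that assms(1) sorted_wrt_iff_nth_less by (metis linorder_neqE_nat)
  then have "path_rel r L P p q \<or> path_rel r L P q p" if "p \<in> set vs" "q \<in> set vs" "p \<noteq> q" for p q
    using that unfolding in_set_conv_nth by blast
  then show ?thesis
    using assms(2) unfolding path_complex_def by blast
qed

lemma path_complex_subset:
  "\<sigma> \<in> path_complex r L P \<Longrightarrow> \<tau> \<subseteq> \<sigma> \<Longrightarrow> \<tau> \<in> path_complex r L P"
  unfolding path_complex_def mem_Collect_eq by (meson subsetD subset_trans)

context lattice_path
begin

text \<open>A multichain with entries \<open>a\<close> and \<open>b\<close> has its cut as weight at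
  elements above \<open>a\<close> but not above \<open>b\<close>; at all other elements the weight
  does not depend on the cut.\<close>

lemma three_clique:
  assumes "(x, y) \<in> L" "(x, z) \<in> L" "(y, z) \<in> L" "x < y" "y < z"
    and ab: "a \<in> P" "b \<in> P" "a < b"
  obtains C where "C \<in> path_complex r L P" "card C = 3"
proof -
  let ?W = "\<lambda>x. block r x x x a b b b"
  have le: "x \<le> r" "y \<le> r" "z \<le> r" using assms bounds by blast+
  have w: "weight r c (?W x) = (if b \<le> c then r else if a \<le> c then x else 0)" if "x \<le> r" for x c
    using weight_block[of x x x r a b b b c] that ab(3) by simp
  have "path_rel r L P (?W x) (?W y)" "path_rel r L P (?W x) (?W z)" "path_rel r L P (?W y) (?W z)"
    unfolding path_rel_def using assms le start finish by (auto simp: w)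
  then have "set [?W x, ?W y, ?W z] \<in> path_complex r L P"
    using ab block_in_multichains[of a P b b b r] by (intro path_complex_list) (auto simp: less_imp_le)
  moreover have "\<not> b \<le> a" using ab(3) by auto
  then have "weight r a (?W x) = x" "weight r a (?W y) = y" "weight r a (?W z) = z"
    using w le by auto
  then have "?W x \<noteq> ?W y" "?W x \<noteq> ?W z" "?W y \<noteq> ?W z" using assms(4,5) by fastforce+
  then have "card (set [?W x, ?W y, ?W z]) = 3" by simp
  ultimately show ?thesis using that by blast
qed

text \<open>The weights at \<open>p\<close> are j, m - 1, m, m, m and those at \<open>q\<close> are
  i, i, i, i + 1, k: the end and the beginning of an excursion, seen at two levels of a chain. The
  entries \<open>b\<close>, \<open>q\<close>, \<open>c\<close> and the extreme ones are kept
  variable, because extensions are counted later by varying one of them.\<close>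

lemma five_clique:
  assumes L: "(i, i) \<in> L" "(m, m) \<in> L" "(i, Suc i) \<in> L" "(i, k) \<in> L" "(Suc i, k) \<in> L"
      "(j, m - 1) \<in> L" "(j, m) \<in> L" "(m - 1, m) \<in> L"
    and ord: "i + 2 \<le> k" "k \<le> m" "i \<le> j" "j + 2 \<le> m"
    and P: "z0 \<in> P" "b \<in> P" "q \<in> P" "p \<in> P" "y \<in> P" "c \<in> P" "z \<in> P"
    and le: "z0 \<le> b" "b \<le> q" "q < p" "p < y" "y \<le> c" "c \<le> z"
  defines "vs \<equiv> [block r i j m z0 p c z, block r i (m - 1) m z0 p y z, block r i i m z0 p p z,
    block r i (Suc i) m z0 q p z, block r i k m z0 b p z]"
  shows "set vs \<in> path_complex r L P" "distinct vs"
proof -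
  have m: "m \<le> r" using L bounds by blast
  have le': "z0 \<le> q" "z0 \<le> p" "b \<le> p" "p \<le> c" "p \<le> z" "q \<le> p" "p \<le> y" "y \<le> z"
    using le by (meson less_imp_le order.trans)+
  have w: "weight r a (block r i x m z0 B C z) =
      (if z \<le> a then r else if C \<le> a then m else if B \<le> a then x else if z0 \<le> a then i else 0)"
    if "i \<le> x" "x \<le> m" "z0 \<le> B" "B \<le> C" "C \<le> z" for x B C a
    using weight_block[of i x m r z0 B C z a] that m by simp
  have w1: "weight r a (vs ! 0) = (if z \<le> a then r else if c \<le> a then m else if p \<le> a then j else if z0 \<le> a then i else 0)"
    and w2: "weight r a (vs ! 1) = (if z \<le> a then r else if y \<le> a then m else if p \<le> a then m - 1 else if z0 \<le> a then i else 0)"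
    and w3: "weight r a (vs ! 2) = (if z \<le> a then r else if p \<le> a then m else if z0 \<le> a then i else 0)"
    and w4: "weight r a (vs ! 3) = (if z \<le> a then r else if p \<le> a then m else if q \<le> a then Suc i else if z0 \<le> a then i else 0)"
    and w5: "weight r a (vs ! 4) = (if z \<le> a then r else if p \<le> a then m else if b \<le> a then k else if z0 \<le> a then i else 0)"
    for a
    unfolding vs_def using w[of j p c a] w[of "m - 1" p y a] w[of i p p a] w[of "Suc i" q p a] w[of k b p a] ord le le'
    by (simp_all add: numeral_eq_Suc)
  have imp: "z \<le> a \<Longrightarrow> c \<le> a" "c \<le> a \<Longrightarrow> y \<le> a" "y \<le> a \<Longrightarrow> p \<le> a" "p \<le> a \<Longrightarrow> q \<le> a"
     "q \<le> a \<Longrightarrow> b \<le> a" "b \<le> a \<Longrightarrow> z0 \<le> a" for a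
    using le le' order.trans less_imp_le by blast+
  have "sorted_wrt (path_rel r L P) vs"
  proof -
    have vs: "vs = [vs ! 0, vs ! 1, vs ! 2, vs ! 3, vs ! 4]" by (simp add: vs_def)
    have "(weight r a (vs ! 0), weight r a (vs ! 1)) \<in> L" "(weight r a (vs ! 0), weight r a (vs ! 2)) \<in> L"
      "(weight r a (vs ! 0), weight r a (vs ! 3)) \<in> L" "(weight r a (vs ! 0), weight r a (vs ! 4)) \<in> L"
      "(weight r a (vs ! 1), weight r a (vs ! 2)) \<in> L" "(weight r a (vs ! 1), weight r a (vs ! 3)) \<in> L"
      "(weight r a (vs ! 1), weight r a (vs ! 4)) \<in> L" "(weight r a (vs ! 2), weight r a (vs ! 3)) \<in> L"
      "(weight r a (vs ! 2), weight r a (vs ! 4)) \<in> L" "(weight r a (vs ! 3), weight r a (vs ! 4)) \<in> L" for a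
      unfolding w1 w2 w3 w4 w5 using imp[of a] L start finish by (auto split: if_splits)
    then have "sorted_wrt (path_rel r L P) [vs ! 0, vs ! 1, vs ! 2, vs ! 3, vs ! 4]"
      by (simp add: path_rel_def)
    then show ?thesis by (simp only: vs[symmetric])
  qed
  moreover have "set vs \<subseteq> multichains r P"
    unfolding vs_def using P le le' by (auto intro!: block_in_multichains)
  ultimately show "set vs \<in> path_complex r L P" by (rule path_complex_list)
  have np: "\<not> p \<le> q" "\<not> y \<le> p" "\<not> c \<le> p" "\<not> z \<le> p" "\<not> z \<le> q" "\<not> y \<le> q" "\<not> c \<le> q" using le le' by (meson leD le_less_trans less_le_trans)+
  \<comment> \<open>The weights at \<open>p\<close> and \<open>q\<close> together separate the five
    multichains.\<close>
  have "map (\<lambda>v. (weight r p v, weight r q v)) vs = [(j, i), (m - 1, i), (m, i), (m, Suc i), (m, k)]"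
  proof -
    have "map (\<lambda>v. (weight r p v, weight r q v)) vs = map (\<lambda>v. (weight r p v, weight r q v)) [vs ! 0, vs ! 1, vs ! 2, vs ! 3, vs ! 4]"
      by (simp add: vs_def)
    then show ?thesis using np le le' by (simp add: w1 w2[unfolded One_nat_def] w3 w4 w5)
  qed
  moreover have "distinct [(j, i), (m - 1, i), (m, i), (m, Suc i), (m, k)]"
    using ord by auto
  ultimately show "distinct vs" by (metis distinct_map)
qed

text \<open>Two different columns of a monotone path share at most one row, and vice versa.\<close>

lemma third_eq_fourth:
  assumes isolated: "\<And>x y. (x, x) \<in> L \<Longrightarrow> (y, y) \<in> L \<Longrightarrow> (x, y) \<in> L \<Longrightarrow> x = y"
    and u: "\<And>s t. s < t \<Longrightarrow> t < 6 \<Longrightarrow> (u s, u t) \<in> L"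
  shows "u 2 = u (3::nat)"
proof (rule ccontr)
  assume neq: "u 2 \<noteq> u 3"
  have "u 0 = u 1"
    using mono[of "u 0" "u 2" "u 1" "u 3"] mono[of "u 0" "u 3" "u 1" "u 2"]
      mono[of "u 1" "u 2" "u 0" "u 3"] mono[of "u 1" "u 3" "u 0" "u 2"] u neq
    by (cases "u 0" "u 1" rule: linorder_cases) auto
  moreover have "u 4 = u 5"
    using mono'[of "u 2" "u 4" "u 3" "u 5"] mono'[of "u 3" "u 4" "u 2" "u 5"]
      mono'[of "u 2" "u 5" "u 3" "u 4"] mono'[of "u 3" "u 5" "u 2" "u 4"] u neq
    by (cases "u 4" "u 5" rule: linorder_cases) auto
  \<comment> \<open>Now (\<open>u 0\<close>, \<open>u 0\<close>) and (\<open>u 4\<close>,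
    \<open>u 4\<close>) are diagonal points joined by (\<open>u 0\<close>, \<open>u 4\<close>).
    Isolation identifies them, and \<open>u 2\<close>, \<open>u 3\<close> are caught between equal
    values.\<close>
  ultimately have "u 0 = u 4"
    using isolated[of "u 0" "u 4"] u[of 0 1] u[of 4 5] u[of 0 4] by simp
  then have "u 0 = u 2" "u 0 = u 3"
    using no_two_cycle[of "u 0" "u 2"] no_two_cycle[of "u 0" "u 3"] u[of 0 2] u[of 2 4] u[of 0 3] u[of 3 4]
    by auto
  then show False using neq by simp
qed

lemma path_rel_antisym:
  assumes "p \<in> multichains r P" "q \<in> multichains r P" "path_rel r L P p q" "path_rel r L P q p"
  shows "p = q"
  using assms no_two_cycle by (intro multichain_eqI_weight[OF assms(1,2)]) (auto simp: path_rel_def)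

text \<open>If \<open>s\<close> preceded \<open>p\<close>, the weights of the three at every element
  would form a directed triangle, which collapses.\<close>

lemma path_rel_trans_clique:
  assumes "p \<in> multichains r P" "q \<in> multichains r P" "path_rel r L P p q" "path_rel r L P q s"
    and "path_rel r L P p s \<or> path_rel r L P s p"
  shows "path_rel r L P p s"
  using assms(5)
proof
  assume sp: "path_rel r L P s p"
  have "p = q"
    using assms(3,4) sp no_three_cycle
    by (intro multichain_eqI_weight[OF assms(1,2)]) (auto simp: path_rel_def)
  then show ?thesis using assms by simp
qed

lemma sorted_clique:
  assumes "finite \<sigma>" "\<sigma> \<in> path_complex r L P"
  obtains vs where "set vs = \<sigma>" "sorted_wrt (path_rel r L P) vs" "distinct vs"
proof -
  define R where "R = (\<lambda>p q. path_rel r L P p q \<and> p \<noteq> q)"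
  have mc: "p \<in> multichains r P" if "p \<in> \<sigma>" for p
    using assms(2) that by (auto simp: path_complex_def)
  have tot: "path_rel r L P p q \<or> path_rel r L P q p" if "p \<in> \<sigma>" "q \<in> \<sigma>" "p \<noteq> q" for p q
    using assms(2) that unfolding path_complex_def by blast
  have asy: "\<not> R q p" if "R p q" "p \<in> \<sigma>" "q \<in> \<sigma>" for p q
    using that path_rel_antisym mc unfolding R_def by blast
  have tr: "R p s" if "R p q" "R q s" "p \<in> \<sigma>" "q \<in> \<sigma>" "s \<in> \<sigma>" for p q s
  proof -
    have "p \<noteq> s" using asy that by blast
    then show ?thesis
      using path_rel_trans_clique[OF mc mc, of p q s] tot that unfolding R_def by blast
  qed
  obtain vs where vs: "set vs = \<sigma>" "sorted_wrt R vs" "length vs = card \<sigma>"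
  proof (rule exists_sorted_list[OF assms(1), of R])
    show "transp_on \<sigma> R" using tr unfolding transp_on_def by blast
    show "asymp_on \<sigma> R" using asy unfolding asymp_on_def by blast
    show "R p q \<or> R q p" if "p \<in> \<sigma>" "q \<in> \<sigma>" "p \<noteq> q" for p q
      using tot that unfolding R_def by blast
  qed
  have "sorted_wrt (path_rel r L P) vs"
    using vs(2) by (rule sorted_wrt_mono_rel[rotated]) (auto simp: R_def)
  moreover have "distinct vs" using vs card_distinct by metis
  ultimately show ?thesis using that vs(1) by blast
qed

text \<open>Among six members in order, the third and the fourth have the same weight at every
  element.\<close>

lemma card_clique_le_5:
  assumes isolated: "\<And>x y. (x, x) \<in> L \<Longrightarrow> (y, y) \<in> L \<Longrightarrow> (x, y) \<in> L \<Longrightarrow> x = y"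
    and "finite P" "\<sigma> \<in> path_complex r L P"
  shows "card \<sigma> \<le> 5"
proof (rule ccontr)
  assume "\<not> card \<sigma> \<le> 5"
  have "\<sigma> \<subseteq> multichains r P" using assms(3) by (simp add: path_complex_def)
  then have "finite \<sigma>" using finite_multichains[OF assms(2)] by (rule finite_subset)
  then obtain vs where vs: "set vs = \<sigma>" "sorted_wrt (path_rel r L P) vs" "distinct vs"
    using sorted_clique assms(3) by blast
  then have len: "6 \<le> length vs" using \<open>\<not> card \<sigma> \<le> 5\<close> distinct_card by fastforce
  have "vs ! 2 = vs ! 3"
  proof (rule multichain_eqI_weight)
    show "vs ! 2 \<in> multichains r P" "vs ! 3 \<in> multichains r P"
      using len vs(1) \<open>\<sigma> \<subseteq> multichains r P\<close> by (auto simp: subset_iff)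
    fix a assume "a \<in> P"
    then show "weight r a (vs ! 2) = weight r a (vs ! 3)"
      using vs(2) len by (intro third_eq_fourth[of "\<lambda>s. weight r a (vs ! s)"] isolated)
        (auto simp: sorted_wrt_iff_nth_less path_rel_def)
  qed
  then show False using vs(3) len by (simp add: nth_eq_iff_index_eq)
qed

text \<open>The shape of the large cliques below: a family indexed by part of a chain, followed by
  two multichains showing later stages of an excursion.\<close>

lemma clique_from_family:
  assumes "finite I" "inj_on S I" "S ` I \<subseteq> multichains r P" "F \<in> multichains r P" "F' \<in> multichains r P"
    and "\<And>s t. s \<in> I \<Longrightarrow> t \<in> I \<Longrightarrow> s < t \<Longrightarrow> path_rel r L P (S s) (S t) \<or> path_rel r L P (S t) (S s)"
    and "\<And>s. s \<in> I \<Longrightarrow> path_rel r L P (S s) F" "\<And>s. s \<in> I \<Longrightarrow> path_rel r L P (S s) F'" "path_rel r L P F F'"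
    and "F \<notin> S ` I" "F' \<notin> S ` I" "F \<noteq> F'"
  shows "\<exists>\<sigma>\<in>path_complex r L P. card \<sigma> = card (I :: nat set) + 2"
proof
  have fam: "path_rel r L P (S s) (S t) \<or> path_rel r L P (S t) (S s)" if "s \<in> I" "t \<in> I" "s \<noteq> t" for s t
    using assms(6) that by (meson linorder_neqE_nat)
  show "insert F (insert F' (S ` I)) \<in> path_complex r L P"
    unfolding path_complex_def
  proof (intro CollectI conjI ballI impI)
    fix p q assume pq: "p \<in> insert F (insert F' (S ` I))" "q \<in> insert F (insert F' (S ` I))" "p \<noteq> q"
    show "path_rel r L P p q \<or> path_rel r L P q p"
    proof (cases "p \<in> S ` I \<and> q \<in> S ` I")
      case True
      then obtain s t where st: "s \<in> I" "t \<in> I" "p = S s" "q = S t" by blast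
      then have "s \<noteq> t" using pq(3) by blast
      then show ?thesis using fam st by blast
    next
      case False
      then show ?thesis using pq assms(7-9) by blast
    qed
  qed (use assms in simp)
  have "card (S ` I) = card I" using assms(2) by (rule card_image)
  then show "card (insert F (insert F' (S ` I))) = card I + 2"
    using assms(1,10-12) by simp
qed

text \<open>The pair i, m lets the entry between the cuts i and m run through the chain: n - 1
  pairwise related multichains, whose order depends on which of (i, m) and (m, i) is on the path.
  One end of the chain is reserved to display an excursion, whose stages e + 1 and k give two more
  members.\<close>

lemma large_clique_up:
  assumes ex: "excursion e f"
    and pair: "i < m" "(i, i) \<in> L" "(m, m) \<in> L" "(i, m) \<in> L \<or> (m, i) \<in> L"
    and a: "2 \<le> n" "\<And>s. s \<in> {1..n} \<Longrightarrow> a s \<in> P" "strict_mono_on {1..n} a"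
  shows "\<exists>\<sigma>\<in>path_complex r L P. card \<sigma> = n + 1"
proof -
  obtain k where k: "(e, k) \<in> L" "(Suc e, k) \<in> L" "e + 2 \<le> k" "k \<le> f"
    using excursion_start[OF ex] by blast
  have e: "(e, e) \<in> L" "(e, Suc e) \<in> L" using ex by (auto simp: excursion_def)
  have le: "i \<le> r" "m \<le> r" "e \<le> r" "Suc e \<le> r" "k \<le> r" using pair k e bounds by blast+
  have am: "a s < a t" if "s < t" "s \<in> {1..n}" "t \<in> {1..n}" for s t
    using a(3) that by (auto simp: strict_mono_on_def)
  have aml: "a s \<le> a t" if "s \<le> t" "s \<in> {1..n}" "t \<in> {1..n}" for s t
    using am[of s t] that by (cases "s = t") (auto simp: less_imp_le)
  \<comment> \<open>Both weights i and m of the family have to be related to the common value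
    \<open>\<rho>\<close> of the last two members.\<close>
  define \<rho> where "\<rho> = (if (i, m) \<in> L then m else i)"
  have \<rho>: "(i, \<rho>) \<in> L" "(m, \<rho>) \<in> L" "(\<rho>, \<rho>) \<in> L" "i \<le> \<rho>" "\<rho> \<le> m" using pair by (auto simp: \<rho>_def)
  show ?thesis
  proof (cases "m \<le> e")
    case True
    \<comment> \<open>The excursion comes after the pair, so it is displayed at
      \<open>a (n - 1)\<close>, where the whole family has weight e.\<close>
    define S where "S = (\<lambda>s. block r i m e (a 1) (a s) (a (n - 1)) (a n))"
    define F where "F = (\<lambda>x. block r \<rho> \<rho> x (a 1) (a (n - 1)) (a (n - 1)) (a n))"
    have ord: "a 1 \<le> a s" "a s \<le> a (n - 1)" "a (n - 1) \<le> a n" if "s \<in> {1..n - 1}" for s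
      using that a(1) by (auto intro!: aml)
    have ord': "a 1 \<le> a (n - 1)" "a (n - 1) \<le> a n" "\<not> a n \<le> a (n - 1)" "n - 1 \<in> {1..n - 1}"
    proof -
      have one: "1 \<in> {1..n - 1}" "n - 1 \<in> {1..n}" "n \<in> {1..n}" "n - 1 < n" using a(1) by auto
      show "a 1 \<le> a (n - 1)" "a (n - 1) \<le> a n" using ord[OF one(1)] by auto
      show "\<not> a n \<le> a (n - 1)" using am[OF one(4,2,3)] by (simp add: less_le_not_le)
      show "n - 1 \<in> {1..n - 1}" using one(1) by auto
    qed
    have wS: "weight r c (S s) = (if a n \<le> c then r else if a (n - 1) \<le> c then e else if a s \<le> c then m else if a 1 \<le> c then i else 0)"
      if "s \<in> {1..n - 1}" for s c
      unfolding S_def using ord[OF that] True pair(1) le by (intro weight_block) auto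
    have wF: "weight r c (F x) = (if a n \<le> c then r else if a (n - 1) \<le> c then x else if a 1 \<le> c then \<rho> else 0)"
      if "m \<le> x" "x \<le> r" for x c
      unfolding F_def using weight_block[of \<rho> \<rho> x r "a 1" "a (n - 1)" "a (n - 1)" "a n" c] ord' \<rho> that by simp
    have tr: "a n \<le> c \<Longrightarrow> a (n - 1) \<le> c" "a (n - 1) \<le> c \<Longrightarrow> a s \<le> c" "a s \<le> c \<Longrightarrow> a 1 \<le> c" if "s \<in> {1..n - 1}" for c s
      using ord[OF that] order.trans by blast+
    have "\<exists>\<sigma>\<in>path_complex r L P. card \<sigma> = card {1..n - 1} + 2"
    proof (rule clique_from_family[of "{1..n - 1}" S P "F (Suc e)" "F k"])
      show "inj_on S {1..n - 1}"
      proof (rule inj_onI)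
        fix s t assume st: "s \<in> {1..n - 1}" "t \<in> {1..n - 1}" "S s = S t"
        have "S s m = a s" "S t m = a t" using pair(1) le by (auto simp: S_def block_def)
        then have "a s = a t" using st(3) by simp
        then show "s = t" using st a(3) by (auto dest!: strict_mono_on_eqD)
      qed
      show "S ` {1..n - 1} \<subseteq> multichains r P"
        unfolding S_def using ord a(1,2) by (auto intro!: block_in_multichains)
      show "F (Suc e) \<in> multichains r P" "F k \<in> multichains r P"
        unfolding F_def using ord' a(1,2) by (auto intro!: block_in_multichains)
      show "path_rel r L P (S s) (F (Suc e))" "path_rel r L P (S s) (F k)" if "s \<in> {1..n - 1}" for s
        unfolding path_rel_def using wS[OF that] wF[of "Suc e"] wF[of k] True k(3) tr[OF that] tr[OF ord'(4)] \<rho> start finish k e le by auto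
      show "path_rel r L P (F (Suc e)) (F k)"
        unfolding path_rel_def using wF[of "Suc e"] wF[of k] True k(3) tr[OF ord'(4)] \<rho> start finish k e le by auto
      have "weight r (a (n - 1)) (S s) = e" if "s \<in> {1..n - 1}" for s using wS[OF that] ord' by simp
      moreover have "weight r (a (n - 1)) (F (Suc e)) = Suc e" "weight r (a (n - 1)) (F k) = k"
        using wF True k(3) le ord' by auto
      ultimately show "F (Suc e) \<notin> S ` {1..n - 1}" "F k \<notin> S ` {1..n - 1}" "F (Suc e) \<noteq> F k"
        using k(3) by fastforce+
      show "path_rel r L P (S s) (S t) \<or> path_rel r L P (S t) (S s)"
        if st: "s \<in> {1..n - 1}" "t \<in> {1..n - 1}" "s < t" for s t
      proof -
        have "a s \<le> a t" using st by (intro aml) auto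
        then have imp: "a t \<le> c \<Longrightarrow> a s \<le> c" for c by (rule order.trans)
        from pair(4) show ?thesis
        proof
          assume "(i, m) \<in> L"
          then have "path_rel r L P (S t) (S s)"
            unfolding path_rel_def wS[OF st(1)] wS[OF st(2)]
            using imp tr[OF st(1)] tr[OF st(2)] pair(2,3) e start finish by auto
          then show ?thesis ..
        next
          assume "(m, i) \<in> L"
          then have "path_rel r L P (S s) (S t)"
            unfolding path_rel_def wS[OF st(1)] wS[OF st(2)]
            using imp tr[OF st(1)] tr[OF st(2)] pair(2,3) e start finish by auto
          then show ?thesis ..
        qed
      qed
    qed simp
    then show ?thesis using a(1) by simp
  next
    case False
    \<comment> \<open>The common row or column of (i, i) and (m, m) leaves no diagonal point of the
      path strictly between them.\<close>
    have "\<not> (i < e)"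
      using mono[of i m e e] mono[of e e m i] pair e(1) False by auto
    have "k \<le> \<rho>"
    proof (cases "e = i")
      case True
      then have "(m, i) \<notin> L" using mono[of i "Suc i" m i] e(2) pair(1) by auto
      then show ?thesis using mono[OF k(1) pair(3)] True pair(1,4) by (auto simp: \<rho>_def)
    next
      case False
      then show ?thesis using mono[OF k(1) pair(2)] \<open>\<not> i < e\<close> \<rho>(4) by simp
    qed
    then have e': "e \<le> i" "Suc e \<le> \<rho>" "k \<le> \<rho>" using \<open>\<not> i < e\<close> k(3) by auto
    \<comment> \<open>The excursion starts no later than i, so it is displayed at the bottom element
      \<open>a 1\<close>; \<open>k \<le> \<rho>\<close> keeps the cuts of \<open>F\<close> in
      order.\<close>
    define S where "S = (\<lambda>s. block r e i m (a 1) (a 2) (a s) (a n))"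
    define F where "F = (\<lambda>x. block r x \<rho> \<rho> (a 1) (a 2) (a n) (a n))"
    have ord: "a 1 \<le> a 2" "a 2 \<le> a s" "a s \<le> a n" if "s \<in> {2..n}" for s
      using that a(1) by (auto intro!: aml)
    have ord': "a 1 \<le> a 2" "a 2 \<le> a n" "\<not> a 2 \<le> a 1" "\<not> a n \<le> a 1" "n \<in> {2..n}"
      using a(1) ord[of 2] am[of 1 2] am[of 1 n] by (auto simp: leD)
    have wS: "weight r c (S s) = (if a n \<le> c then r else if a s \<le> c then m else if a 2 \<le> c then i else if a 1 \<le> c then e else 0)"
      if "s \<in> {2..n}" for s c
      unfolding S_def using ord[OF that] e' pair(1) le by (intro weight_block) auto
    have wF: "weight r c (F x) = (if a n \<le> c then r else if a 2 \<le> c then \<rho> else if a 1 \<le> c then x else 0)"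
      if "x \<le> \<rho>" for x c
      unfolding F_def using weight_block[of x \<rho> \<rho> r "a 1" "a 2" "a n" "a n" c] ord' \<rho> le that by simp
    have tr: "a n \<le> c \<Longrightarrow> a s \<le> c" "a s \<le> c \<Longrightarrow> a 2 \<le> c" "a 2 \<le> c \<Longrightarrow> a 1 \<le> c" if "s \<in> {2..n}" for c s
      using ord[OF that] order.trans by blast+
    have "\<exists>\<sigma>\<in>path_complex r L P. card \<sigma> = card {2..n} + 2"
    proof (rule clique_from_family[of "{2..n}" S P "F (Suc e)" "F k"])
      show "inj_on S {2..n}"
      proof (rule inj_onI)
        fix s t assume st: "s \<in> {2..n}" "t \<in> {2..n}" "S s = S t"
        have "S s m = a s" "S t m = a t" using pair(1) le e' by (auto simp: S_def block_def)
        then have "a s = a t" using st(3) by simp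
        then show "s = t" using st a(3) by (auto dest!: strict_mono_on_eqD)
      qed
      show "S ` {2..n} \<subseteq> multichains r P"
        unfolding S_def using ord a(1,2) by (auto intro!: block_in_multichains)
      show "F (Suc e) \<in> multichains r P" "F k \<in> multichains r P"
        unfolding F_def using ord' a(1,2) by (auto intro!: block_in_multichains)
      show "path_rel r L P (S s) (F (Suc e))" "path_rel r L P (S s) (F k)" if "s \<in> {2..n}" for s
        unfolding path_rel_def using wS[OF that] wF[OF e'(2)] wF[OF e'(3)] tr[OF that] tr[OF ord'(5)] \<rho> start finish k e le by auto
      show "path_rel r L P (F (Suc e)) (F k)"
        unfolding path_rel_def using wF[OF e'(2)] wF[OF e'(3)] tr[OF ord'(5)] \<rho> start finish k e le by auto
      have "weight r (a 1) (S s) = e" if "s \<in> {2..n}" for s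
        using wS[OF that] ord' am[of 1 s] that by (auto simp: leD)
      moreover have "weight r (a 1) (F (Suc e)) = Suc e" "weight r (a 1) (F k) = k"
        using wF e' ord' by auto
      ultimately show "F (Suc e) \<notin> S ` {2..n}" "F k \<notin> S ` {2..n}" "F (Suc e) \<noteq> F k"
        using k(3) by fastforce+
      show "path_rel r L P (S s) (S t) \<or> path_rel r L P (S t) (S s)"
        if st: "s \<in> {2..n}" "t \<in> {2..n}" "s < t" for s t
      proof -
        have "a s \<le> a t" using st by (intro aml) auto
        then have imp: "a t \<le> c \<Longrightarrow> a s \<le> c" for c by (rule order.trans)
        from pair(4) show ?thesis
        proof
          assume "(i, m) \<in> L"
          then have "path_rel r L P (S t) (S s)"
            unfolding path_rel_def wS[OF st(1)] wS[OF st(2)]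
            using imp tr[OF st(1)] tr[OF st(2)] pair(2,3) e start finish by auto
          then show ?thesis ..
        next
          assume "(m, i) \<in> L"
          then have "path_rel r L P (S s) (S t)"
            unfolding path_rel_def wS[OF st(1)] wS[OF st(2)]
            using imp tr[OF st(1)] tr[OF st(2)] pair(2,3) e start finish by auto
          then show ?thesis ..
        qed
      qed
    qed simp
    then show ?thesis using a(1) by simp
  qed
qed

lemma large_clique:
  assumes nonrefl: "j \<le> r" "(j, j) \<notin> L"
    and pair: "(x, x) \<in> L" "(y, y) \<in> L" "(x, y) \<in> L" "x \<noteq> y"
    and a: "2 \<le> n" "\<And>s. s \<in> {1..n} \<Longrightarrow> a s \<in> P" "strict_mono_on {1..n} a"
  shows "\<exists>\<sigma>\<in>path_complex r L P. card \<sigma> = n + 1"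
proof -
  interpret T: lattice_path r "L\<inverse>" by (rule transpose)
  obtain i m where im: "i < m" "(i, i) \<in> L" "(m, m) \<in> L" "(i, m) \<in> L \<or> (m, i) \<in> L"
    using pair by (cases x y rule: linorder_cases) auto
  obtain e f where "excursion e f \<or> T.excursion e f" using excursion_exists[OF nonrefl] by blast
  then show ?thesis
    using large_clique_up[OF _ im a] T.large_clique_up[of e f i m n a P] im a
    by (auto simp: path_complex_transpose)
qed

end

section \<open>Extensions of cliques of size four\<close>

lemma finite_complex_path_complex: "finite P \<Longrightarrow> finite_complex (path_complex r L P)"
proof
  assume "finite P"
  have "\<Union>(path_complex r L P) \<subseteq> multichains r P" by (auto simp: path_complex_def)
  then show "finite (\<Union>(path_complex r L P))"
    using finite_multichains[OF \<open>finite P\<close>] by (rule finite_subset)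
qed (rule path_complex_subset)

lemma finite_complex_order_complex: "finite P \<Longrightarrow> finite_complex (order_complex P)"
proof
  assume "finite P"
  then show "finite (\<Union>(order_complex P))"
    by (rule finite_subset[rotated]) (auto simp: order_complex_def)
next
  fix \<sigma> \<tau> assume "\<sigma> \<in> order_complex P" "\<tau> \<subseteq> \<sigma>"
  then show "\<tau> \<in> order_complex P" unfolding order_complex_def chain_def by blast
qed

lemma (in finite_complex) card_le_card_extensions:
  assumes "inj_on v X" "\<And>x. x \<in> X \<Longrightarrow> insert (v x) \<tau> \<in> K" "\<And>x. x \<in> X \<Longrightarrow> v x \<notin> \<tau>"
  shows "card X \<le> card (extensions K \<tau>)"
  using assms finite_extensions by (intro card_inj_on_le[of v]) (auto simp: extensions_def)

text \<open>An empty first block hides its entry. Together with the dual fact for the last block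
  this lets an entry of one member of a five-clique vary while the other four stay fixed.\<close>

lemma block_cong_0: "block r 0 y z A B C D = block r 0 y z A' B C D"
  by (auto simp: block_def restrict_def)

lemma block_cong_r: "block r x y r A B C D = block r x y r A B C D'"
  by (auto simp: block_def restrict_def)

context lattice_path
begin

text \<open>The excursion starts at 0, so the least entry is hidden in four members, and the fifth
  may use any \<open>b \<le> q\<close> for it.\<close>

lemma extensions_below:
  assumes ex: "excursion 0 m" and "finite P" and P: "q \<in> P" "p \<in> P" "y \<in> P" "q < p" "p < y"
  shows "\<exists>\<tau>\<in>path_complex r L P. card \<tau> = 4 \<and> card {b \<in> P. b \<le> q} \<le> card (extensions (path_complex r L P) \<tau>)"
proof -
  interpret K: finite_complex "path_complex r L P" using \<open>finite P\<close> by (rule finite_complex_path_complex)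
  obtain k where k: "(0, k) \<in> L" "(Suc 0, k) \<in> L" "0 + 2 \<le> k" "k \<le> m" using excursion_start[OF ex] by blast
  obtain j where j: "(j, m - 1) \<in> L" "(j, m) \<in> L" "(m - 1, m) \<in> L" "0 \<le> j" "j + 2 \<le> m" using excursion_finish[OF ex] by blast
  have e: "(0, 0) \<in> L" "(m, m) \<in> L" "(0, Suc 0) \<in> L" using ex by (auto simp: excursion_def)
  have "m \<le> r" using e bounds by blast
  define v where "v = (\<lambda>b. block r 0 k m b b p y)"
  define us where "us = [block r 0 j m q p y y, block r 0 (m - 1) m q p y y, block r 0 0 m q p p y, block r 0 (Suc 0) m q q p y]"
  have five: "set (us @ [v b]) \<in> path_complex r L P" "distinct (us @ [v b])" if "b \<in> {b \<in> P. b \<le> q}" for b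
    using five_clique[OF e k(1,2) j(1-3) k(3,4) j(4,5), of b P b q p y y y] P that
    unfolding us_def v_def append.simps
      block_cong_0[of r j m b p y y q] block_cong_0[of r "m - 1" m b p y y q]
      block_cong_0[of r 0 m b p p y q] block_cong_0[of r "Suc 0" m b q p y q]
    by blast+
  show ?thesis
  proof (intro bexI conjI)
    have "set us \<subseteq> set (us @ [v q])" by auto
    then show "set us \<in> path_complex r L P" using five(1)[of q] P path_complex_subset by blast
    have "distinct us" using five(2)[of q] P by simp
    then show "card (set us) = 4" by (simp add: distinct_card us_def)
    show "card {b \<in> P. b \<le> q} \<le> card (extensions (path_complex r L P) (set us))"
    proof (rule K.card_le_card_extensions)
      show "inj_on v {b \<in> P. b \<le> q}"
      proof (rule inj_onI)
        fix b b' assume "v b = v b'"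
        then have "v b 1 = v b' 1" by simp
        then show "b = b'" using k(3,4) \<open>m \<le> r\<close> by (simp add: v_def block_def)
      qed
      show "insert (v b) (set us) \<in> path_complex r L P" "v b \<notin> set us" if "b \<in> {b \<in> P. b \<le> q}" for b
        using five[OF that] by simp_all
    qed
  qed
qed

text \<open>Only the fourth member of the five-clique contains the entry \<open>q\<close>. With all
  lower entries equal to \<open>w\<close> it ranges over a half-open interval, for any
  excursion.\<close>

lemma extensions_between:
  assumes ex: "excursion i m" and "finite P" and P: "w \<in> P" "p \<in> P" "y \<in> P" "w < p" "p < y"
  shows "\<exists>\<tau>\<in>path_complex r L P. card \<tau> = 4 \<and> card {q \<in> P. w \<le> q \<and> q < p} \<le> card (extensions (path_complex r L P) \<tau>)"
proof -
  interpret K: finite_complex "path_complex r L P" using \<open>finite P\<close> by (rule finite_complex_path_complex)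
  obtain k where k: "(i, k) \<in> L" "(Suc i, k) \<in> L" "i + 2 \<le> k" "k \<le> m" using excursion_start[OF ex] by blast
  obtain j where j: "(j, m - 1) \<in> L" "(j, m) \<in> L" "(m - 1, m) \<in> L" "i \<le> j" "j + 2 \<le> m" using excursion_finish[OF ex] by blast
  have e: "(i, i) \<in> L" "(m, m) \<in> L" "(i, Suc i) \<in> L" using ex by (auto simp: excursion_def)
  have "m \<le> r" using e bounds by blast
  define v where "v = (\<lambda>q. block r i (Suc i) m w q p y)"
  define us where "us = [block r i j m w p y y, block r i (m - 1) m w p y y, block r i i m w p p y]"
  define u where "u = block r i k m w w p y"
  have five: "set (us @ [v q, u]) \<in> path_complex r L P" "distinct (us @ [v q, u])" if "q \<in> {q \<in> P. w \<le> q \<and> q < p}" for q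
    using five_clique[OF e k(1,2) j(1-3) k(3,4) j(4,5), of w P w q p y y y] P that
    unfolding us_def v_def u_def append.simps by blast+
  show ?thesis
  proof (intro bexI conjI)
    have "set (us @ [u]) \<subseteq> set (us @ [v w, u])" by auto
    then show "set (us @ [u]) \<in> path_complex r L P" using five(1)[of w] P path_complex_subset by blast
    have "distinct (us @ [u])" using five(2)[of w] P by simp
    then show "card (set (us @ [u])) = 4" using distinct_card by (fastforce simp: us_def)
    show "card {q \<in> P. w \<le> q \<and> q < p} \<le> card (extensions (path_complex r L P) (set (us @ [u])))"
    proof (rule K.card_le_card_extensions)
      show "inj_on v {q \<in> P. w \<le> q \<and> q < p}"
      proof (rule inj_onI)
        fix b b' assume "v b = v b'"
        then have "v b (Suc i) = v b' (Suc i)" by simp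
        then show "b = b'" using k(3,4) \<open>m \<le> r\<close> by (simp add: v_def block_def)
      qed
      show "insert (v q) (set (us @ [u])) \<in> path_complex r L P" "v q \<notin> set (us @ [u])" if "q \<in> {q \<in> P. w \<le> q \<and> q < p}" for q
        using five[OF that] by (auto simp: insert_commute)
    qed
  qed
qed

text \<open>Dual to varying the least entry: the excursion ends at r, so the greatest entry is
  hidden in four members, and the first may use any \<open>c \<ge> y\<close> for it.\<close>

lemma extensions_above:
  assumes ex: "excursion i r" and "finite P" and P: "q \<in> P" "p \<in> P" "y \<in> P" "q < p" "p < y"
  shows "\<exists>\<tau>\<in>path_complex r L P. card \<tau> = 4 \<and> card {c \<in> P. y \<le> c} \<le> card (extensions (path_complex r L P) \<tau>)"
proof -
  interpret K: finite_complex "path_complex r L P" using \<open>finite P\<close> by (rule finite_complex_path_complex)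
  obtain k where k: "(i, k) \<in> L" "(Suc i, k) \<in> L" "i + 2 \<le> k" "k \<le> r" using excursion_start[OF ex] by blast
  obtain j where j: "(j, r - 1) \<in> L" "(j, r) \<in> L" "(r - 1, r) \<in> L" "i \<le> j" "j + 2 \<le> r" using excursion_finish[OF ex] by blast
  have e: "(i, i) \<in> L" "(r, r) \<in> L" "(i, Suc i) \<in> L" using ex by (auto simp: excursion_def)
  define v where "v = (\<lambda>c. block r i j r q p c c)"
  define us where "us = [block r i (r - 1) r q p y y, block r i i r q p p y, block r i (Suc i) r q q p y, block r i k r q q p y]"
  have five: "set (v c # us) \<in> path_complex r L P" "distinct (v c # us)" if "c \<in> {c \<in> P. y \<le> c}" for c
    using five_clique[OF e k(1,2) j(1-3) k(3,4) j(4,5), of q P q q p y c c] P that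
    unfolding us_def v_def block_cong_r[of r i "r - 1" q p y c y] block_cong_r[of r i i q p p c y]
      block_cong_r[of r i "Suc i" q q p c y] block_cong_r[of r i k q q p c y]
    by blast+
  show ?thesis
  proof (intro bexI conjI)
    have "set us \<subseteq> set (v y # us)" by auto
    then show "set us \<in> path_complex r L P" using five(1)[of y] P path_complex_subset by blast
    have "distinct us" using five(2)[of y] P by simp
    then show "card (set us) = 4" by (simp add: distinct_card us_def)
    show "card {c \<in> P. y \<le> c} \<le> card (extensions (path_complex r L P) (set us))"
    proof (rule K.card_le_card_extensions)
      show "inj_on v {c \<in> P. y \<le> c}"
      proof (rule inj_onI)
        fix b b' assume "v b = v b'"
        then have "v b r = v b' r" by simp
        then show "b = b'" using j(4,5) k(3,4) by (simp add: v_def block_def)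
      qed
      show "insert (v c) (set us) \<in> path_complex r L P" "v c \<notin> set us" if "c \<in> {c \<in> P. y \<le> c}" for c
        using five[OF that] by simp_all
    qed
  qed
qed

context
  assumes isolated: "\<And>x y. (x, x) \<in> L \<Longrightarrow> (y, y) \<in> L \<Longrightarrow> (x, y) \<in> L \<Longrightarrow> x = y" and nontrivial: "r > 0"
begin

text \<open>The path steps from (0, 0) to (0, 1) or (1, 0). If (1, 1) were on it, that step would
  join two diagonal points by a row and a column, against isolation.\<close>

lemma first_excursion:
  obtains m where "excursion 0 m \<or> lattice_path.excursion (L\<inverse>) 0 m"
proof -
  have "(1, 1) \<notin> L"
    using forward[OF start] isolated[of 0 1] isolated[of 1 0] start nontrivial by auto
  moreover have "1 \<le> r" using nontrivial by simp
  ultimately obtain i m where im: "i < 1" "excursion i m \<or> lattice_path.excursion (L\<inverse>) i m"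
    using excursion_exists by metis
  then have "i = 0" by simp
  show ?thesis using that im(2) unfolding \<open>i = 0\<close> by blast
qed

lemma last_excursion:
  obtains i where "excursion i r \<or> lattice_path.excursion (L\<inverse>) i r"
proof -
  interpret T: lattice_path r "L\<inverse>" by (rule transpose)
  have "(r - 1, r - 1) \<notin> L"
    using backward[OF finish] isolated[of r "r - 1"] isolated[of "r - 1" r] finish nontrivial by auto
  moreover have "r - 1 \<le> r" by simp
  ultimately obtain i m where im: "r - 1 < m" "excursion i m \<or> T.excursion i m"
    using excursion_exists by metis
  then have "(m, m) \<in> L" by (auto simp: excursion_def T.excursion_def)
  then have "m = r" using bounds im(1) by fastforce
  then show ?thesis using that im by blast
qed

lemma clique_3: "a \<in> P \<Longrightarrow> b \<in> P \<Longrightarrow> a < b \<Longrightarrow> \<exists>\<sigma>\<in>path_complex r L P. card \<sigma> = 3"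
proof -
  assume ab: "a \<in> P" "b \<in> P" "a < b"
  interpret T: lattice_path r "L\<inverse>" by (rule transpose)
  obtain m where "excursion 0 m \<or> T.excursion 0 m" by (rule first_excursion)
  then show ?thesis
  proof
    assume ex: "excursion 0 m"
    obtain k where "(0, k) \<in> L" "(Suc 0, k) \<in> L" "0 + 2 \<le> k" using excursion_start[OF ex] by blast
    moreover have "(0, Suc 0) \<in> L" using ex by (simp add: excursion_def)
    ultimately show ?thesis using three_clique[of 0 "Suc 0" k a P b] ab by auto
  next
    assume ex: "T.excursion 0 m"
    obtain k where "(0, k) \<in> L\<inverse>" "(Suc 0, k) \<in> L\<inverse>" "0 + 2 \<le> k" using T.excursion_start[OF ex] by blast
    moreover have "(0, Suc 0) \<in> L\<inverse>" using ex by (simp add: T.excursion_def)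
    ultimately show ?thesis
      using T.three_clique[of 0 "Suc 0" k a P b] ab unfolding path_complex_transpose by auto
  qed
qed

lemma clique_4_extensions:
  assumes "finite P" "w \<in> P" "p \<in> P" "y \<in> P" "w < p" "p < y"
    and X: "X = {b \<in> P. b \<le> w} \<or> X = {q \<in> P. w \<le> q \<and> q < p} \<or> X = {c \<in> P. y \<le> c}"
  shows "\<exists>\<tau>\<in>path_complex r L P. card \<tau> = 4 \<and> card X \<le> card (extensions (path_complex r L P) \<tau>)"
proof -
  interpret T: lattice_path r "L\<inverse>" by (rule transpose)
  obtain m where m: "excursion 0 m \<or> T.excursion 0 m" by (rule first_excursion)
  obtain i where i: "excursion i r \<or> T.excursion i r" by (rule last_excursion)
  note T = T.extensions_below T.extensions_between T.extensions_above
  from X show ?thesis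
  proof (elim disjE)
    assume "X = {b \<in> P. b \<le> w}"
    then show ?thesis
      using m extensions_below[OF _ assms(1-6)] T(1)[OF _ assms(1-6)] unfolding path_complex_transpose by blast
  next
    assume "X = {q \<in> P. w \<le> q \<and> q < p}"
    then show ?thesis
      using m extensions_between[OF _ assms(1-6)] T(2)[OF _ assms(1-6)] unfolding path_complex_transpose by blast
  next
    assume "X = {c \<in> P. y \<le> c}"
    then show ?thesis
      using i extensions_above[OF _ assms(1-6)] T(3)[OF _ assms(1-6)] unfolding path_complex_transpose by blast
  qed
qed

lemma clique_5:
  assumes "finite P" "w \<in> P" "p \<in> P" "y \<in> P" "w < p" "p < y"
  shows "\<exists>\<sigma>\<in>path_complex r L P. card \<sigma> = 5"
proof -
  interpret K: finite_complex "path_complex r L P" using \<open>finite P\<close> by (rule finite_complex_path_complex)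
  obtain \<tau> where \<tau>: "\<tau> \<in> path_complex r L P" "card \<tau> = 4"
    "card {b \<in> P. b \<le> w} \<le> card (extensions (path_complex r L P) \<tau>)"
    using clique_4_extensions[OF assms] by blast
  have "card {b \<in> P. b \<le> w} > 0" using assms(1,2) by (auto simp: card_gt_0_iff)
  then have "extensions (path_complex r L P) \<tau> \<noteq> {}" using \<tau>(3) by force
  then obtain v where v: "v \<notin> \<tau>" "insert v \<tau> \<in> path_complex r L P" by (auto simp: extensions_def)
  then have "card (insert v \<tau>) = 5" using K.finite_face[OF \<tau>(1)] \<tau>(2) by simp
  then show ?thesis using v(2) by blast
qed

end

end

section \<open>Excluding a homeomorphism\<close>

context complex_homeomorphism
begin

lemma card_face_le:
  assumes "\<sigma> \<in> K1" "\<And>\<tau>. \<tau> \<in> K2 \<Longrightarrow> card \<tau> \<le> n"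
  shows "card \<sigma> \<le> n"
proof (cases "\<sigma> = {}")
  case False
  then obtain x where "x \<in> geometric_realization K1" "card \<sigma> \<le> card (supp (h x))"
    using simplex_meets_large_simplex assms(1) by metis
  then show ?thesis using assms(2) B.supp_face(1)[OF h_mem] le_trans by blast
qed simp

end

text \<open>Let \<open>b\<close> extend the four-element chain \<open>\<tau>\<close> to a maximal chain. According to the position of \<open>b\<close>,
  vary one entry of a five-element clique over a lower set, an interval or an upper set; besides all
  extensions of \<open>\<tau>\<close> these sets contain two elements of \<open>\<tau>\<close>.\<close>

lemma (in lattice_path) multichain_extensions_exceed:
  assumes isolated: "\<And>x y. (x, x) \<in> L \<Longrightarrow> (y, y) \<in> L \<Longrightarrow> (x, y) \<in> L \<Longrightarrow> x = y" and "r > 0"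
    and "finite P" and top: "\<And>\<sigma>. \<sigma> \<in> order_complex P \<Longrightarrow> card \<sigma> \<le> 5"
    and \<tau>: "\<tau> \<in> order_complex P" "card \<tau> = 4" "extensions (order_complex P) \<tau> \<noteq> {}"
  shows "\<exists>\<sigma>\<in>path_complex r L P. card \<sigma> = 4 \<and>
    card (extensions (order_complex P) \<tau>) + 2 \<le> card (extensions (path_complex r L P) \<sigma>)"
proof -
  interpret O: finite_complex "order_complex P" using \<open>finite P\<close> by (rule finite_complex_order_complex)
  let ?E = "extensions (order_complex P) \<tau>"
  obtain b0 where b0: "b0 \<notin> \<tau>" "insert b0 \<tau> \<in> order_complex P" using \<tau>(3) by (auto simp: extensions_def)
  have fin: "finite \<tau>" using \<tau>(1) by (rule O.finite_face)
  then have card5: "card (insert b0 \<tau>) = 5" using b0 \<tau>(2) by simp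
  have ch: "Complete_Partial_Order.chain (\<le>) (insert b0 \<tau>)" using b0(2) by (simp add: order_complex_def)
  obtain a where a: "bij_betw a {1..5} (insert b0 \<tau>)" "strict_mono_on {1..5::nat} a"
    using chain_enumeration[OF _ ch] fin card5 by auto
  have lt: "a s < a t" if "s < t" "s \<in> {1..5}" "t \<in> {1..5}" for s t
    using a(2) that by (auto simp: strict_mono_on_def)
  have aP: "a s \<in> P" if "s \<in> {1..5}" for s
    using a(1) b0(2) that by (auto simp: bij_betw_def order_complex_def)
  have "b0 \<in> a ` {1..5}" using a(1) by (simp add: bij_betw_def)
  then obtain j where j: "j \<in> {1..5}" "a j = b0" by blast
  have a\<tau>: "a s \<in> \<tau>" if "s \<in> {1..5}" "s \<noteq> j" for s
  proof -
    have "a s \<in> insert b0 \<tau>" using a(1) that by (auto simp: bij_betw_def)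
    moreover have "a s \<noteq> a j" using a(1) that j by (auto simp: bij_betw_def inj_on_def)
    ultimately show ?thesis using j by auto
  qed
  have E: "b \<in> P" "b \<notin> \<tau>" "\<And>x. x \<in> \<tau> \<Longrightarrow> b < x \<or> x < b" if "b \<in> ?E" for b
  proof -
    have b: "b \<notin> \<tau>" "insert b \<tau> \<in> order_complex P" using that by (auto simp: extensions_def)
    then show "b \<in> P" "b \<notin> \<tau>" by (auto simp: order_complex_def)
    show "b < x \<or> x < b" if "x \<in> \<tau>" for x
    proof -
      have "b \<le> x \<or> x \<le> b" "b \<noteq> x" using b that by (auto simp: order_complex_def chain_def)
      then show ?thesis by (auto simp: less_le)
    qed
  qed
  \<comment> \<open>Two comparable extensions would together enlarge \<open>\<tau>\<close> to a
    chain of six elements, against \<open>top\<close>.\<close>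
  have incomparable: "\<not> b < b0" "\<not> b0 < b" if b: "b \<in> ?E" for b
  proof -
    have "b = b0" if "b \<le> b0 \<or> b0 \<le> b"
    proof (rule ccontr)
      assume "b \<noteq> b0"
      have "b \<le> x \<or> x \<le> b" if "x \<in> \<tau>" for x using E(3)[OF b that] by (auto simp: less_imp_le)
      then have "insert b (insert b0 \<tau>) \<in> order_complex P"
        using ch E(1)[OF b] b0(2) that unfolding order_complex_def chain_def by blast
      then have "card (insert b (insert b0 \<tau>)) \<le> 5" by (rule top)
      then show False using card5 E(2)[OF b] \<open>b \<noteq> b0\<close> fin by simp
    qed
    then show "\<not> b < b0" "\<not> b0 < b" by (auto simp: less_imp_le)
  qed
  \<comment> \<open>Being incomparable to \<open>b0\<close> or equal to it puts every extension into
    the same gap of \<open>\<tau>\<close> as \<open>b0\<close>.\<close>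
  have below: "b < a s" if "b \<in> ?E" "s \<in> {1..5}" "j < s" for b s
  proof -
    have "b0 < a s" "a s \<in> \<tau>" using lt[OF that(3) j(1) that(2)] a\<tau>[of s] that j(2) by auto
    then show ?thesis using E(3)[OF that(1), of "a s"] incomparable[OF that(1)] by (auto dest: order.strict_trans)
  qed
  have above: "a s < b" if "b \<in> ?E" "s \<in> {1..5}" "s < j" for b s
  proof -
    have "a s < b0" "a s \<in> \<tau>" using lt[OF that(3) that(2) j(1)] a\<tau>[of s] that j(2) by auto
    then show ?thesis using E(3)[OF that(1), of "a s"] incomparable[OF that(1)] by (auto dest: order.strict_trans)
  qed
  have bound: "card ?E + 2 \<le> card X"
    if X: "X \<subseteq> P" "?E \<subseteq> X" "a s \<in> X" "a t \<in> X" "s \<in> {1..5}" "t \<in> {1..5}" "s \<noteq> j" "t \<noteq> j" "s \<noteq> t" for X s t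
  proof -
    have "a s \<notin> ?E" "a t \<notin> ?E" using E(2) a\<tau> X by blast+
    moreover have "a s \<noteq> a t" using a(1) X by (auto simp: bij_betw_def inj_on_def)
    ultimately have "card (insert (a s) (insert (a t) ?E)) = card ?E + 2"
      using O.finite_extensions by simp
    moreover have "card (insert (a s) (insert (a t) ?E)) \<le> card X"
      using X \<open>finite P\<close> by (intro card_mono) (auto intro: finite_subset)
    ultimately show ?thesis by simp
  qed
  note ext = clique_4_extensions[OF isolated \<open>r > 0\<close> \<open>finite P\<close>]
  consider "j \<le> 2" | "j = 3" | "4 \<le> j" by linarith
  then show ?thesis
  proof cases
    case 1
    \<comment> \<open>\<open>3 - j\<close> is the index in {1, 2} other than j; with the index 3 it
      gives two elements of \<open>\<tau>\<close> in the lower set.\<close>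
    have "3 - j \<noteq> j" by presburger
    then have "card ?E + 2 \<le> card {b \<in> P. b \<le> a 3}"
      using 1 j(1) aP lt[of _ 3] below[of _ 3] E(1)
      by (intro bound[of _ 3 "3 - j"]) (auto simp: less_imp_le)
    moreover have "\<exists>\<sigma>\<in>path_complex r L P. card \<sigma> = 4 \<and>
        card {b \<in> P. b \<le> a 3} \<le> card (extensions (path_complex r L P) \<sigma>)"
      using aP lt by (intro ext[of "a 3" "a 4" "a 5"]) auto
    ultimately show ?thesis using le_trans by blast
  next
    case 2
    have "card ?E + 2 \<le> card {q \<in> P. a 1 \<le> q \<and> q < a 4}"
      using 2 aP lt[of _ 4] lt[of 1] below[of _ 4] above[of _ 1] E(1)
      by (intro bound[of _ 1 2]) (auto simp: less_imp_le)
    moreover have "\<exists>\<sigma>\<in>path_complex r L P. card \<sigma> = 4 \<and>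
        card {q \<in> P. a 1 \<le> q \<and> q < a 4} \<le> card (extensions (path_complex r L P) \<sigma>)"
      using aP lt by (intro ext[of "a 1" "a 4" "a 5"]) auto
    ultimately show ?thesis using le_trans by blast
  next
    case 3
    \<comment> \<open>\<open>9 - j\<close> is the index in {4, 5} other than j.\<close>
    have "9 - j \<noteq> j" by presburger
    then have "card ?E + 2 \<le> card {c \<in> P. a 3 \<le> c}"
      using 3 j(1) aP lt[of 3] above[of _ 3] E(1)
      by (intro bound[of _ 3 "9 - j"]) (auto simp: less_imp_le)
    moreover have "\<exists>\<sigma>\<in>path_complex r L P. card \<sigma> = 4 \<and>
        card {c \<in> P. a 3 \<le> c} \<le> card (extensions (path_complex r L P) \<sigma>)"
      using aP lt by (intro ext[of "a 1" "a 2" "a 3"]) auto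
    ultimately show ?thesis using le_trans by blast
  qed
qed

lemma (in lattice_path) not_homeomorphic:
  assumes "finite P" and nonrefl: "j \<le> r" "(j, j) \<notin> L" and xy: "x \<in> P" "y \<in> P" "x < y"
  shows "\<not> geometric_realization (path_complex r L P) homeomorphic geometric_realization (order_complex P)"
proof
  assume "geometric_realization (path_complex r L P) homeomorphic geometric_realization (order_complex P)"
  then obtain h h' where "homeomorphism (geometric_realization (path_complex r L P)) (geometric_realization (order_complex P)) h h'"
    by (auto simp: homeomorphic_def)
  then interpret complex_homeomorphism "path_complex r L P" "order_complex P" h h'
    using finite_complex_path_complex[OF \<open>finite P\<close>] finite_complex_order_complex[OF \<open>finite P\<close>]
    by (simp add: complex_homeomorphism_def complex_homeomorphism_axioms_def)
  interpret inv: complex_homeomorphism "order_complex P" "path_complex r L P" h' h by (rule inverse)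
  have r: "r > 0" using nonrefl start by (cases "j = 0") auto
  define n where "n = Max (card ` order_complex P)"
  have xyO: "{x, y} \<in> order_complex P" using xy by (auto simp: order_complex_def chain_def)
  have fin: "finite (card ` order_complex P)" using B.finite_complex by simp
  have "n \<in> card ` order_complex P" unfolding n_def using fin xyO by (intro Max_in) auto
  then obtain C where C: "C \<in> order_complex P" "card C = n" by auto
  have le_n: "card \<sigma> \<le> n" if "\<sigma> \<in> order_complex P" for \<sigma>
    unfolding n_def using fin that by simp
  then have K_le_n: "card \<sigma> \<le> n" if "\<sigma> \<in> path_complex r L P" for \<sigma>
    using card_face_le that by blast
  have "2 \<le> n" using le_n[OF xyO] xy by auto
  obtain a where a: "bij_betw a {1..n} C" "strict_mono_on {1..n} a"
    using chain_enumeration[of C] B.finite_face[OF C(1)] C by (auto simp: order_complex_def)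
  have aP: "a s \<in> P" if "s \<in> {1..n}" for s
    using a(1) C(1) that by (auto simp: bij_betw_def order_complex_def)
  have isolated: "u = v" if uv: "(u, u) \<in> L" "(v, v) \<in> L" "(u, v) \<in> L" for u v
  proof (rule ccontr)
    assume "u \<noteq> v"
    then obtain \<sigma> where "\<sigma> \<in> path_complex r L P" "card \<sigma> = n + 1"
      using large_clique[OF nonrefl uv _ \<open>2 \<le> n\<close> aP a(2)] by blast
    then show False using K_le_n by fastforce
  qed
  have "n \<le> 5"
    using inv.card_face_le[OF C(1), of 5] card_clique_le_5[OF isolated \<open>finite P\<close>] C(2) by simp
  \<comment> \<open>A chain of two elements gives a clique of three and a chain of three gives one
    of five, so of the values up to 5 only n = 5 survives.\<close>
  have "3 \<le> n" using clique_3[OF isolated r xy] K_le_n by force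
  then have "a 1 < a 2" "a 2 < a 3" "a 1 \<in> P" "a 2 \<in> P" "a 3 \<in> P"
    using a(2) aP by (auto simp: strict_mono_on_def)
  then have "5 \<le> n" using clique_5[OF isolated r \<open>finite P\<close>, of "a 1" "a 2" "a 3"] K_le_n by force
  then have n: "n = 5" using \<open>n \<le> 5\<close> by simp
  define T where "T = {\<tau> \<in> order_complex P. card \<tau> = 4 \<and> extensions (order_complex P) \<tau> \<noteq> {}}"
  have "finite T" using B.finite_complex by (simp add: T_def)
  have "C - {a 1} \<in> T"
  proof -
    have a1: "a 1 \<in> C" using a(1) n by (auto simp: bij_betw_def)
    then have "insert (a 1) (C - {a 1}) = C" by auto
    then have "a 1 \<in> extensions (order_complex P) (C - {a 1})" using C(1) by (simp add: extensions_def)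
    then show ?thesis using a1 C n B.face_subset[of C "C - {a 1}"] B.finite_face[OF C(1)] by (auto simp: T_def)
  qed
  define \<beta> where "\<beta> = Max ((\<lambda>\<tau>. card (extensions (order_complex P) \<tau>)) ` T)"
  have "\<beta> \<in> (\<lambda>\<tau>. card (extensions (order_complex P) \<tau>)) ` T"
    unfolding \<beta>_def using \<open>finite T\<close> \<open>C - {a 1} \<in> T\<close> by (intro Max_in) auto
  then obtain \<tau> where \<tau>: "\<tau> \<in> order_complex P" "card \<tau> = 4" "extensions (order_complex P) \<tau> \<noteq> {}"
    "\<beta> = card (extensions (order_complex P) \<tau>)"
    by (auto simp: T_def)
  have "\<beta> > 0" using \<tau>(3,4) B.finite_extensions by (simp add: card_gt_0_iff)
  \<comment> \<open>Since \<open>\<beta>\<close> is positive, \<open>\<beta> + 2\<close> is at least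
    three, the range in which branching is a topological quantity.\<close>
  obtain \<sigma> where \<sigma>: "\<sigma> \<in> path_complex r L P" "card \<sigma> = 4" "\<beta> + 2 \<le> card (extensions (path_complex r L P) \<sigma>)"
    using multichain_extensions_exceed[OF isolated r \<open>finite P\<close> _ \<tau>(1-3)] le_n n \<tau>(4) by auto
  obtain \<rho> where \<rho>: "\<rho> \<in> order_complex P" "card \<rho> = Suc 3"
    "card (extensions (path_complex r L P) \<sigma>) \<le> card (extensions (order_complex P) \<rho>)"
  proof (rule card_extensions_le[OF \<sigma>(1), of 3])
    show "card \<sigma> = Suc 3" "3 \<le> card (extensions (path_complex r L P) \<sigma>)" using \<sigma> \<open>\<beta> > 0\<close> by auto
  qed (use K_le_n le_n n in auto)
  then have "\<rho> \<in> T" using \<sigma>(3) by (auto simp: T_def)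
  then have "card (extensions (order_complex P) \<rho>) \<le> \<beta>"
    unfolding \<beta>_def using \<open>finite T\<close> by simp
  then show False using \<sigma>(3) \<rho>(3) by simp
qed

section \<open>Geometric subdivisions\<close>

text \<open>The linear extension of a vertex placement. Summing over a fixed vertex set makes it
  linear on the whole coordinate space; on the realization it is the usual piecewise linear
  map.\<close>

definition bary :: "('v \<Rightarrow> 'e::real_vector) \<Rightarrow> 'v set \<Rightarrow> ('v \<Rightarrow> real) \<Rightarrow> 'e" where
  "bary \<phi> V x = (\<Sum>v\<in>V. x v *\<^sub>R \<phi> v)"

lemma linear_bary: "linear (bary \<phi> V)"
  by (rule linearI)
    (simp_all add: bary_def scaleR_fun_def plus_fun_def scaleR_add_left sum.distrib scaleR_sum_right)

lemma bary_apply: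
  fixes \<phi> :: "'v \<Rightarrow> 'b \<Rightarrow> real"
  shows "bary \<phi> V x a = (\<Sum>v\<in>V. x v * \<phi> v a)"
  unfolding bary_def by (induction V rule: infinite_finite_induct) (simp_all add: scaleR_fun_def)

lemma bary_supp:
  assumes "finite V" "supp x \<subseteq> \<sigma>" "\<sigma> \<subseteq> V"
  shows "bary \<phi> V x = bary \<phi> \<sigma> x"
  unfolding bary_def using assms by (intro sum.mono_neutral_right) (auto simp: supp_def)

lemma bary_std_vertex:
  assumes "finite V" "v \<in> V"
  shows "bary \<phi> V (std_vertex v) = \<phi> v"
proof -
  have "bary \<phi> V (std_vertex v) = bary \<phi> {v} (std_vertex v)"
    using assms by (intro bary_supp) (auto simp: supp_def std_vertex_def indicator_def split: if_splits)
  then show ?thesis by (simp add: bary_def std_vertex_def)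
qed

context finite_complex
begin

lemma convex_hull_vertices:
  assumes "\<sigma> \<subseteq> \<Union>K"
  shows "convex hull (\<phi> ` \<sigma>) = bary \<phi> (\<Union>K) ` (convex hull (std_vertex ` \<sigma>))"
proof -
  have "bary \<phi> (\<Union>K) ` std_vertex ` \<sigma> = \<phi> ` \<sigma>"
    unfolding image_image using assms bary_std_vertex[OF finite_vertices] by (intro image_cong) auto
  then show ?thesis by (simp only: convex_hull_linear_image[OF linear_bary])
qed

lemma underlying_space_eq: "underlying_space \<phi> K = bary \<phi> (\<Union>K) ` geometric_realization K"
  unfolding underlying_space_def geometric_realization_def image_UN
  by (intro SUP_cong refl convex_hull_vertices Union_upper)

lemma convex_hull_face_subset:
  assumes "\<sigma> \<in> K"
  shows "convex hull (std_vertex ` \<sigma>) \<subseteq> geometric_realization K"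
  using assms by (auto simp: geometric_realization_def underlying_space_def)

lemma affine_independence:
  assumes \<sigma>: "\<sigma> \<in> K" and ind: "\<not> affine_dependent (\<phi> ` \<sigma>)" and inj: "inj_on \<phi> \<sigma>"
    and x: "supp x \<subseteq> \<sigma>" "sum x \<sigma> = 1" and y: "supp y \<subseteq> \<sigma>" "sum y \<sigma> = 1"
    and eq: "bary \<phi> \<sigma> x = bary \<phi> \<sigma> y"
  shows "x = y"
proof (rule ccontr)
  assume "x \<noteq> y"
  then obtain v where v: "x v \<noteq> y v" by blast
  then have "v \<in> \<sigma>" using x(1) y(1) by (force simp: supp_def)
  define U where "U = (\<lambda>p. x (the_inv_into \<sigma> \<phi> p) - y (the_inv_into \<sigma> \<phi> p))"
  have U: "U (\<phi> w) = x w - y w" if "w \<in> \<sigma>" for w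
    using that inj by (simp add: U_def the_inv_into_f_f)
  have "sum U (\<phi> ` \<sigma>) = 0"
    using inj x(2) y(2) by (simp add: sum.reindex U sum_subtractf)
  moreover have "\<exists>p\<in>\<phi> ` \<sigma>. U p \<noteq> 0"
    using v \<open>v \<in> \<sigma>\<close> U by (intro bexI[of _ "\<phi> v"]) auto
  moreover have "(\<Sum>p\<in>\<phi> ` \<sigma>. U p *\<^sub>R p) = 0"
    using inj eq by (simp add: sum.reindex U scaleR_diff_left sum_subtractf bary_def)
  ultimately show False
    using ind affine_dependent_explicit_finite[of "\<phi> ` \<sigma>"] finite_face[OF \<sigma>] by blast
qed

text \<open>A common image lies in the hull of the common face and thus comes from a point z there.
  Affine independence within each of the two supports identifies both points with z.\<close>

lemma inj_on_bary:
  assumes "realizes \<phi> K"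
  shows "inj_on (bary \<phi> (\<Union>K)) (geometric_realization K)"
proof (rule inj_onI)
  fix x y
  assume xy: "x \<in> geometric_realization K" "y \<in> geometric_realization K" "bary \<phi> (\<Union>K) x = bary \<phi> (\<Union>K) y"
  have K: "supp x \<in> K" "supp y \<in> K" using xy supp_face by auto
  have "x \<in> convex hull (std_vertex ` supp x)" "y \<in> convex hull (std_vertex ` supp y)"
    using xy K by (auto simp: convex_hull_std_vertex finite_face realization_iff)
  then have "bary \<phi> (\<Union>K) x \<in> convex hull (\<phi> ` supp x)" "bary \<phi> (\<Union>K) y \<in> convex hull (\<phi> ` supp y)"
    unfolding convex_hull_vertices[OF Union_upper[OF K(1)], of \<phi>] convex_hull_vertices[OF Union_upper[OF K(2)], of \<phi>]
    by blast+
  then have "bary \<phi> (\<Union>K) x \<in> convex hull (\<phi> ` supp x) \<inter> convex hull (\<phi> ` supp y)"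
    using xy(3) by simp
  also have "\<dots> = convex hull (\<phi> ` (supp x \<inter> supp y))"
    using assms K by (auto simp: realizes_def)
  also have "\<dots> = bary \<phi> (\<Union>K) ` (convex hull (std_vertex ` (supp x \<inter> supp y)))"
    using K by (intro convex_hull_vertices) auto
  finally obtain z where z: "z \<in> convex hull (std_vertex ` (supp x \<inter> supp y))"
    "bary \<phi> (\<Union>K) x = bary \<phi> (\<Union>K) z" by auto
  have z': "supp z \<subseteq> supp x \<inter> supp y" "sum z (supp x \<inter> supp y) = 1"
    using z(1) K finite_face by (auto simp: convex_hull_std_vertex)
  have "u = z" if u: "u \<in> geometric_realization K" "supp x \<inter> supp y \<subseteq> supp u" "bary \<phi> (\<Union>K) u = bary \<phi> (\<Union>K) z" for u
  proof (rule affine_independence[of "supp u" \<phi>])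
    show uK: "supp u \<in> K" using u supp_face by auto
    show "\<not> affine_dependent (\<phi> ` supp u)" "inj_on \<phi> (supp u)"
      using assms uK by (auto simp: realizes_def intro: inj_on_subset)
    show "supp u \<subseteq> supp u" ..
    show "sum u (supp u) = 1" using u by (simp add: realization_iff)
    show "supp z \<subseteq> supp u" using z' u by auto
    have "sum z (supp u) = sum z (supp x \<inter> supp y)"
      using z' u finite_face[OF uK] by (intro sum.mono_neutral_right) (auto simp: supp_def)
    then show "sum z (supp u) = 1" using z' by simp
    show "bary \<phi> (supp u) u = bary \<phi> (supp u) z"
      using u(3) bary_supp[OF finite_vertices, of _ "supp u" \<phi>] \<open>supp z \<subseteq> supp u\<close> uK by (metis Union_upper order_refl)
  qed
  then show "x = y" using xy z(2) by (metis inf_le1 inf_le2)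
qed

text \<open>The direction used for barycenters: injectivity of the piecewise linear map is what can
  be checked there, and it contains both affine independence and the correct intersections.\<close>

lemma realizesI:
  assumes inj: "inj_on (bary \<phi> (\<Union>K)) (geometric_realization K)"
  shows "realizes \<phi> K"
  unfolding realizes_def
proof (intro conjI ballI)
  have hull: "p \<in> convex hull (std_vertex ` \<sigma>) \<Longrightarrow> p \<in> geometric_realization K" if "\<sigma> \<in> K" for p \<sigma>
    using convex_hull_face_subset[OF that] by blast
  show "inj_on \<phi> (\<Union>K)"
  proof (rule inj_onI)
    fix v w assume vw: "v \<in> \<Union>K" "w \<in> \<Union>K" "\<phi> v = \<phi> w"
    then have "{v} \<in> K" "{w} \<in> K" using face_subset by blast+
    then have "std_vertex v \<in> geometric_realization K" "std_vertex w \<in> geometric_realization K"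
      using hull by (auto simp: hull_inc)
    then have "(std_vertex v :: 'v \<Rightarrow> real) = std_vertex w"
      using inj vw bary_std_vertex[OF finite_vertices] by (metis inj_onD)
    then have "(std_vertex v :: 'v \<Rightarrow> real) v = std_vertex w v" by simp
    then show "v = w" by (auto simp: std_vertex_def indicator_def split: if_splits)
  qed
  then have inj\<phi>: "inj_on \<phi> \<sigma>" if "\<sigma> \<in> K" for \<sigma> using that by (meson Union_upper inj_on_subset)
  show "\<not> affine_dependent (\<phi> ` \<sigma>)" if \<sigma>: "\<sigma> \<in> K" for \<sigma>
  proof
    have fin: "finite \<sigma>" using \<sigma> by (rule finite_face)
    assume "affine_dependent (\<phi> ` \<sigma>)"
    then obtain U where U: "sum U (\<phi> ` \<sigma>) = 0" "\<exists>p\<in>\<phi> ` \<sigma>. U p \<noteq> 0" "(\<Sum>p\<in>\<phi> ` \<sigma>. U p *\<^sub>R p) = 0"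
      using affine_dependent_explicit_finite[of "\<phi> ` \<sigma>"] fin by auto
    define u where "u = (\<lambda>v. if v \<in> \<sigma> then U (\<phi> v) else 0)"
    have u: "sum u \<sigma> = 0" "\<exists>v\<in>\<sigma>. u v \<noteq> 0" "bary \<phi> \<sigma> u = 0"
      using U inj\<phi>[OF \<sigma>] by (auto simp: u_def bary_def sum.reindex)
    \<comment> \<open>\<open>m\<close> is positive and bounds all coefficients of the dependence
      \<open>u\<close>, so the barycenter \<open>x\<close> of the face can be shifted along
      \<open>u\<close> without leaving the simplex, and without changing its image.\<close>
    define m where "m = (1 + (\<Sum>v\<in>\<sigma>. \<bar>u v\<bar>))"
    have m: "m > 0" unfolding m_def by (simp add: add_pos_nonneg sum_nonneg)
    have um: "\<bar>u v\<bar> \<le> m" if "v \<in> \<sigma>" for v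
      using member_le_sum[OF that, of "\<lambda>v. \<bar>u v\<bar>"] fin by (simp add: m_def)
    have c: "real (card \<sigma>) > 0" using u(2) fin by (auto simp: card_gt_0_iff)
    define x where "x = (\<lambda>v. indicator \<sigma> v / real (card \<sigma>))"
    define y where "y = (\<lambda>v. x v + u v / (m * real (card \<sigma>)))"
    have sx: "supp x \<subseteq> \<sigma>" "supp y \<subseteq> \<sigma>" by (auto simp: supp_def x_def y_def u_def indicator_def)
    have x1: "sum x \<sigma> = 1" using c by (simp add: x_def)
    have y1: "sum y \<sigma> = 1" using x1 u(1) by (simp add: y_def sum.distrib sum_divide_distrib[symmetric])
    have "y v \<ge> 0" for v
    proof (cases "v \<in> \<sigma>")
      case True
      have "y v = (m + u v) / (m * real (card \<sigma>))" using True m c by (simp add: y_def x_def field_simps)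
      moreover have "m + u v \<ge> 0" using um[OF True] by linarith
      ultimately show ?thesis using m c by simp
    qed (simp add: y_def x_def u_def)
    then have "x \<in> convex hull (std_vertex ` \<sigma>)" "y \<in> convex hull (std_vertex ` \<sigma>)"
      using sx x1 y1 c by (auto simp: convex_hull_std_vertex[OF fin] x_def)
    then have xy: "x \<in> geometric_realization K" "y \<in> geometric_realization K" using hull[OF \<sigma>] by auto
    have "y = x + (1 / (m * real (card \<sigma>))) *\<^sub>R u"
      by (auto simp: y_def plus_fun_def scaleR_fun_def)
    then have "bary \<phi> \<sigma> y = bary \<phi> \<sigma> x + (1 / (m * real (card \<sigma>))) *\<^sub>R bary \<phi> \<sigma> u"
      using linear_bary by (metis linear_add linear_scale)
    then have "bary \<phi> \<sigma> y = bary \<phi> \<sigma> x" using u(3) by simp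
    then have "bary \<phi> (\<Union>K) y = bary \<phi> (\<Union>K) x"
      using bary_supp[OF finite_vertices sx(1), of \<phi>] bary_supp[OF finite_vertices sx(2), of \<phi>]
        Union_upper[OF \<sigma>] by simp
    then have "y = x" using inj xy by (metis inj_onD)
    have "u v = 0" for v
    proof -
      have "y v = x v" by (simp only: \<open>y = x\<close>)
      then show ?thesis using m c by (simp add: y_def)
    qed
    then show False using u(2) by blast
  qed
  show "convex hull (\<phi> ` \<sigma>) \<inter> convex hull (\<phi> ` \<tau>) = convex hull (\<phi> ` (\<sigma> \<inter> \<tau>))"
    if \<sigma>\<tau>: "\<sigma> \<in> K" "\<tau> \<in> K" for \<sigma> \<tau>
  proof
    show "convex hull (\<phi> ` (\<sigma> \<inter> \<tau>)) \<subseteq> convex hull (\<phi> ` \<sigma>) \<inter> convex hull (\<phi> ` \<tau>)"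
      by (intro Int_greatest hull_mono) auto
    show "convex hull (\<phi> ` \<sigma>) \<inter> convex hull (\<phi> ` \<tau>) \<subseteq> convex hull (\<phi> ` (\<sigma> \<inter> \<tau>))"
    proof
      fix p assume "p \<in> convex hull (\<phi> ` \<sigma>) \<inter> convex hull (\<phi> ` \<tau>)"
      then obtain x y where xy: "x \<in> convex hull (std_vertex ` \<sigma>)" "y \<in> convex hull (std_vertex ` \<tau>)"
        "p = bary \<phi> (\<Union>K) x" "p = bary \<phi> (\<Union>K) y"
        unfolding convex_hull_vertices[OF Union_upper[OF \<sigma>\<tau>(1)], of \<phi>]
          convex_hull_vertices[OF Union_upper[OF \<sigma>\<tau>(2)], of \<phi>] by blast
      then have "x = y" using inj hull \<sigma>\<tau> by (metis inj_onD)
      have fin: "finite \<sigma>" "finite \<tau>" using \<sigma>\<tau> finite_face by auto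
      have x: "\<forall>v. x v \<ge> 0" "supp x \<subseteq> \<sigma>" "supp x \<subseteq> \<tau>" "sum x \<sigma> = 1"
        using xy(1,2) \<open>x = y\<close> by (auto simp: convex_hull_std_vertex fin)
      have "sum x (\<sigma> \<inter> \<tau>) = 1"
        using x sum_supp[OF fin(1), of x] sum_supp[of "\<sigma> \<inter> \<tau>" x] fin by simp
      then have "x \<in> convex hull (std_vertex ` (\<sigma> \<inter> \<tau>))"
        using x fin by (simp add: convex_hull_std_vertex)
      moreover have "\<sigma> \<inter> \<tau> \<subseteq> \<Union>K" using \<sigma>\<tau> by blast
      ultimately show "p \<in> convex hull (\<phi> ` (\<sigma> \<inter> \<tau>))" using xy(3) convex_hull_vertices by blast
    qed
  qed
qed

text \<open>A closed simplex is a closed subset of a product of compact intervals and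
  points.\<close>

lemma compact_geometric_realization: "compact (geometric_realization K)"
proof -
  have "compact (convex hull (std_vertex ` \<sigma>))" if "\<sigma> \<in> K" for \<sigma>
  proof -
    let ?B = "Pi\<^sub>E UNIV (\<lambda>v. if v \<in> \<sigma> then {0..1::real} else {0})"
    have fin: "finite \<sigma>" using that by (rule finite_face)
    have "compactin (product_topology (\<lambda>_. euclidean) UNIV) ?B"
      unfolding compactin_PiE by simp
    then have "compact ?B" by (simp add: euclidean_product_topology)
    moreover have "closed {x :: 'v \<Rightarrow> real. sum x \<sigma> = 1}"
      by (rule closed_Collect_eq) (rule continuous_intros)+
    ultimately have "compact (?B \<inter> {x. sum x \<sigma> = 1})" by (rule compact_Int_closed)
    moreover have "convex hull (std_vertex ` \<sigma>) = ?B \<inter> {x. sum x \<sigma> = 1}"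
    proof (rule Set.set_eqI)
      fix x :: "'v \<Rightarrow> real"
      have "x v \<le> 1" if "\<forall>v. x v \<ge> 0" "sum x \<sigma> = 1" "v \<in> \<sigma>" for v
        using member_le_sum[OF that(3), of x] that fin by simp
      then show "x \<in> convex hull (std_vertex ` \<sigma>) \<longleftrightarrow> x \<in> ?B \<inter> {x. sum x \<sigma> = 1}"
      proof (intro iffI)
        assume le: "\<And>v. \<lbrakk>\<forall>v. 0 \<le> x v; sum x \<sigma> = 1; v \<in> \<sigma>\<rbrakk> \<Longrightarrow> x v \<le> 1"
          and "x \<in> convex hull (std_vertex ` \<sigma>)"
        then have x: "\<forall>v. 0 \<le> x v" "supp x \<subseteq> \<sigma>" "sum x \<sigma> = 1" by (simp_all add: convex_hull_std_vertex[OF fin])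
        have "x v \<in> (if v \<in> \<sigma> then {0..1} else {0})" for v
        proof (cases "v \<in> \<sigma>")
          case True
          then show ?thesis using le x by simp
        next
          case False
          then have "v \<notin> supp x" using x(2) by blast
          then show ?thesis using False by (simp add: supp_def)
        qed
        then show "x \<in> ?B \<inter> {x. sum x \<sigma> = 1}" using x(3) by (simp add: PiE_iff)
      next
        assume B: "x \<in> ?B \<inter> {x. sum x \<sigma> = 1}"
        have v: "x v \<in> (if v \<in> \<sigma> then {0..1} else {0})" for v using B by (simp add: PiE_iff)
        have "0 \<le> x v" for v using v[of v] by (simp split: if_splits)
        moreover have "supp x \<subseteq> \<sigma>"
        proof
          fix v assume "v \<in> supp x"
          then show "v \<in> \<sigma>" using v[of v] by (simp add: supp_def split: if_splits)
        qed
        ultimately show "x \<in> convex hull (std_vertex ` \<sigma>)" using B by (simp add: convex_hull_std_vertex[OF fin])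
      qed
    qed
    ultimately show ?thesis by simp
  qed
  then show ?thesis
    unfolding geometric_realization_def underlying_space_def using finite_complex by (intro compact_UN) auto
qed

end

text \<open>The piecewise linear map is a continuous bijection from a compact space onto a Hausdorff
  space.\<close>

lemma homeomorphic_if_geometric_subdivision:
  assumes "finite_complex K'" "geometric_subdivision K' K"
  shows "geometric_realization K' homeomorphic geometric_realization K"
proof -
  interpret finite_complex K' by fact
  obtain \<phi> where \<phi>: "realizes \<phi> K'" "underlying_space \<phi> K' = geometric_realization K"
    using assms(2) by (auto simp: geometric_subdivision_def)
  let ?f = "bary \<phi> (\<Union>K')"
  have "continuous_on UNIV ?f"
  proof (rule continuous_on_coordinatewise_then_product)
    show "continuous_on UNIV (\<lambda>x. ?f x a)" for a
      unfolding bary_apply by (rule continuous_intros)+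
  qed
  then have cont: "continuous_on (geometric_realization K') ?f" by (rule continuous_on_subset) simp
  have im: "?f ` geometric_realization K' = geometric_realization K" using \<phi>(2) underlying_space_eq by metis
  have "Hausdorff_space (product_topology (\<lambda>_ :: 'b. euclidean :: real topology) UNIV)"
    by (simp add: Hausdorff_space_product_topology)
  then have "Hausdorff_space (top_of_set (geometric_realization K))"
    unfolding euclidean_product_topology by (rule Hausdorff_space_subtopology)
  then have "homeomorphic_map (top_of_set (geometric_realization K')) (top_of_set (geometric_realization K)) ?f"
    using cont im inj_on_bary[OF \<phi>(1)] compact_geometric_realization
    by (intro continuous_imp_homeomorphic_map) (auto simp: compact_space_subtopology)
  then show ?thesis
    using homeomorphic_map_imp_homeomorphic_space homeomorphic_space_iff_homeomorphic by blast
qed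

lemma sum_indicator_mult:
  fixes f :: "'v \<Rightarrow> real"
  assumes "finite V" "v \<in> V"
  shows "(\<Sum>u\<in>V. d * indicator {v} u * f u) = d * f v"
proof -
  have "(\<Sum>u\<in>V. d * indicator {v} u * f u) = (\<Sum>u\<in>{v}. d * indicator {v} u * f u)"
    using assms by (intro sum.mono_neutral_right) auto
  then show ?thesis by simp
qed

text \<open>The inequality is strict because \<open>u\<close> has positive coefficient and
  contributes no deviation. The total mass is not normalized, since it changes in the induction that
  uses this.\<close>

lemma weighted_average_close:
  fixes w f :: "'v \<Rightarrow> real"
  assumes "finite V" "\<And>v. 0 \<le> w v" "supp w \<subseteq> V" "u \<in> supp w"
    and "\<And>v. v \<in> supp w \<Longrightarrow> \<bar>f u - f v\<bar> \<le> 1"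
  shows "\<bar>(\<Sum>v\<in>V. w v) * f u - (\<Sum>v\<in>V. w v * f v)\<bar> < (\<Sum>v\<in>V. w v)"
proof -
  have u: "u \<in> V" "w u > 0" using assms(2)[of u] assms(3,4) by (auto simp: supp_def less_le)
  have "(\<Sum>v\<in>V. w v) * f u - (\<Sum>v\<in>V. w v * f v) = (\<Sum>v\<in>V. w v * (f u - f v))"
    by (simp add: sum_distrib_right right_diff_distrib sum_subtractf)
  also have "\<dots> = (\<Sum>v\<in>V - {u}. w v * (f u - f v))"
    using assms(1) u by (simp add: sum.remove)
  also have "\<bar>\<dots>\<bar> \<le> (\<Sum>v\<in>V - {u}. w v)"
  proof (rule order.trans[OF sum_abs sum_mono])
    fix v
    show "\<bar>w v * (f u - f v)\<bar> \<le> w v"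
    proof (cases "v \<in> supp w")
      case True
      then have "w v * \<bar>f u - f v\<bar> \<le> w v * 1" using assms(2,5) by (intro mult_left_mono) auto
      then show ?thesis using assms(2)[of v] by (simp add: abs_mult)
    qed (simp add: supp_def)
  qed
  also have "\<dots> < (\<Sum>v\<in>V. w v)" using assms(1) u by (simp add: sum.remove)
  finally show ?thesis .
qed

text \<open>Lower sums form a triangular system, as in Moebius inversion.\<close>

lemma eq_if_lower_sums_eq:
  fixes f g :: "'a::order \<Rightarrow> real"
  assumes "finite P" "\<And>a. a \<in> P \<Longrightarrow> (\<Sum>b\<in>{b \<in> P. b \<le> a}. f b) = (\<Sum>b\<in>{b \<in> P. b \<le> a}. g b)" "a \<in> P"
  shows "f a = g a"
  using assms(3)
proof (induction "card {b \<in> P. b < a}" arbitrary: a rule: less_induct)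
  case less
  have IH: "f b = g b" if b: "b \<in> P" "b < a" for b
  proof (rule less.hyps[OF _ b(1)])
    have "{c \<in> P. c < b} \<subset> {c \<in> P. c < a}" using b by (auto dest: order.strict_trans)
    then show "card {c \<in> P. c < b} < card {c \<in> P. c < a}" using assms(1) by (intro psubset_card_mono) auto
  qed
  have "{b \<in> P. b \<le> a} = insert a {b \<in> P. b < a}" using less.prems by (auto simp: le_less)
  then have "(\<Sum>b\<in>{b \<in> P. b \<le> a}. h b) = h a + (\<Sum>b\<in>{b \<in> P. b < a}. h b)" for h :: "'a \<Rightarrow> real"
    using assms(1) by simp
  moreover have "(\<Sum>b\<in>{b \<in> P. b < a}. f b) = (\<Sum>b\<in>{b \<in> P. b < a}. g b)"
    using IH by (intro sum.cong) auto
  ultimately show ?case using assms(2)[OF less.prems] by simp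
qed

section \<open>Paths containing the diagonal: weighted cliques and average weights\<close>

locale diagonal_path = lattice_path +
  assumes diagonal: "j \<le> r \<Longrightarrow> (j, j) \<in> L"
begin

text \<open>Monotonicity against the diagonal points confines the path to a zigzag around the
  diagonal.\<close>

lemma adjacent:
  assumes "(x, y) \<in> L"
  shows "y \<le> Suc x" "x \<le> Suc y"
proof -
  have b: "x \<le> r" "y \<le> r" using assms bounds by blast+
  show "y \<le> Suc x"
    using mono[OF assms diagonal[of "Suc x"]] b by (cases "Suc x \<le> r") auto
  show "x \<le> Suc y"
    using mono'[OF assms diagonal[of "Suc y"]] b by (cases "Suc y \<le> r") auto
qed

lemma step: "i < r \<Longrightarrow> (i, Suc i) \<in> L \<or> (Suc i, i) \<in> L"
  using forward[OF diagonal[of i]] by auto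

text \<open>The path orients the interval between \<open>i\<close> and \<open>i + 1\<close>. The predicate says that \<open>z\<close> lies in
  such an interval with source \<open>i\<close> but is not its target.\<close>

definition has_source :: "real \<Rightarrow> nat \<Rightarrow> bool" where
  "has_source z i \<longleftrightarrow> z = real i \<or> (real i < z \<and> z < real i + 1 \<and> (i, Suc i) \<in> L) \<or>
     (real i - 1 < z \<and> z < real i \<and> i > 0 \<and> (i, i - 1) \<in> L)"

lemma has_source_dist: "has_source z i \<Longrightarrow> \<bar>z - real i\<bar> < 1"
  by (auto simp: has_source_def)

text \<open>A violation would need one unit interval oriented both ways, that is, (i, i + 1) and (i
  + 1, i) both on the path. Uniqueness of sources follows.\<close>

lemma has_source_mono:
  assumes "has_source z i" "has_source z' i'" "z \<le> z'"
  shows "i \<le> i'"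
proof (rule ccontr)
  assume "\<not> i \<le> i'"
  then have "real i \<ge> real i' + 1" by simp
  moreover have "\<bar>z - real i\<bar> < 1" "\<bar>z' - real i'\<bar> < 1" using assms has_source_dist by auto
  ultimately have "real i < real i' + 2" "z' > real i'" "z < real i" using assms(3) by linarith+
  then have "i = Suc i'" "(i', Suc i') \<in> L" "(i, i - 1) \<in> L"
    using assms \<open>\<not> i \<le> i'\<close> by (auto simp: has_source_def)
  then show False using no_two_cycle[of i' i] by auto
qed

lemma ex_has_source:
  assumes "0 \<le> z" "z \<le> real r"
  shows "\<exists>i. has_source z i"
proof -
  define f where "f = nat \<lfloor>z\<rfloor>"
  have f: "real f \<le> z" "z < real f + 1" using assms by (auto simp: f_def)
  show ?thesis
  proof (cases "z = real f")
    case True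
    then show ?thesis by (auto simp: has_source_def)
  next
    case False
    then have "real f < real r" using f assms by linarith
    then have "(f, Suc f) \<in> L \<or> (Suc f, f) \<in> L" by (intro step) simp
    then have "has_source z f \<or> has_source z (Suc f)" using f False by (auto simp: has_source_def)
    then show ?thesis by blast
  qed
qed

text \<open>The choice is forced, as sources are unique; a source exists for arguments between 0 and
  r.\<close>

definition src :: "real \<Rightarrow> nat" where
  "src z = (SOME i. has_source z i)"

lemma has_source_src: "0 \<le> z \<Longrightarrow> z \<le> real r \<Longrightarrow> has_source z (src z)"
  unfolding src_def using ex_has_source by (rule someI_ex)

lemma has_source_unique: "has_source z i \<Longrightarrow> has_source z i' \<Longrightarrow> i = i'"
  using has_source_mono by (meson order.antisym order.refl)

lemma src_eqI: "has_source z i \<Longrightarrow> src z = i"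
  unfolding src_def using has_source_unique by (metis someI)

lemma src_of_nat: "src (real i) = i"
  by (rule src_eqI) (simp add: has_source_def)

lemma path_rel_refl: "path_rel r L P p p"
  using diagonal weight_le by (auto simp: path_rel_def)

lemma first_of_clique:
  assumes "finite \<sigma>" "\<sigma> \<in> path_complex r L P" "\<sigma> \<noteq> {}"
  obtains v where "v \<in> \<sigma>" "\<And>u. u \<in> \<sigma> \<Longrightarrow> path_rel r L P v u"
proof -
  obtain vs where vs: "set vs = \<sigma>" "sorted_wrt (path_rel r L P) vs"
    using sorted_clique[OF assms(1,2)] by blast
  then obtain v us where "vs = v # us" using assms(3) by (cases vs) auto
  then show ?thesis using that[of v] vs path_rel_refl by auto
qed

lemma clique_weights_close:
  assumes "\<sigma> \<in> path_complex r L P" "u \<in> \<sigma>" "v \<in> \<sigma>" "a \<in> P"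
  shows "\<bar>real (weight r a u) - real (weight r a v)\<bar> \<le> 1"
proof (cases "u = v")
  case False
  then have "path_rel r L P u v \<or> path_rel r L P v u"
    using assms unfolding path_complex_def by blast
  then have "(weight r a u, weight r a v) \<in> L \<or> (weight r a v, weight r a u) \<in> L"
    using assms(4) by (auto simp: path_rel_def)
  then show ?thesis using adjacent by fastforce
qed simp

text \<open>The weights of the clique differ by at most one from that of its first member. If the
  average is different from it, some member has the neighbouring weight on that side, and being
  related to this member is the orientation that makes the first weight the source.\<close>

lemma weight_first_of_clique:
  assumes V: "finite V" "supp w \<subseteq> V" and w: "\<And>v. 0 \<le> w v" "supp w \<in> path_complex r L P"
    and v: "v \<in> supp w" "\<And>u. u \<in> supp w \<Longrightarrow> path_rel r L P v u" and a: "a \<in> P"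
  shows "weight r a v = src ((\<Sum>u\<in>V. w u * weight r a u) / (\<Sum>u\<in>V. w u))"
proof -
  let ?m = "\<Sum>u\<in>V. w u" and ?y = "\<Sum>u\<in>V. w u * weight r a u" and ?i = "weight r a v"
  have close: "\<bar>?m * ?i - ?y\<bar> < ?m"
    using V w v(1) clique_weights_close[OF w(2) v(1) _ a]
    by (intro weighted_average_close) auto
  then have m: "?m > 0" by linarith
  have z: "\<bar>?y / ?m - ?i\<bar> < 1"
  proof -
    have "?y / ?m - ?i = (?y - ?m * ?i) / ?m" using m by (simp add: field_simps)
    then show ?thesis using close m by (simp add: abs_divide abs_minus_commute)
  qed
  have zero: "w u = 0" if "u \<notin> supp w" for u using that by (simp add: supp_def)
  have up: "?y / ?m \<le> ?i" if "\<And>u. u \<in> supp w \<Longrightarrow> weight r a u \<le> ?i"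
  proof -
    have "w u * weight r a u \<le> w u * ?i" for u
      using that[of u] w(1)[of u] zero[of u] by (cases "u \<in> supp w") (auto intro: mult_left_mono)
    then have "?y \<le> ?m * ?i" unfolding sum_distrib_right by (rule sum_mono)
    then show ?thesis using m by (simp add: divide_le_eq mult.commute)
  qed
  have down: "?i \<le> ?y / ?m" if "\<And>u. u \<in> supp w \<Longrightarrow> ?i \<le> weight r a u"
  proof -
    have "w u * ?i \<le> w u * weight r a u" for u
      using that[of u] w(1)[of u] zero[of u] by (cases "u \<in> supp w") (auto intro: mult_left_mono)
    then have "?m * ?i \<le> ?y" unfolding sum_distrib_right by (rule sum_mono)
    then show ?thesis using m by (simp add: le_divide_eq mult.commute)
  qed
  have rel: "(?i, weight r a u) \<in> L" if "u \<in> supp w" for u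
    using v(2)[OF that] a by (simp add: path_rel_def)
  have "has_source (?y / ?m) ?i"
  proof (cases "?y / ?m" "real ?i" rule: linorder_cases)
    case equal
    then show ?thesis by (simp add: has_source_def)
  next
    case greater
    then obtain u where u: "u \<in> supp w" "?i < weight r a u" using up by (meson leD leI)
    then have "weight r a u = Suc ?i" using adjacent(1)[OF rel[OF u(1)]] by simp
    then show ?thesis using rel[OF u(1)] greater z by (auto simp: has_source_def)
  next
    case less
    then obtain u where u: "u \<in> supp w" "weight r a u < ?i" using down by (meson leD leI)
    then have "weight r a u = ?i - 1" "?i > 0" using adjacent(2)[OF rel[OF u(1)]] by simp_all
    then show ?thesis using rel[OF u(1)] less z by (auto simp: has_source_def)
  qed
  then show ?thesis by (simp add: src_eqI)
qed

text \<open>The first vertex of a weighted clique is determined by the average weights; subtract the smaller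
  of its two coefficients and proceed by induction.\<close>

lemma weighted_clique_unique:
  assumes "finite P"
    and "\<And>v. 0 \<le> w v" "supp w \<in> path_complex r L P" "\<And>v. 0 \<le> w' v" "supp w' \<in> path_complex r L P"
    and "(\<Sum>v\<in>multichains r P. w v) = (\<Sum>v\<in>multichains r P. w' v)"
    and "\<And>a. a \<in> P \<Longrightarrow> (\<Sum>v\<in>multichains r P. w v * weight r a v) = (\<Sum>v\<in>multichains r P. w' v * weight r a v)"
  shows "w = w'"
  using assms(2-)
proof (induction "card (supp w) + card (supp w')" arbitrary: w w' rule: less_induct)
  case less
  let ?V = "multichains r P"
  have V: "finite ?V" using assms(1) by (rule finite_multichains)
  have sub: "supp w \<subseteq> ?V" "supp w' \<subseteq> ?V" using less.prems(2,4) by (auto simp: path_complex_def)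
  have fin: "finite (supp w)" "finite (supp w')" using sub V finite_subset by auto
  have zero: "x = (\<lambda>_. 0)" if "\<And>v. 0 \<le> x v" "supp x \<subseteq> ?V" "(\<Sum>v\<in>?V. x v) = 0" for x
  proof
    fix v
    show "x v = 0" using that V sum_nonneg_eq_0_iff[of ?V x] by (cases "v \<in> ?V") (auto simp: supp_def)
  qed
  show ?case
  proof (cases "supp w = {} \<or> supp w' = {}")
    case True
    then have "(\<Sum>v\<in>?V. w v) = 0 \<or> (\<Sum>v\<in>?V. w' v) = 0"
      by (metis (mono_tags, lifting) empty_iff mem_Collect_eq sum.neutral supp_def)
    then show ?thesis using zero less.prems sub by metis
  next
    case False
    obtain v where v: "v \<in> supp w" "\<And>u. u \<in> supp w \<Longrightarrow> path_rel r L P v u"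
      using first_of_clique[OF fin(1) less.prems(2)] False by blast
    obtain v' where v': "v' \<in> supp w'" "\<And>u. u \<in> supp w' \<Longrightarrow> path_rel r L P v' u"
      using first_of_clique[OF fin(2) less.prems(4)] False by blast
    have "v' = v"
    proof (rule multichain_eqI_weight)
      show "weight r a v' = weight r a v" if "a \<in> P" for a
        using weight_first_of_clique[OF V sub(1) less.prems(1,2) v that]
          weight_first_of_clique[OF V sub(2) less.prems(3,4) v' that] less.prems(5,6) that by simp
    qed (use v v' sub in auto)
    \<comment> \<open>Subtracting the smaller coefficient at the common first vertex keeps both
      families nonnegative and removes this vertex from at least one support.\<close>
    define d where "d = min (w v) (w' v)"
    have pos: "w v > 0" "w' v > 0"
      using v v' \<open>v' = v\<close> less.prems(1,3)[of v] by (auto simp: supp_def less_le)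
    define x where "x = (\<lambda>u. w u - d * indicator {v} u)"
    define x' where "x' = (\<lambda>u. w' u - d * indicator {v} u)"
    have vV: "v \<in> ?V" using v sub by blast
    have sx: "supp x \<subseteq> supp w" "supp x' \<subseteq> supp w'"
      using pos by (auto simp: supp_def x_def x'_def indicator_def)
    have shrink: "v \<notin> supp x \<or> v \<notin> supp x'" by (auto simp: supp_def x_def x'_def d_def min_def)
    have "card (supp x) \<le> card (supp w)" "card (supp x') \<le> card (supp w')"
      using sx fin by (auto intro: card_mono)
    moreover have "card (supp x) < card (supp w) \<or> card (supp x') < card (supp w')"
      using shrink sx v(1) v'(1) \<open>v' = v\<close> fin by (metis psubsetI psubset_card_mono)
    ultimately have card: "card (supp x) + card (supp x') < card (supp w) + card (supp w')" by linarith
    have "x = x'"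
    proof (rule less.hyps[OF card])
      show "0 \<le> x u" "0 \<le> x' u" for u
        using less.prems(1,3)[of u] by (auto simp: x_def x'_def d_def indicator_def)
      show "supp x \<in> path_complex r L P" "supp x' \<in> path_complex r L P"
        using sx less.prems(2,4) path_complex_subset by blast+
      show "(\<Sum>u\<in>?V. x u) = (\<Sum>u\<in>?V. x' u)"
        using less.prems(5) by (simp add: x_def x'_def sum_subtractf)
      show "(\<Sum>u\<in>?V. x u * weight r a u) = (\<Sum>u\<in>?V. x' u * weight r a u)" if "a \<in> P" for a
        using less.prems(6)[OF that] by (simp add: x_def x'_def left_diff_distrib sum_subtractf)
    qed
    then show ?thesis by (auto simp: x_def x'_def fun_eq_iff)
  qed
qed

text \<open>What remains of the value y after mass m - G has been given to a multichain of weight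
  \<open>src (y / m)\<close>; the remaining total mass is G.\<close>

definition shrink :: "real \<Rightarrow> real \<Rightarrow> real \<Rightarrow> real" where
  "shrink m G y = y - (m - G) * src (y / m)"

text \<open>A value keeps its deviation from its source while the spacing of the sources shrinks
  from m to G. As deviations are at most G, only values with neighbouring sources could change
  order, and the interval between two neighbours belongs to just one of them.\<close>

lemma shrink_mono:
  assumes "0 < m" "0 \<le> y" "y \<le> y'" "y' \<le> real r * m"
    and G: "\<bar>y - m * src (y / m)\<bar> \<le> G" "\<bar>y' - m * src (y' / m)\<bar> \<le> G"
  shows "shrink m G y \<le> shrink m G y'"
proof -
  let ?s = "src (y / m)" and ?s' = "src (y' / m)"
  have z: "0 \<le> y / m" "y / m \<le> y' / m" "y' / m \<le> real r"
    using assms by (auto simp: divide_right_mono divide_le_eq)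
  then have hs: "has_source (y / m) ?s" "has_source (y' / m) ?s'"
    by (auto intro!: has_source_src)
  have le: "?s \<le> ?s'" using has_source_mono[OF hs] z by simp
  have e: "shrink m G y = (y - m * ?s) + G * ?s" "shrink m G y' = (y' - m * ?s') + G * ?s'"
    by (simp_all add: shrink_def algebra_simps)
  have "G \<ge> 0" using G by linarith
  consider "?s = ?s'" | "?s' = Suc ?s" | "?s + 2 \<le> ?s'" using le by linarith
  then show ?thesis
  proof cases
    case 1
    then show ?thesis using assms(3) by (simp add: shrink_def)
  next
    case 2
    have "\<not> (y / m > ?s \<and> y' / m < ?s')"
    proof
      assume "y / m > ?s \<and> y' / m < ?s'"
      then have "(?s, Suc ?s) \<in> L" "(?s', ?s' - 1) \<in> L" using hs by (auto simp: has_source_def)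
      then show False using 2 no_two_cycle[of ?s "Suc ?s"] by simp
    qed
    then have "y \<le> m * ?s \<or> m * ?s' \<le> y'" using assms(1) by (auto simp: field_simps not_less)
    moreover have "G * ?s' = G * ?s + G" using 2 by (simp add: algebra_simps)
    ultimately show ?thesis using G unfolding e by linarith
  next
    case 3
    then have "G * (real ?s + 2) \<le> G * real ?s'" using \<open>G \<ge> 0\<close> by (intro mult_left_mono) auto
    then have "G * ?s + 2 * G \<le> G * ?s'" by (simp add: algebra_simps)
    then show ?thesis using G unfolding e by linarith
  qed
qed

lemma shrink_of_nat: "m \<noteq> 0 \<Longrightarrow> shrink m G (m * real i) = G * real i"
  by (simp add: shrink_def src_of_nat algebra_simps)

text \<open>The functions arising as lower sums \<open>a \<mapsto> r * (\<Sum>b \<le> a. x b)\<close> of a point \<open>x\<close> of the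
  realization with total mass \<open>m\<close> and support \<open>C\<close>.\<close>

definition chain_profile :: "'a::order set \<Rightarrow> 'a set \<Rightarrow> real \<Rightarrow> ('a \<Rightarrow> real) \<Rightarrow> bool" where
  "chain_profile P C m y \<longleftrightarrow>
     (\<forall>c\<in>C. \<forall>c'\<in>C. c \<le> c' \<longrightarrow> y c \<le> y c') \<and> (\<forall>c\<in>C. 0 \<le> y c \<and> y c \<le> real r * m) \<and> (\<exists>c\<in>C. y c = real r * m) \<and>
     (\<forall>a\<in>P. (\<exists>c\<in>C. c \<le> a \<and> y a = y c \<and> (\<forall>c'\<in>C. c' \<le> a \<longrightarrow> c' \<le> c)) \<or> (y a = 0 \<and> (\<forall>c\<in>C. \<not> c \<le> a)))"

lemma chain_profileD:
  assumes "chain_profile P C m y"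
  shows "c \<in> C \<Longrightarrow> c' \<in> C \<Longrightarrow> c \<le> c' \<Longrightarrow> y c \<le> y c'"
    and "c \<in> C \<Longrightarrow> 0 \<le> y c" and "c \<in> C \<Longrightarrow> y c \<le> real r * m" and "\<exists>c\<in>C. y c = real r * m"
    and "a \<in> P \<Longrightarrow> (\<exists>c\<in>C. c \<le> a \<and> y a = y c \<and> (\<forall>c'\<in>C. c' \<le> a \<longrightarrow> c' \<le> c)) \<or>
      (y a = 0 \<and> (\<forall>c\<in>C. \<not> c \<le> a))"
  using assms unfolding chain_profile_def by simp_all

lemma chain_profile_bounds:
  assumes "chain_profile P C m y" "0 < m" "a \<in> P"
  shows "0 \<le> y a" "y a \<le> real r * m" "0 \<le> y a / m" "y a / m \<le> real r"
proof -
  note D = chain_profileD[OF assms(1)]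
  have "(\<exists>c\<in>C. y a = y c) \<or> y a = 0" using D(5)[OF assms(3)] by blast
  moreover have "0 \<le> y c \<and> y c \<le> real r * m" if "c \<in> C" for c
    using D(2,3)[OF that] by simp
  moreover have "0 \<le> real r * m" using assms(2) by simp
  ultimately show *: "0 \<le> y a" "y a \<le> real r * m" by auto
  then show "0 \<le> y a / m" "y a / m \<le> real r" using assms(2) by (auto simp: divide_le_eq)
qed

text \<open>Entry t is the least element of the chain whose source is at least t; it exists because
  the profile attains \<open>r * m\<close> on \<open>C\<close>.\<close>

lemma profile_first_multichain:
  assumes C: "finite C" "C \<noteq> {}" "C \<subseteq> P" "Complete_Partial_Order.chain (\<le>) C"
    and y: "chain_profile P C m y" and m: "0 < m"
  obtains v where "v \<in> multichains r P" "\<And>a. a \<in> P \<Longrightarrow> weight r a v = src (y a / m)"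
proof -
  let ?s = "\<lambda>a. src (y a / m)"
  note b = chain_profile_bounds[OF y m]
  have hs: "has_source (y a / m) (?s a)" if "a \<in> P" for a using b[OF that] by (intro has_source_src)
  have smono: "?s c \<le> ?s c'" if "c \<in> C" "c' \<in> C" "c \<le> c'" for c c'
  proof -
    have "y c \<le> y c'" using chain_profileD(1)[OF y] that by blast
    then show ?thesis using hs that C(3) m by (intro has_source_mono[of "y c / m" _ "y c' / m"]) (auto simp: divide_right_mono)
  qed
  have "\<exists>c\<in>C. t \<le> ?s c \<and> (\<forall>c'\<in>C. t \<le> ?s c' \<longrightarrow> c \<le> c')" if t: "t \<in> {1..r}" for t
  proof -
    let ?D = "{c \<in> C. t \<le> ?s c}"
    obtain c0 where "c0 \<in> C" "y c0 = real r * m" using chain_profileD(4)[OF y] by blast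
    then have "c0 \<in> ?D" using src_of_nat[of r] t m by simp
    then have D: "?D \<noteq> {}" "finite ?D" using C(1) by auto
    obtain c where c: "c \<in> ?D" "\<forall>c'\<in>?D. c' \<le> c \<longrightarrow> c = c'"
      using finite_has_minimal[OF D(2,1)] by blast
    have "c \<le> c'" if "c' \<in> ?D" for c'
    proof -
      have "c \<in> C" "c' \<in> C" using c(1) that by simp_all
      then have "c \<le> c' \<or> c' \<le> c" using C(4) unfolding chain_def by blast
      moreover have "c = c'" if "c' \<le> c" using c(2) \<open>c' \<in> ?D\<close> that by blast
      ultimately show ?thesis by auto
    qed
    moreover have "c \<in> C" "t \<le> ?s c" using c(1) by simp_all
    ultimately show ?thesis by (intro bexI[of _ c]) simp_all
  qed
  then obtain v0 where v0: "\<And>t. t \<in> {1..r} \<Longrightarrow> v0 t \<in> C \<and> t \<le> ?s (v0 t) \<and> (\<forall>c'\<in>C. t \<le> ?s c' \<longrightarrow> v0 t \<le> c')"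
    by metis
  define v where "v = restrict v0 {1..r}"
  have v: "v t \<in> C" "t \<le> ?s (v t)" "\<And>c'. c' \<in> C \<Longrightarrow> t \<le> ?s c' \<Longrightarrow> v t \<le> c'" if "t \<in> {1..r}" for t
    using v0[OF that] that by (auto simp: v_def)
  have "v \<in> multichains r P"
    unfolding multichains_def
  proof (intro CollectI conjI)
    show "v \<in> {1..r} \<rightarrow>\<^sub>E P" using v(1) C(3) by (auto simp: v_def)
    show "mono_on {1..r} v"
    proof (rule mono_onI)
      fix t t' assume t: "t \<in> {1..r}" "t' \<in> {1..r}" "t \<le> t'"
      then show "v t \<le> v t'" using v(3)[OF t(1) v(1)[OF t(2)]] v(2)[OF t(2)] by simp
    qed
  qed
  moreover have "weight r a v = ?s a" if a: "a \<in> P" for a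
  proof -
    have sr: "?s a \<le> r"
    proof -
      have "has_source (real r) r" by (simp add: has_source_def)
      then show ?thesis using has_source_mono[OF hs[OF a]] b(4)[OF a] by blast
    qed
    have "v t \<le> a \<longleftrightarrow> t \<le> ?s a" if t: "t \<in> {1..r}" for t
    proof -
      consider c where "c \<in> C" "c \<le> a" "y a = y c" "\<forall>c'\<in>C. c' \<le> a \<longrightarrow> c' \<le> c"
        | "y a = 0" "\<forall>c\<in>C. \<not> c \<le> a"
        using chain_profileD(5)[OF y a] by blast
      then show ?thesis
      proof cases
        case (1 c)
        have "v t \<le> a \<longleftrightarrow> v t \<le> c" using 1 v(1)[OF t] by (auto intro: order.trans)
        also have "\<dots> \<longleftrightarrow> t \<le> ?s c" using v[OF t] smono[OF v(1)[OF t] 1(1)] 1(1) by fastforce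
        finally show ?thesis using 1(3) by simp
      next
        case 2
        then show ?thesis using v(1)[OF t] src_of_nat[of 0] t by auto
      qed
    qed
    then have "{t \<in> {1..r}. v t \<le> a} = {1..?s a}" using sr by auto
    then show ?thesis by (simp add: weight_def)
  qed
  ultimately show ?thesis using that by blast
qed

text \<open>0 and r are their own sources, so the extreme values 0 and \<open>r * m\<close> go to 0
  and \<open>r * G\<close>; the rest is monotonicity of \<open>shrink\<close>.\<close>

lemma chain_profile_shrink:
  assumes y: "chain_profile P C m y" and m: "0 < m" and "C \<subseteq> P"
    and G: "\<And>a. a \<in> P \<Longrightarrow> \<bar>y a - m * src (y a / m)\<bar> \<le> G" "0 \<le> G"
  shows "chain_profile P C G (\<lambda>a. shrink m G (y a))"
proof -
  note b = chain_profile_bounds[OF y m]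
  have zero: "shrink m G 0 = 0" using shrink_of_nat[of m G 0] m by simp
  have top: "shrink m G (real r * m) = real r * G" using shrink_of_nat[of m G r] m by (simp add: mult.commute)
  have "shrink m G (y c) \<le> shrink m G (y c')" if "c \<in> C" "c' \<in> C" "c \<le> c'" for c c'
  proof (rule shrink_mono[OF m])
    show "y c \<le> y c'" using chain_profileD(1)[OF y] that by blast
  qed (use that assms b G in auto)
  moreover have "0 \<le> shrink m G (y c)" "shrink m G (y c) \<le> real r * G" if "c \<in> C" for c
  proof -
    have cP: "c \<in> P" using that assms(3) by blast
    have "shrink m G 0 \<le> shrink m G (y c)"
      using b[OF cP] m G cP src_of_nat[of 0] by (intro shrink_mono) auto
    then show "0 \<le> shrink m G (y c)" using zero by simp
    have "shrink m G (y c) \<le> shrink m G (real r * m)"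
      using b[OF cP] m G cP src_of_nat[of r] by (intro shrink_mono) auto
    then show "shrink m G (y c) \<le> real r * G" using top by simp
  qed
  moreover have "\<exists>c\<in>C. shrink m G (y c) = real r * G"
    using chain_profileD(4)[OF y] top by metis
  moreover have "(\<exists>c\<in>C. c \<le> a \<and> shrink m G (y a) = shrink m G (y c) \<and> (\<forall>c'\<in>C. c' \<le> a \<longrightarrow> c' \<le> c)) \<or>
      (shrink m G (y a) = 0 \<and> (\<forall>c\<in>C. \<not> c \<le> a))" if "a \<in> P" for a
    using chain_profileD(5)[OF y that] zero by metis
  ultimately show ?thesis unfolding chain_profile_def by simp
qed

text \<open>Move along the first multichain until one more of the quotients \<open>y a / m\<close> becomes an
  integer.\<close>

lemma weighted_clique_exists:
  assumes P: "finite P" and C: "finite C" "C \<noteq> {}" "C \<subseteq> P" "Complete_Partial_Order.chain (\<le>) C"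
    and "chain_profile P C m y" "0 < m"
  shows "\<exists>w. (\<forall>v. 0 \<le> w v) \<and> supp w \<in> path_complex r L P \<and> (\<Sum>v\<in>multichains r P. w v) = m \<and>
    (\<forall>a\<in>P. (\<Sum>v\<in>multichains r P. w v * weight r a v) = y a)"
  using assms(6-)
proof (induction "card {a \<in> P. y a \<noteq> m * src (y a / m)}" arbitrary: y m rule: less_induct)
  case less
  let ?V = "multichains r P"
  have V: "finite ?V" using P by (rule finite_multichains)
  note y = less.prems(1) and m = less.prems(2)
  let ?s = "\<lambda>a. src (y a / m)" and ?g = "\<lambda>a. \<bar>y a - m * src (y a / m)\<bar>"
  note b = chain_profile_bounds[OF y m]
  have hs: "has_source (y a / m) (?s a)" if "a \<in> P" for a using b[OF that] by (intro has_source_src)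
  have gm: "?g a < m" if "a \<in> P" for a
  proof -
    have "y a - m * ?s a = m * (y a / m - ?s a)" using m by (simp add: field_simps)
    then have "?g a = m * \<bar>y a / m - ?s a\<bar>" using m by (simp add: abs_mult)
    then show ?thesis using has_source_dist[OF hs[OF that]] m by simp
  qed
  obtain v where v: "v \<in> ?V" "\<And>a. a \<in> P \<Longrightarrow> weight r a v = ?s a"
    using profile_first_multichain[OF C y m] by blast
  \<comment> \<open>\<open>G\<close> is the largest deviation from a source. If exactly this mass is
    kept, the largest deviation becomes a full unit of the new scale, while values without deviation
    stay integral.\<close>
  define G where "G = Max (?g ` P)"
  have "P \<noteq> {}" using C by auto
  then have "G \<in> ?g ` P" unfolding G_def using P by (intro Max_in) auto
  then obtain a0 where a0: "a0 \<in> P" "?g a0 = G" by blast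
  have G: "?g a \<le> G" if "a \<in> P" for a using that P by (simp add: G_def)
  have "G < m" using gm[OF a0(1)] a0(2) by simp
  have "0 \<le> G" using a0(2) by linarith
  show ?case
  proof (cases "G = 0")
    case True
    have "y a = m * ?s a" if "a \<in> P" for a using G[OF that] True by linarith
    moreover have "supp (\<lambda>u. m * indicator {v} u) = {v}" using m by (auto simp: supp_def indicator_def)
    moreover have "{v} \<in> path_complex r L P" using v(1) by (simp add: path_complex_def)
    ultimately show ?thesis
      using m V v sum_indicator_mult[OF V v(1), of m "\<lambda>_. 1"] sum_indicator_mult[OF V v(1), of m]
      by (intro exI[of _ "\<lambda>u. m * indicator {v} u"]) auto
  next
    case False
    then have "0 < G" using \<open>0 \<le> G\<close> by simp
    define y' where "y' = (\<lambda>a. shrink m G (y a))"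
    have y': "chain_profile P C G y'"
      unfolding y'_def using y m C(3) G \<open>0 \<le> G\<close> by (rule chain_profile_shrink)
    have y'_eq: "y' a = (y a - m * ?s a) + G * ?s a" for a by (simp add: y'_def shrink_def algebra_simps)
    have int: "y' a = G * src (y' a / G)" if "y' a = G * real i" for a i
      using that \<open>0 < G\<close> src_of_nat[of i] by simp
    have "{a \<in> P. y' a \<noteq> G * src (y' a / G)} \<subset> {a \<in> P. y a \<noteq> m * ?s a}"
    proof
      show "{a \<in> P. y' a \<noteq> G * src (y' a / G)} \<subseteq> {a \<in> P. y a \<noteq> m * ?s a}"
      proof clarify
        fix a assume "y' a \<noteq> G * src (y' a / G)" "y a = m * ?s a"
        moreover from this(2) have "y' a = G * real (?s a)" using y'_eq[of a] by linarith
        ultimately show False using int by blast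
      qed
      have "y' a0 = G * src (y' a0 / G)"
      proof (cases "y a0 - m * ?s a0 = G")
        case True
        then have "y' a0 = G * real (Suc (?s a0))" using y'_eq[of a0] by (simp add: algebra_simps)
        then show ?thesis by (rule int)
      next
        case False
        then have *: "y a0 - m * ?s a0 = - G" using a0(2) by linarith
        have "?s a0 \<noteq> 0"
        proof
          assume "?s a0 = 0"
          then have "y a0 = - G" using * by simp
          then show False using b(1)[OF a0(1)] \<open>0 < G\<close> by linarith
        qed
        then have "y' a0 = G * real (?s a0 - 1)" using y'_eq[of a0] * by (simp add: algebra_simps of_nat_diff)
        then show ?thesis by (rule int)
      qed
      moreover have "y a0 \<noteq> m * ?s a0" using a0(2) \<open>0 < G\<close> by auto
      ultimately show "{a \<in> P. y' a \<noteq> G * src (y' a / G)} \<noteq> {a \<in> P. y a \<noteq> m * ?s a}" using a0(1) by blast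
    qed
    then have "card {a \<in> P. y' a \<noteq> G * src (y' a / G)} < card {a \<in> P. y a \<noteq> m * ?s a}"
      using P by (intro psubset_card_mono) auto
    from less.hyps[OF this y' \<open>0 < G\<close>] obtain w where w: "\<And>v. 0 \<le> w v" "supp w \<in> path_complex r L P"
      "(\<Sum>v\<in>?V. w v) = G" "\<And>a. a \<in> P \<Longrightarrow> (\<Sum>v\<in>?V. w v * weight r a v) = y' a"
      by blast
    have sub: "supp w \<subseteq> ?V" using w(2) by (simp add: path_complex_def)
    \<comment> \<open>The remaining clique has average \<open>y' a / G\<close> at \<open>a\<close>,
      and each of its weights is within one of it. The sign of the deviation at \<open>a\<close>
      leaves at most the source and the neighbour towards which the interval is oriented.\<close>
    have rel: "path_rel r L P v u" if u: "u \<in> supp w" for u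
      unfolding path_rel_def
    proof
      fix a assume a: "a \<in> P"
      let ?x = "weight r a u"
      have "\<bar>G * ?x - y' a\<bar> < G"
        using weighted_average_close[OF V w(1) sub u, of "\<lambda>u. real (weight r a u)"]
          clique_weights_close[OF w(2) u _ a] w(3,4) a by auto
      then have c: "\<bar>G * (real ?x - ?s a) - (y a - m * ?s a)\<bar> < G" by (simp add: y'_eq algebra_simps)
      have sd: "(?s a, ?s a) \<in> L" using v(2)[OF a] weight_le[of r a v] diagonal by metis
      have "(?s a, ?x) \<in> L"
      proof (cases "y a - m * ?s a" "0 :: real" rule: linorder_cases)
        case equal
        then have "G * (- 1) < G * (real ?x - ?s a)" "G * (real ?x - ?s a) < G * 1" using c by linarith+
        then have "?x = ?s a" unfolding mult_less_cancel_left_pos[OF \<open>0 < G\<close>] by linarith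
        then show ?thesis using sd by simp
      next
        case greater
        then have "y a / m > ?s a" using m by (simp add: field_simps)
        then have "(?s a, Suc (?s a)) \<in> L" using hs[OF a] by (auto simp: has_source_def)
        moreover have "G * (- 1) < G * (real ?x - ?s a)" "G * (real ?x - ?s a) < G * 2"
          using c greater G[OF a] by linarith+
        then have "?x = ?s a \<or> ?x = Suc (?s a)" unfolding mult_less_cancel_left_pos[OF \<open>0 < G\<close>] by linarith
        ultimately show ?thesis using sd by auto
      next
        case less
        then have "y a / m < ?s a" using m by (simp add: field_simps)
        then have "(?s a, ?s a - 1) \<in> L" "?s a > 0" using hs[OF a] by (auto simp: has_source_def)
        moreover have "G * (- 2) < G * (real ?x - ?s a)" "G * (real ?x - ?s a) < G * 1"
          using c less G[OF a] by linarith+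
        then have "?x = ?s a \<or> ?x = ?s a - 1" unfolding mult_less_cancel_left_pos[OF \<open>0 < G\<close>] by linarith
        ultimately show ?thesis using sd by auto
      qed
      then show "(weight r a v, ?x) \<in> L" using v(2)[OF a] by simp
    qed
    define w' where "w' = (\<lambda>u. w u + (m - G) * indicator {v} u)"
    have "supp w' = insert v (supp w)"
      using w(1)[of v] \<open>G < m\<close> by (auto simp: supp_def w'_def indicator_def)
    moreover have "insert v (supp w) \<in> path_complex r L P"
      using w(2) v(1) rel unfolding path_complex_def by blast
    moreover have "0 \<le> w' u" for u using w(1)[of u] \<open>G < m\<close> by (simp add: w'_def)
    moreover have "(\<Sum>u\<in>?V. w' u) = m"
      using w(3) sum_indicator_mult[OF V v(1), of "m - G" "\<lambda>_. 1"] by (simp add: w'_def sum.distrib)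
    moreover have "(\<Sum>u\<in>?V. w' u * weight r a u) = y a" if "a \<in> P" for a
    proof -
      have "(\<Sum>u\<in>?V. w' u * weight r a u) =
          (\<Sum>u\<in>?V. w u * weight r a u) + (\<Sum>u\<in>?V. (m - G) * indicator {v} u * real (weight r a u))"
        unfolding w'_def distrib_right sum.distrib ..
      also have "\<dots> = y' a + (m - G) * ?s a"
        unfolding sum_indicator_mult[OF V v(1)] w(4)[OF that] v(2)[OF that] ..
      also have "\<dots> = y a" unfolding y'_eq by (simp add: algebra_simps)
      finally show ?thesis .
    qed
    ultimately show ?thesis by metis
  qed
qed

end

lemma Union_path_complex: "\<Union>(path_complex r L P) = multichains r P"
proof
  show "\<Union>(path_complex r L P) \<subseteq> multichains r P" by (auto simp: path_complex_def)
  show "multichains r P \<subseteq> \<Union>(path_complex r L P)"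
  proof
    fix p assume "p \<in> multichains r P"
    then have "{p} \<in> path_complex r L P" by (simp add: path_complex_def)
    then show "p \<in> \<Union>(path_complex r L P)" by blast
  qed
qed

section \<open>Barycenters as vertices of the subdivision\<close>

definition barycenter :: "nat \<Rightarrow> (nat \<Rightarrow> 'a) \<Rightarrow> 'a \<Rightarrow> real" where
  "barycenter r p a = card {t \<in> {1..r}. p t = a} / r"

text \<open>Lower sums turn barycenters into weights, in terms of which cliques are
  described.\<close>

lemma barycenter_lower_sum:
  assumes "finite P" "p \<in> multichains r P" "a \<in> P"
  shows "(\<Sum>b\<in>{b \<in> P. b \<le> a}. barycenter r p b) = weight r a p / r"
proof -
  have "{t \<in> {1..r}. p t \<le> a} = (\<Union>b\<in>{b \<in> P. b \<le> a}. {t \<in> {1..r}. p t = b})"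
    using assms(2) by (auto simp: multichains_def)
  then have "weight r a p = card (\<Union>b\<in>{b \<in> P. b \<le> a}. {t \<in> {1..r}. p t = b})"
    by (simp add: weight_def)
  also have "\<dots> = (\<Sum>b\<in>{b \<in> P. b \<le> a}. card {t \<in> {1..r}. p t = b})"
    using assms(1) by (intro card_UN_disjoint) auto
  finally show ?thesis by (simp add: barycenter_def sum_divide_distrib)
qed

text \<open>If the two entries were incomparable, passing from the element \<open>q s\<close> to
  \<open>p t\<close> would raise the weight of \<open>p\<close> and lower that of \<open>q\<close>,
  against monotonicity of the path.\<close>

lemma (in lattice_path) path_rel_letters_comparable:
  assumes "p \<in> multichains r P" "q \<in> multichains r P" "path_rel r L P p q" "t \<in> {1..r}" "s \<in> {1..r}"
  shows "p t \<le> q s \<or> q s \<le> p t"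
proof (rule ccontr)
  assume n: "\<not> (p t \<le> q s \<or> q s \<le> p t)"
  have P: "p t \<in> P" "q s \<in> P" using assms by (auto simp: multichains_def)
  have "weight r (q s) p < t" "t \<le> weight r (p t) p" "weight r (p t) q < s" "s \<le> weight r (q s) q"
    using n multichain_le_iff_weight[OF assms(1,4)] multichain_le_iff_weight[OF assms(2,5)]
    by (auto simp: not_le[symmetric])
  moreover have "(weight r (q s) p, weight r (q s) q) \<in> L" "(weight r (p t) p, weight r (p t) q) \<in> L"
    using assms(3) P by (auto simp: path_rel_def)
  ultimately show False using mono[of "weight r (q s) p" "weight r (q s) q" "weight r (p t) p" "weight r (p t) q"] by linarith
qed

lemma (in lattice_path) letters_of_clique:
  assumes "\<sigma> \<in> path_complex r L P"
  shows "(\<Union>p\<in>\<sigma>. p ` {1..r}) \<in> order_complex P"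
  unfolding order_complex_def
proof (intro CollectI conjI chainI)
  have mc: "p \<in> multichains r P" if "p \<in> \<sigma>" for p using assms that by (auto simp: path_complex_def)
  show "(\<Union>p\<in>\<sigma>. p ` {1..r}) \<subseteq> P" using mc by (auto simp: multichains_def)
  fix x y assume "x \<in> (\<Union>p\<in>\<sigma>. p ` {1..r})" "y \<in> (\<Union>p\<in>\<sigma>. p ` {1..r})"
  then obtain p t q s where xy: "p \<in> \<sigma>" "t \<in> {1..r}" "x = p t" "q \<in> \<sigma>" "s \<in> {1..r}" "y = q s" by blast
  show "x \<le> y \<or> y \<le> x"
  proof (cases "p = q")
    case True
    have "mono_on {1..r} p" using mc[OF xy(1)] by (simp add: multichains_def)
    then show ?thesis using xy True by (meson mono_onD nle_le)
  next
    case False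
    then have "path_rel r L P p q \<or> path_rel r L P q p" using assms xy unfolding path_complex_def by blast
    then show ?thesis using path_rel_letters_comparable mc xy by blast
  qed
qed

context diagonal_path
begin

context
  fixes P :: "'a::order set"
  assumes P: "finite P" and r: "0 < r"
begin

interpretation K: finite_complex "path_complex r L P" using P by (rule finite_complex_path_complex)
interpretation O: finite_complex "order_complex P" using P by (rule finite_complex_order_complex)

lemma bary_lower_sum:
  assumes "a \<in> P"
  shows "(\<Sum>b\<in>{b \<in> P. b \<le> a}. bary (barycenter r) (multichains r P) w b) =
    (\<Sum>v\<in>multichains r P. w v * weight r a v) / r"
proof -
  have "(\<Sum>b\<in>{b \<in> P. b \<le> a}. bary (barycenter r) (multichains r P) w b) =
      (\<Sum>v\<in>multichains r P. w v * (\<Sum>b\<in>{b \<in> P. b \<le> a}. barycenter r v b))"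
    unfolding bary_apply sum_distrib_left by (rule sum.swap)
  also have "\<dots> = (\<Sum>v\<in>multichains r P. w v * (weight r a v / r))"
    using barycenter_lower_sum[OF P _ assms] by (intro sum.cong) auto
  finally show ?thesis by (simp add: sum_divide_distrib)
qed

lemma inj_on_bary_barycenter:
  "inj_on (bary (barycenter r) (\<Union>(path_complex r L P))) (geometric_realization (path_complex r L P))"
  unfolding Union_path_complex
proof (rule inj_onI)
  fix w w'
  assume w: "w \<in> geometric_realization (path_complex r L P)" "w' \<in> geometric_realization (path_complex r L P)"
    and eq: "bary (barycenter r) (multichains r P) w = bary (barycenter r) (multichains r P) w'"
  have sub: "supp w \<subseteq> multichains r P" "supp w' \<subseteq> multichains r P"
    using K.supp_face(1) w by (auto simp: path_complex_def)
  show "w = w'"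
  proof (rule weighted_clique_unique[OF P])
    show "(\<Sum>v\<in>multichains r P. w v) = (\<Sum>v\<in>multichains r P. w' v)"
      using sum_supp[OF finite_multichains[OF P]] sub w by (simp add: K.realization_iff)
    show "(\<Sum>v\<in>multichains r P. w v * weight r a v) = (\<Sum>v\<in>multichains r P. w' v * weight r a v)"
      if "a \<in> P" for a
      using bary_lower_sum[OF that, of w] bary_lower_sum[OF that, of w'] eq r by simp
  qed (use w in \<open>auto simp: K.realization_iff\<close>)
qed

text \<open>Each barycenter is a convex combination of entries, and the entries of all members of a
  clique form one chain.\<close>

lemma convex_hull_barycenter_subset:
  assumes "\<sigma> \<in> path_complex r L P"
  shows "convex hull (barycenter r ` \<sigma>) \<subseteq> convex hull (std_vertex ` (\<Union>p\<in>\<sigma>. p ` {1..r}))"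
proof (rule hull_minimal)
  let ?\<tau> = "\<Union>p\<in>\<sigma>. p ` {1..r}"
  have fin: "finite ?\<tau>" using letters_of_clique[OF assms] by (rule O.finite_face)
  show "barycenter r ` \<sigma> \<subseteq> convex hull (std_vertex ` ?\<tau>)"
  proof clarify
    fix p assume p: "p \<in> \<sigma>"
    have "supp (barycenter r p) \<subseteq> ?\<tau>"
    proof
      fix a assume "a \<in> supp (barycenter r p)"
      then have "{t \<in> {1..r}. p t = a} \<noteq> {}" unfolding supp_def barycenter_def by force
      then show "a \<in> ?\<tau>" using p by blast
    qed
    moreover have "sum (barycenter r p) ?\<tau> = 1"
    proof -
      have "(\<Sum>a\<in>?\<tau>. card {t \<in> {1..r}. p t = a}) = card (\<Union>a\<in>?\<tau>. {t \<in> {1..r}. p t = a})"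
        using fin by (intro card_UN_disjoint[symmetric]) auto
      also have "(\<Union>a\<in>?\<tau>. {t \<in> {1..r}. p t = a}) = {1..r}" using p by blast
      finally have c: "(\<Sum>a\<in>?\<tau>. card {t \<in> {1..r}. p t = a}) = r" by simp
      have "sum (barycenter r p) ?\<tau> = real (\<Sum>a\<in>?\<tau>. card {t \<in> {1..r}. p t = a}) / r"
        by (simp add: barycenter_def sum_divide_distrib)
      then show ?thesis unfolding c using r by simp
    qed
    moreover have "\<forall>a. 0 \<le> barycenter r p a" by (simp add: barycenter_def)
    ultimately show "barycenter r p \<in> convex hull (std_vertex ` ?\<tau>)"
      unfolding convex_hull_std_vertex[OF fin] by blast
  qed
qed simp

lemma realization_subset_bary_image:
  assumes x: "x \<in> geometric_realization (order_complex P)"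
  shows "x \<in> bary (barycenter r) (multichains r P) ` geometric_realization (path_complex r L P)"
proof -
  let ?C = "supp x"
  have C: "?C \<subseteq> P" "Complete_Partial_Order.chain (\<le>) ?C" "?C \<noteq> {}" "finite ?C"
    using O.supp_face[OF x] by (auto simp: order_complex_def)
  have x': "\<And>a. 0 \<le> x a" "sum x ?C = 1" using x by (auto simp: O.realization_iff)
  have sum_C: "(\<Sum>b\<in>{b \<in> P. b \<le> a}. x b) = (\<Sum>b\<in>{b \<in> ?C. b \<le> a}. x b)" for a
    using P C(1) by (intro sum.mono_neutral_right) (auto simp: supp_def)
  \<comment> \<open>Lower sums are scaled by r to be comparable with weights; the total mass is
    1.\<close>
  define y where "y = (\<lambda>a. real r * (\<Sum>b\<in>{b \<in> P. b \<le> a}. x b))"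
  have "chain_profile P ?C 1 y"
    unfolding chain_profile_def
  proof (intro conjI ballI impI)
    show "y c \<le> y c'" if "c \<le> c'" for c c'
      unfolding y_def using P that x'(1) by (intro mult_left_mono sum_mono2) (auto intro: order.trans)
    show "0 \<le> y c" for c unfolding y_def using x'(1) by (simp add: sum_nonneg)
    have "(\<Sum>b\<in>{b \<in> ?C. b \<le> c}. x b) \<le> sum x ?C" for c
      using C(4) x'(1) by (intro sum_mono2) auto
    then show "y c \<le> real r * 1" for c unfolding y_def sum_C x'(2) by (intro mult_left_mono) auto
    obtain c where c: "c \<in> ?C" "\<forall>b\<in>?C. c \<le> b \<longrightarrow> c = b" using finite_has_maximal[OF C(4,3)] by blast
    have "b \<le> c" if "b \<in> ?C" for b using c C(2) that unfolding chain_def by auto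
    then have "{b \<in> ?C. b \<le> c} = ?C" by blast
    then show "\<exists>c\<in>?C. y c = real r * 1" using c(1) x'(2) by (intro bexI[of _ c]) (simp_all add: y_def sum_C)
    fix a assume "a \<in> P"
    show "(\<exists>c\<in>?C. c \<le> a \<and> y a = y c \<and> (\<forall>c'\<in>?C. c' \<le> a \<longrightarrow> c' \<le> c)) \<or> (y a = 0 \<and> (\<forall>c\<in>?C. \<not> c \<le> a))"
    proof (cases "{c \<in> ?C. c \<le> a} = {}")
      case True
      then have "y a = 0" unfolding y_def sum_C True by simp
      then show ?thesis using True by blast
    next
      case False
      have D: "finite {c \<in> ?C. c \<le> a}" using C(4) by simp
      obtain c where c: "c \<in> ?C" "c \<le> a" "\<forall>b\<in>{c \<in> ?C. c \<le> a}. c \<le> b \<longrightarrow> c = b"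
        using finite_has_maximal[OF D False] by blast
      have top: "b \<le> c" if "b \<in> ?C" "b \<le> a" for b
      proof -
        have "b \<le> c \<or> c \<le> b" using C(2) that(1) c(1) unfolding chain_def by blast
        then show ?thesis using c(3) that by auto
      qed
      then have "{b \<in> ?C. b \<le> a} = {b \<in> ?C. b \<le> c}" using c(2) by (auto intro: order.trans)
      then have "y a = y c" by (simp add: y_def sum_C)
      then show ?thesis using c(1,2) top by blast
    qed
  qed
  from weighted_clique_exists[OF P C(4,3,1,2) this] obtain w where w: "\<And>v. 0 \<le> w v"
    "supp w \<in> path_complex r L P" "(\<Sum>v\<in>multichains r P. w v) = 1"
    "\<And>a. a \<in> P \<Longrightarrow> (\<Sum>v\<in>multichains r P. w v * weight r a v) = y a"
    by auto
  have "supp w \<subseteq> multichains r P" using w(2) by (simp add: path_complex_def)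
  then have "w \<in> geometric_realization (path_complex r L P)"
    using w sum_supp[OF finite_multichains[OF P], of w] by (simp add: K.realization_iff)
  moreover have "bary (barycenter r) (multichains r P) w = x"
  proof
    fix a
    show "bary (barycenter r) (multichains r P) w a = x a"
    proof (cases "a \<in> P")
      case True
      then show ?thesis
      proof (rule eq_if_lower_sums_eq[OF P, rotated])
        fix a assume "a \<in> P"
        then show "(\<Sum>b\<in>{b \<in> P. b \<le> a}. bary (barycenter r) (multichains r P) w b) = (\<Sum>b\<in>{b \<in> P. b \<le> a}. x b)"
          using bary_lower_sum[of a w] w(4)[of a] r by (simp add: y_def)
      qed
    next
      case False
      then have "barycenter r v a = 0" if "v \<in> multichains r P" for v
        using that by (auto simp: barycenter_def multichains_def)
      then have "bary (barycenter r) (multichains r P) w a = 0" unfolding bary_apply by simp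
      moreover have "x a = 0" using False C(1) by (auto simp: supp_def)
      ultimately show ?thesis by simp
    qed
  qed
  ultimately show ?thesis by blast
qed

lemma geometric_subdivision_path_complex:
  "geometric_subdivision (path_complex r L P) (order_complex P)"
  unfolding geometric_subdivision_def
proof (intro exI conjI ballI)
  show "realizes (barycenter r) (path_complex r L P)"
    using inj_on_bary_barycenter by (rule K.realizesI)
  show "\<exists>\<tau>\<in>order_complex P. convex hull (barycenter r ` \<sigma>) \<subseteq> convex hull (std_vertex ` \<tau>)"
    if "\<sigma> \<in> path_complex r L P" for \<sigma>
    using convex_hull_barycenter_subset[OF that] letters_of_clique[OF that] by blast
  then have "underlying_space (barycenter r) (path_complex r L P) \<subseteq> geometric_realization (order_complex P)"
    unfolding underlying_space_def geometric_realization_def by blast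
  moreover have "geometric_realization (order_complex P) \<subseteq> underlying_space (barycenter r) (path_complex r L P)"
    unfolding K.underlying_space_eq Union_path_complex using realization_subset_bary_image by blast
  ultimately show "underlying_space (barycenter r) (path_complex r L P) = geometric_realization (order_complex P)"
    by (rule order.antisym)
qed

end

end

section \<open>Antichains and the three equivalent conditions\<close>

text \<open>Entries of related multichains at the same position are comparable, hence equal in an
  antichain. So the complex does not depend on the path.\<close>

lemma path_complex_antichain:
  assumes "lattice_path r L" and antichain: "\<And>x y. x \<in> P \<Longrightarrow> y \<in> P \<Longrightarrow> \<not> x < y"
  shows "path_complex r L P = {C. C \<subseteq> multichains r P \<and> (\<forall>p\<in>C. \<forall>q\<in>C. p = q)}"
proof -
  interpret lattice_path r L by fact
  have "p = q" if "p \<in> multichains r P" "q \<in> multichains r P" "path_rel r L P p q" for p q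
  proof
    fix t
    show "p t = q t"
    proof (cases "t \<in> {1..r}")
      case True
      then have "p t \<le> q t \<or> q t \<le> p t" "p t \<in> P" "q t \<in> P"
        using path_rel_letters_comparable[OF that True True] that by (auto simp: multichains_def)
      then show ?thesis using antichain by (auto simp: le_less)
    next
      case False
      then show ?thesis using that by (auto simp: multichains_def PiE_def extensional_def)
    qed
  qed
  then show ?thesis unfolding path_complex_def by blast
qed

theorem theorem1p1:
  fixes P :: "'a::order set" and r :: nat and \<iota> :: "nat \<Rightarrow> nat"
  assumes "finite P"
    and "r \<ge> 2"
    and "\<iota> \<in> {1..r} \<rightarrow> {1..2 * r}"
    and "strict_mono_on {1..r} \<iota>"
  shows "(reflp_on (multichains r P) (multichain_rel r \<iota>)
            \<longleftrightarrow> geometric_subdivision (multichain_complex r \<iota> P) (order_complex P))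
       \<and> (geometric_subdivision (multichain_complex r \<iota> P) (order_complex P)
            \<longleftrightarrow> geometric_realization (multichain_complex r \<iota> P)
                  homeomorphic geometric_realization (order_complex P))"
proof -
  let ?L = "path_of r \<iota>"
  interpret lattice_path r ?L using assms(3,4) by (rule lattice_path_path_of)
  have rel: "multichain_rel r \<iota> p q \<longleftrightarrow> path_rel r ?L P p q"
    if "p \<in> multichains r P" "q \<in> multichains r P" for p q
    using multichain_rel_iff_path_rel[OF assms(3,4) that] .
  have K: "multichain_complex r \<iota> P = path_complex r ?L P"
    using multichain_complex_eq_path_complex[OF assms(3,4)] .
  have "geometric_subdivision (path_complex r ?L P) (order_complex P)"
    if refl: "reflp_on (multichains r P) (multichain_rel r \<iota>)"
  proof (cases "\<exists>x\<in>P. \<exists>y\<in>P. x < y")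
    case True
    then obtain x y where xy: "x \<in> P" "y \<in> P" "x < y" by blast
    have "(j, j) \<in> ?L" if "j \<le> r" for j
    proof -
      \<comment> \<open>The multichain with \<open>x\<close> in the first j positions and
        \<open>y\<close> afterwards has weight j at \<open>x\<close>, so reflexivity puts (j, j) on
        the path.\<close>
      let ?p = "block r j j j x y y y"
      have p: "?p \<in> multichains r P" using xy by (intro block_in_multichains) (auto simp: less_imp_le)
      then have "path_rel r ?L P ?p ?p" using refl rel by (simp add: reflp_on_def)
      moreover have "weight r x ?p = j"
        using weight_block[of j j j r x y y y x] xy(3) that by (auto simp: less_le_not_le)
      ultimately show ?thesis using xy(1) unfolding path_rel_def by metis
    qed
    then interpret diagonal_path r ?L by unfold_locales
    show ?thesis using assms(1,2) by (intro geometric_subdivision_path_complex) auto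
  next
    case False
    \<comment> \<open>\<open>?\<kappa>\<close> alternates vertical and horizontal steps, and its
      path contains the diagonal. For an antichain it may replace the given path.\<close>
    let ?\<kappa> = "\<lambda>t :: nat. 2 * t"
    have \<kappa>: "?\<kappa> \<in> {1..r} \<rightarrow> {1..2 * r}" "strict_mono_on {1..r} ?\<kappa>" by (auto simp: strict_mono_on_def)
    interpret D: lattice_path r "path_of r ?\<kappa>" using \<kappa> by (rule lattice_path_path_of)
    interpret D: diagonal_path r "path_of r ?\<kappa>"
      by unfold_locales (auto simp: path_of_def)
    have "path_complex r ?L P = path_complex r (path_of r ?\<kappa>) P"
      using path_complex_antichain[OF lattice_path_axioms, of P] path_complex_antichain[OF D.lattice_path_axioms, of P] False
      by simp
    then show ?thesis using D.geometric_subdivision_path_complex[of P] assms(1,2) by simp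
  qed
  moreover have "geometric_realization (path_complex r ?L P) homeomorphic geometric_realization (order_complex P)"
    if "geometric_subdivision (path_complex r ?L P) (order_complex P)"
    using finite_complex_path_complex[OF assms(1)] that by (rule homeomorphic_if_geometric_subdivision)
  moreover have "reflp_on (multichains r P) (multichain_rel r \<iota>)"
    if homeo: "geometric_realization (path_complex r ?L P) homeomorphic geometric_realization (order_complex P)"
  proof (rule ccontr)
    assume "\<not> reflp_on (multichains r P) (multichain_rel r \<iota>)"
    then obtain p where p: "p \<in> multichains r P" "\<not> path_rel r ?L P p p"
      using rel by (auto simp: reflp_on_def)
    then obtain a where a: "a \<in> P" "(weight r a p, weight r a p) \<notin> ?L" by (auto simp: path_rel_def)
    let ?j = "weight r a p"
    \<comment> \<open>The missing diagonal point is not an end of the path, so the entries number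
      \<open>?j\<close> and \<open>?j + 1\<close> both exist; exactly the former is below
      \<open>a\<close>, which gives a strict inequality in \<open>P\<close>.\<close>
    have "?j \<noteq> 0" "?j \<noteq> r" using a(2) start finish by metis+
    then have j: "?j \<in> {1..r}" "Suc ?j \<in> {1..r}" using weight_le[of r a p] by auto
    have "p ?j \<le> a" "\<not> p (Suc ?j) \<le> a"
      using multichain_le_iff_weight[OF p(1)] j by auto
    moreover have "p ?j \<le> p (Suc ?j)" "p ?j \<in> P" "p (Suc ?j) \<in> P"
      using p(1) j by (auto simp: multichains_def mono_on_def)
    ultimately have "p ?j < p (Suc ?j)" by (auto simp: less_le)
    then show False
      using not_homeomorphic[OF assms(1) weight_le a(2) \<open>p ?j \<in> P\<close> \<open>p (Suc ?j) \<in> P\<close>] homeo by blast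
  qed
  ultimately show ?thesis unfolding K by blast
qed

end
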